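(* Let $n\geq 1$ be an integer. Then \[ \Pi_n=\sup\bigl\{ r(|P|)\,:\, P\in\mathcal{P}_n \text{ and } |P| \text{ is positive}\bigr\}, \] where, for a $d\times d$ matrix $P=(p_{ij})$, $r(|P|):=\min_{i=1,\ldots,d}\,\sum_{j=1}^d|p_{ij}|$.
   Context: All Banach spaces and matrices are real. For a finite-dimensional linear subspace $E$ of a Banach space $F$, $\Pi(E,F)$ denotes the minimal operator norm of a linear projection of $F$ onto $E$. The (absolute) projection constant of a finite-dimensional Banach space $E$ is $\Pi(E):=\Pi(E,\ell_\infty)$, where $E$ is regarded as a subspace of $\ell_\infty$ via a linear isometric embedding (the value does not depend on the embedding). The maximal projection constant of order $n$ is $\Pi_n:=\max\{\Pi(E): E \text{ a real Banach space},\ \dim(E)=n\}$. $\mathcal{P}_n$ is the set of all orthogonal projection matrices (real symmetric idempotent matrices) of rank $n$, of any size $d\times d$ with $d\geq n$. $|P|$ is the matrix obtained from $P$ by taking the absolute value of every entry; a matrix is positive if all its entries are strictly positive. *)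

theory Defs
  imports
    "HOL-Analysis.Bounded_Continuous_Function"
    "HOL-Analysis.Operator_Norm"
    "Jordan_Normal_Form.DL_Rank"
begin

definition is_projection_onto :: "'a::real_normed_vector set \<Rightarrow> ('a \<Rightarrow> 'a) \<Rightarrow> bool" where
  "is_projection_onto E Q \<longleftrightarrow> bounded_linear Q \<and> range Q = E \<and> (\<forall>x. Q (Q x) = Q x)"

text \<open>The ambient space F is the whole type. The least norm is attained whenever E is a
  finite-dimensional subspace.\<close>

definition rel_proj_const :: "'a::real_normed_vector set \<Rightarrow> real" where
  "rel_proj_const E = (LEAST c. c \<in> {onorm Q | Q. is_projection_onto E Q})"

text \<open>Every function on the discrete space of natural numbers is continuous, so this is the
  space of all bounded real sequences with the supremum norm.\<close>

type_synonym l_infty = "(nat, real) bcontfun"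

text \<open>A real Banach space of dimension n is represented, up to linear isometry, by its norm in
  coordinates with respect to a basis, that is, by an arbitrary norm on the space of real
  n-vectors. Completeness is automatic in finite dimension.\<close>

definition is_norm :: "nat \<Rightarrow> (real vec \<Rightarrow> real) \<Rightarrow> bool" where
  "is_norm n N \<longleftrightarrow>
     (\<forall>x \<in> carrier_vec n. 0 \<le> N x \<and> (N x = 0 \<longleftrightarrow> x = 0\<^sub>v n)) \<and>
     (\<forall>x \<in> carrier_vec n. \<forall>a. N (a \<cdot>\<^sub>v x) = \<bar>a\<bar> * N x) \<and>
     (\<forall>x \<in> carrier_vec n. \<forall>y \<in> carrier_vec n. N (x + y) \<le> N x + N y)"

definition is_isometric_embedding ::
    "nat \<Rightarrow> (real vec \<Rightarrow> real) \<Rightarrow> (real vec \<Rightarrow> l_infty) \<Rightarrow> bool" where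
  "is_isometric_embedding n N T \<longleftrightarrow>
     (\<forall>x \<in> carrier_vec n. \<forall>y \<in> carrier_vec n. T (x + y) = T x + T y) \<and>
     (\<forall>x \<in> carrier_vec n. \<forall>a. T (a \<cdot>\<^sub>v x) = a *\<^sub>R T x) \<and>
     (\<forall>x \<in> carrier_vec n. norm (T x) = N x)"

text \<open>An isometric embedding exists because the space is separable, and the value does not
  depend on which one is chosen.\<close>

definition abs_proj_const :: "nat \<Rightarrow> (real vec \<Rightarrow> real) \<Rightarrow> real" where
  "abs_proj_const n N =
     rel_proj_const ((SOME T. is_isometric_embedding n N T) ` carrier_vec n)"

definition max_proj_const :: "nat \<Rightarrow> real" where
  "max_proj_const n = (GREATEST c. c \<in> {abs_proj_const n N | N. is_norm n N})"

definition orth_proj_mats :: "nat \<Rightarrow> real mat set" where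
  "orth_proj_mats n =
     {P. \<exists>d\<ge>n. P \<in> carrier_mat d d \<and> transpose_mat P = P \<and> P * P = P \<and> vec_space.rank d P = n}"

definition abs_mat :: "real mat \<Rightarrow> real mat" where
  "abs_mat P = map_mat abs P"

definition positive_mat :: "real mat \<Rightarrow> bool" where
  "positive_mat A \<longleftrightarrow> (\<forall>i<dim_row A. \<forall>j<dim_col A. 0 < A $$ (i, j))"

definition min_row_sum :: "real mat \<Rightarrow> real" where
  "min_row_sum A = Min ((\<lambda>i. \<Sum>j<dim_col A. A $$ (i, j)) ` {..<dim_row A})"

end

theory Submission
  imports Defs "HOL-Analysis.Function_Topology"
begin

text \<open>Write an orthogonal projection of rank \<open>n\<close> as \<open>P = U U\<^sup>T\<close> with \<open>U\<close> having \<open>n\<close> orthonormal columns. The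
entries of \<open>P\<close> are then the Gram numbers of the rows of \<open>U\<close>. Let \<open>\<Lambda>\<close> be the supremum in question.

A norm of projection constant at least \<open>\<Lambda>\<close>. For a fixed size \<open>d\<close> choose \<open>U\<close> so that the sum of all
\<open>|p\<^sub>i\<^sub>j|\<close> is maximal, and let \<open>S\<close> be the sign matrix of \<open>P\<close>. Then \<open>P\<close> also maximises the linear functional
\<open>tr (S P)\<close>, so rotating one column of \<open>U\<close> shows that \<open>S\<close> maps the range of \<open>P\<close> into itself
(\<open>trace_maximizer_invariant\<close>). Hence \<open>tr (S Q)\<close> is the same for every linear projection \<open>Q\<close> onto that
range, and the entries of \<open>Q\<close> have absolute sum at least \<open>tr (S P)\<close>, the absolute sum of \<open>P\<close>
(\<open>projection_norm_lower_bound\<close>). So the range of \<open>P\<close> in \<open>\<ell>\<^sub>\<infinity>\<^sup>d\<close> has projection constant at least the mean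
row sum of \<open>|P|\<close>, and therefore at least the minimal row sum of \<open>|P'|\<close> for every competitor \<open>P'\<close> of
size \<open>d\<close>. Expressed in bases with uniformly bounded coefficients, the norms obtained in this way lie in
one compact set of norms. A cluster point has projection constant at least \<open>\<Lambda>\<close>, because a projection
for one norm becomes a projection of almost the same size for a nearby one (\<open>projection_transfer\<close>);
this is where Hahn-Banach extension is needed.

No norm has a larger one. A finite-dimensional subspace of \<open>\<ell>\<^sub>\<infinity>\<close> is almost isometric to its restriction
to finitely many coordinates. If all projections onto a subspace of \<open>\<ell>\<^sub>\<infinity>\<^sup>d\<close> had norm above \<open>c > \<Lambda>\<close>, the
minimax principle (\<open>minimax_weights\<close>) would give weights \<open>w\<close> for which the weighted mean of the row
norms exceeds \<open>c\<close> for all these projections at once. The projection that is orthogonal for the inner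
product with weights \<open>w\<close> turns this mean into \<open>\<Sum> t\<^sub>i t\<^sub>j |p\<^sub>i\<^sub>j|\<close> with \<open>t = sqrt w\<close> and \<open>P\<close> an orthogonal projection
of rank \<open>n\<close>. But such a quantity never exceeds \<open>\<Lambda>\<close> (\<open>weighted_gram_le_row_sum\<close>): a small perturbation,
after replicating coordinates, makes all entries of \<open>P\<close> nonzero; the Perron vector of \<open>|P|\<close> is at least
as good as \<open>t\<close> and makes all weighted row sums equal; and repeating rows of \<open>U\<close> with multiplicities
approximately proportional to the squared entries of that vector turns weighted row sums into plain ones.

That the least norm of a projection and the greatest projection constant are attained, so that the
descriptions by \<open>LEAST\<close> and \<open>GREATEST\<close> denote these numbers, follows from compactness in both
cases.\<close>

hide_const (open) VectorSpace.subspace LinearCombinations.module.span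
unbundle no vec_syntax

section \<open>Subspaces of a given finite dimension\<close>

text \<open>The dimension is part of the predicate, so that no separate finiteness assumption has to accompany
the library function \<open>dim\<close>, which is 0 on infinite-dimensional spaces.\<close>

definition fin_dim :: "nat \<Rightarrow> 'a::real_vector set \<Rightarrow> bool" where
  "fin_dim n E \<longleftrightarrow> (\<exists>B. finite B \<and> independent B \<and> span B = E \<and> card B = n)"

lemma fin_dim_subspace: "fin_dim n E \<Longrightarrow> subspace E"
  unfolding fin_dim_def by auto

lemma fin_dim_0: "fin_dim 0 E \<longleftrightarrow> E = {0}"
proof
  assume "E = {0}"
  then show "fin_dim 0 E"
    unfolding fin_dim_def by (intro exI[of _ "{}"]) (auto simp: independent_empty)
qed (auto simp: fin_dim_def)

lemma fin_dim_subset: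
  assumes "fin_dim n E" "subspace F" "F \<subseteq> E"
  obtains m where "fin_dim m F"
proof -
  obtain B where B: "finite B" "span B = E"
    using assms unfolding fin_dim_def by auto
  obtain A where A: "A \<subseteq> F" "independent A" "F \<subseteq> span A"
    using maximal_independent_subset by blast
  have "finite A"
    using independent_span_bound[of B A] A B assms by auto
  moreover have "span A = F"
    using A assms by (simp add: span_minimal subset_antisym)
  ultimately show thesis
    using A that unfolding fin_dim_def by blast
qed

lemma fin_dim_unique: "fin_dim m E \<Longrightarrow> fin_dim n E \<Longrightarrow> m = n"
  unfolding fin_dim_def by (metis dim_span_eq_card_independent)

lemma fin_dim_hyperplane:
  fixes f :: "'a::real_vector \<Rightarrow> real"
  assumes E: "fin_dim (Suc n) E" and f: "linear f" and b: "b \<in> E" "f b \<noteq> 0"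
  shows "fin_dim n {x \<in> E. f x = 0}"
proof -
  interpret f: linear f by fact
  let ?F = "{x \<in> E. f x = 0}"
  have sE: "subspace E" using E by (rule fin_dim_subspace)
  then have sF: "subspace ?F"
    by (auto simp: real_vector.subspace_def f.add f.scaleR f.zero)
  obtain m where m: "fin_dim m ?F"
    using fin_dim_subset[OF E sF] by blast
  then obtain B where B: "finite B" "independent B" "span B = ?F" "card B = m"
    unfolding fin_dim_def by blast
  have bB: "b \<notin> span B" using B b by auto
  then have "b \<notin> B" using span_base by blast
  have "x \<in> span (insert b B)" if "x \<in> E" for x
  proof -
    have "x - (f x / f b) *\<^sub>R b \<in> ?F"
      using that b sE by (auto simp: f.diff f.scaleR subspace_diff subspace_scale)
    then show ?thesis using B span_breakdown_eq by blast
  qed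
  moreover have "span (insert b B) \<subseteq> E"
    using b B sE span_base by (intro span_minimal) fastforce+
  ultimately have "span (insert b B) = E" by blast
  moreover have "independent (insert b B)"
    using bB B independent_insertI by blast
  ultimately have "fin_dim (Suc m) E"
    using B \<open>b \<notin> B\<close> unfolding fin_dim_def by (intro exI[of _ "insert b B"]) auto
  then have "m = n" using E fin_dim_unique by blast
  then show ?thesis using m by simp
qed

lemma fin_dim_linear_image:
  assumes "fin_dim n E" "linear f" "inj_on f E"
  shows "fin_dim n (f ` E)"
proof -
  interpret f: linear f by fact
  obtain B where B: "finite B" "independent B" "span B = E" "card B = n"
    using assms unfolding fin_dim_def by auto
  have "independent (f ` B)"
    using linear_independent_injective_image[OF assms(2), of B] B assms by simp
  moreover have "span (f ` B) = f ` E"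
    using linear_span_image[OF assms(2), of B] B by simp
  moreover have "card (f ` B) = n"
    using B assms card_image inj_on_subset span_superset by metis
  ultimately show ?thesis
    using B unfolding fin_dim_def by blast
qed

lemma fin_dim_combinations:
  fixes b :: "nat \<Rightarrow> 'a::real_vector"
  assumes "\<And>a. (\<Sum>k<n. a k *\<^sub>R b k) = 0 \<Longrightarrow> \<forall>k<n. a k = 0"
  shows "fin_dim n {\<Sum>k<n. a k *\<^sub>R b k | a. True}"
proof -
  have inj: "inj_on b {..<n}"
  proof (rule inj_onI, rule ccontr)
    fix k l assume kl: "k \<in> {..<n}" "l \<in> {..<n}" "b k = b l" "k \<noteq> l"
    let ?a = "\<lambda>i. if i = k then 1 else if i = l then - 1 else (0::real)"
    have "(\<Sum>i<n. ?a i *\<^sub>R b i) = (\<Sum>i\<in>{k,l}. ?a i *\<^sub>R b i)"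
      using kl by (intro sum.mono_neutral_right) auto
    also have "\<dots> = 0" using kl by simp
    finally show False using assms[of ?a] kl by auto
  qed
  have "independent (b ` {..<n})"
  proof (rule independent_if_scalars_zero)
    fix u x assume "(\<Sum>x\<in>b ` {..<n}. u x *\<^sub>R x) = 0" "x \<in> b ` {..<n}"
    then show "u x = 0"
      using assms[of "\<lambda>k. u (b k)"] by (auto simp: sum.reindex[OF inj])
  qed simp
  moreover have "span (b ` {..<n}) = {\<Sum>k<n. a k *\<^sub>R b k | a. True}" (is "_ = ?R")
  proof
    show "?R \<subseteq> span (b ` {..<n})"
      by clarify (intro span_sum span_scale span_base, auto)
    have "\<exists>a'. (\<Sum>x\<in>b ` {..<n}. a x *\<^sub>R x) = (\<Sum>k<n. a' k *\<^sub>R b k)" for a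
      by (auto simp: sum.reindex[OF inj])
    then show "span (b ` {..<n}) \<subseteq> ?R"
      by (auto simp: span_finite)
  qed
  ultimately show ?thesis
    unfolding fin_dim_def using card_image[OF inj] by (intro exI[of _ "b ` {..<n}"]) auto
qed

text \<open>Splitting off one vector together with a functional that equals 1 on it, and passing to the kernel of
the functional, lowers the dimension by one. The relation \<open>R\<close> records what is wanted of each
pair: with \<open>f = \<langle>b, \<cdot>\<rangle>\<close> this is the Gram-Schmidt process, and with bounds on \<open>b\<close> and
\<open>f\<close> it yields a basis with bounded coefficients.\<close>

lemma triangular_basis:
  fixes E :: "'a::real_vector set" and R :: "('a \<Rightarrow> real) \<Rightarrow> 'a \<Rightarrow> bool"
  assumes "fin_dim n E"
    and "\<And>x. x \<in> E \<Longrightarrow> x \<noteq> 0 \<Longrightarrow> \<exists>r f. r *\<^sub>R x \<in> E \<and> linear f \<and> f (r *\<^sub>R x) = 1 \<and> R f (r *\<^sub>R x)"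
  shows "\<exists>b f. (\<forall>k<n. b k \<in> E \<and> linear (f k) \<and> f k (b k) = 1 \<and> R (f k) (b k)) \<and>
    (\<forall>k l. k < l \<and> l < n \<longrightarrow> f k (b l) = 0) \<and> (\<forall>x\<in>E. \<exists>a. x = (\<Sum>k<n. a k *\<^sub>R b k))"
  using assms
proof (induction n arbitrary: E)
  case 0
  then show ?case by (auto simp: fin_dim_0)
next
  case (Suc n)
  have "E \<noteq> {0}" using Suc.prems(1) fin_dim_unique fin_dim_0 by blast
  moreover have sE: "subspace E" using Suc.prems(1) by (rule fin_dim_subspace)
  ultimately obtain x where "x \<in> E" "x \<noteq> 0" using subspace_0 by blast
  then obtain r f where f: "r *\<^sub>R x \<in> E" "linear f" "f (r *\<^sub>R x) = 1" "R f (r *\<^sub>R x)"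
    using Suc.prems(2) by blast
  define b where "b = r *\<^sub>R x"
  note f = f[folded b_def]
  interpret f: linear f by (rule f)
  let ?F = "{x \<in> E. f x = 0}"
  have "fin_dim n ?F" using f Suc.prems(1) by (intro fin_dim_hyperplane) auto
  moreover have "\<exists>r f. r *\<^sub>R y \<in> ?F \<and> linear f \<and> f (r *\<^sub>R y) = 1 \<and> R f (r *\<^sub>R y)"
    if y: "y \<in> ?F" "y \<noteq> 0" for y
  proof -
    obtain r g where "r *\<^sub>R y \<in> E" "linear g" "g (r *\<^sub>R y) = 1" "R g (r *\<^sub>R y)"
      using y Suc.prems(2)[of y] by auto
    then show ?thesis using that by (intro exI[of _ r] exI[of _ g]) (auto simp: f.scaleR)
  qed
  ultimately obtain b' f' where IH:
    "\<forall>k<n. b' k \<in> ?F \<and> linear (f' k) \<and> f' k (b' k) = 1 \<and> R (f' k) (b' k)"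
    "\<forall>k l. k < l \<and> l < n \<longrightarrow> f' k (b' l) = 0" "\<forall>x\<in>?F. \<exists>a. x = (\<Sum>k<n. a k *\<^sub>R b' k)"
    using Suc.IH[of ?F] by blast
  let ?b = "case_nat b b'" and ?f = "case_nat f f'"
  have "\<forall>k<Suc n. ?b k \<in> E \<and> linear (?f k) \<and> ?f k (?b k) = 1 \<and> R (?f k) (?b k)"
    using IH f by (auto split: nat.split)
  moreover have "\<forall>k l. k < l \<and> l < Suc n \<longrightarrow> ?f k (?b l) = 0"
    using IH by (auto split: nat.split)
  moreover have "\<exists>a. x = (\<Sum>k<Suc n. a k *\<^sub>R ?b k)" if "x \<in> E" for x
  proof -
    have "x - f x *\<^sub>R b \<in> ?F"
      using that f sE by (auto simp: f.diff f.scaleR subspace_diff subspace_scale)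
    then obtain a where "x - f x *\<^sub>R b = (\<Sum>k<n. a k *\<^sub>R b' k)" using IH by blast
    then have "x = (\<Sum>k<Suc n. case_nat (f x) a k *\<^sub>R ?b k)"
      by (simp add: sum.lessThan_Suc_shift algebra_simps del: sum.lessThan_Suc)
    then show ?thesis by blast
  qed
  ultimately show ?case
    by (intro exI[of _ ?b] exI[of _ ?f]) auto
qed

subsection \<open>Hahn-Banach\<close>

section \<open>Extension of functionals by finitely many dimensions\<close>

definition linear_on :: "'a::real_vector set \<Rightarrow> ('a \<Rightarrow> real) \<Rightarrow> bool" where
  "linear_on V f \<longleftrightarrow> (\<forall>x\<in>V. \<forall>y\<in>V. f (x + y) = f x + f y) \<and> (\<forall>x\<in>V. \<forall>c. f (c *\<^sub>R x) = c * f x)"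

text \<open>The value \<open>\<alpha>\<close> of the extension at the new vector \<open>v\<close> can be any number between all
\<open>f x - p (x - v)\<close> and all \<open>p (y + v) - f y\<close>; subadditivity of \<open>p\<close> leaves room for it.\<close>

lemma hahn_banach_step:
  fixes p :: "'a::real_vector \<Rightarrow> real"
  assumes p: "\<And>x y. p (x + y) \<le> p x + p y" "\<And>c x. p (c *\<^sub>R x) = \<bar>c\<bar> * p x"
    and V: "subspace V" and f: "linear_on V f" "\<And>x. x \<in> V \<Longrightarrow> f x \<le> p x"
  shows "\<exists>g. linear_on (span (insert v V)) g \<and> (\<forall>x\<in>V. g x = f x) \<and> (\<forall>x\<in>span (insert v V). g x \<le> p x)"
proof (cases "v \<in> V")
  case True
  then have "span (insert v V) = V" using V by (simp add: insert_absorb)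
  then show ?thesis using f by auto
next
  case False
  have sV: "span V = V" using V by simp
  have add: "f (x + y) = f x + f y" if "x \<in> V" "y \<in> V" for x y
    using that f(1) unfolding linear_on_def by blast
  have scale: "f (c *\<^sub>R x) = c * f x" if "x \<in> V" for c x
    using that f(1) unfolding linear_on_def by blast
  have key: "f x - p (x - v) \<le> p (y + v) - f y" if "x \<in> V" "y \<in> V" for x y
  proof -
    have "f x + f y = f (x + y)" using add that by simp
    also have "\<dots> \<le> p ((x - v) + (y + v))" using f(2)[of "x + y"] that V subspace_add by fastforce
    also have "\<dots> \<le> p (x - v) + p (y + v)" by (rule p)
    finally show ?thesis by simp
  qed
  define \<alpha> where "\<alpha> = Sup ((\<lambda>x. f x - p (x - v)) ` V)"
  have V0: "0 \<in> V" using V subspace_0 by blast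
  have lo: "f x - p (x - v) \<le> \<alpha>" if "x \<in> V" for x
    unfolding \<alpha>_def using that key[OF _ V0]
    by (intro cSup_upper) (auto intro!: bdd_aboveI[of _ "p (0 + v) - f 0"])
  have hi: "\<alpha> \<le> p (y + v) - f y" if "y \<in> V" for y
    unfolding \<alpha>_def using that key V0 by (intro cSup_least) auto
  define k where "k z = (THE k. z - k *\<^sub>R v \<in> V)" for z
  have k: "k z = c" if "z - c *\<^sub>R v \<in> V" for z c
    unfolding k_def
  proof (rule the_equality)
    fix c' assume "z - c' *\<^sub>R v \<in> V"
    then have "(z - c *\<^sub>R v) - (z - c' *\<^sub>R v) \<in> V" using that V subspace_diff by blast
    then have *: "(c' - c) *\<^sub>R v \<in> V" by (simp add: algebra_simps)
    show "c' = c"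
    proof (rule ccontr)
      assume "c' \<noteq> c"
      then show False using False V * subspace_scale[of V "(c' - c) *\<^sub>R v" "1 / (c' - c)"] by simp
    qed
  qed fact
  have ex: "\<exists>c. z - c *\<^sub>R v \<in> V \<and> k z = c" if "z \<in> span (insert v V)" for z
    using that k unfolding span_breakdown_eq sV by blast
  define g where "g z = f (z - k z *\<^sub>R v) + k z * \<alpha>" for z
  have g: "g (x + c *\<^sub>R v) = f x + c * \<alpha>" if "x \<in> V" for x c
    using that k[of "x + c *\<^sub>R v" c] unfolding g_def by simp
  have dec: "\<exists>x\<in>V. \<exists>c. z = x + c *\<^sub>R v" if "z \<in> span (insert v V)" for z
    using ex[OF that] by (metis diff_add_cancel)
  have "linear_on (span (insert v V)) g"
    unfolding linear_on_def
  proof (intro conjI ballI allI)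
    fix z z' assume "z \<in> span (insert v V)" "z' \<in> span (insert v V)"
    then obtain x c x' c' where *: "x \<in> V" "x' \<in> V" "z = x + c *\<^sub>R v" "z' = x' + c' *\<^sub>R v"
      using dec by metis
    then have zz: "z + z' = (x + x') + (c + c') *\<^sub>R v" by (simp add: algebra_simps)
    have "g (z + z') = f (x + x') + (c + c') * \<alpha>"
      unfolding zz by (rule g[OF subspace_add[OF V *(1,2)]])
    then show "g (z + z') = g z + g z'"
      using g[OF *(1), of c] g[OF *(2), of c'] add[OF *(1,2)] *(3,4) by (simp add: algebra_simps)
  next
    fix z r assume "z \<in> span (insert v V)"
    then obtain x c where *: "x \<in> V" "z = x + c *\<^sub>R v" using dec by metis
    then have rz: "r *\<^sub>R z = r *\<^sub>R x + (r * c) *\<^sub>R v" by (simp add: algebra_simps)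
    have "g (r *\<^sub>R z) = f (r *\<^sub>R x) + r * c * \<alpha>"
      unfolding rz by (rule g[OF subspace_scale[OF V *(1)]])
    then show "g (r *\<^sub>R z) = r * g z"
      using g[OF *(1), of c] scale[OF *(1)] *(2) by (simp add: distrib_left)
  qed
  moreover have "g x = f x" if "x \<in> V" for x using g[OF that, of 0] by simp
  moreover have "g z \<le> p z" if "z \<in> span (insert v V)" for z
  proof -
    obtain x c where x: "x \<in> V" and z: "z = x + c *\<^sub>R v" using dec \<open>z \<in> _\<close> by metis
    consider "c = 0" | "c > 0" | "c < 0" by linarith
    then show ?thesis
    proof cases
      case 1
      then show ?thesis using g[OF x, of c] z f(2)[OF x] by simp
    next
      case 2
      let ?y = "(1 / c) *\<^sub>R x"
      have y: "?y \<in> V" using x V subspace_scale by blast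
      have "c * \<alpha> \<le> c * (p (?y + v) - f ?y)" using hi[OF y] 2 by simp
      also have "\<dots> = p (c *\<^sub>R (?y + v)) - f x" using 2 scale[OF x] p(2)[of c "?y + v"] by (simp add: right_diff_distrib)
      also have "c *\<^sub>R (?y + v) = z" using 2 z by (simp add: algebra_simps)
      finally show ?thesis using g[OF x, of c] z by simp
    next
      case 3
      let ?y = "(1 / (- c)) *\<^sub>R x"
      have y: "?y \<in> V" using x V subspace_scale by blast
      have "(- c) * (f ?y - p (?y - v)) \<le> (- c) * \<alpha>" using lo[OF y] 3 by (intro mult_left_mono) auto
      moreover have "(- c) * (f ?y - p (?y - v)) = f x - p ((- c) *\<^sub>R (?y - v))"
        using 3 scale[OF x, of "1 / (- c)"] p(2)[of "- c" "?y - v"] by (simp add: right_diff_distrib)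
      moreover have "(- c) *\<^sub>R (?y - v) = z" using 3 z by (simp add: algebra_simps)
      ultimately show ?thesis using g[OF x, of c] z by simp
    qed
  qed
  ultimately show ?thesis by (intro exI[of _ g]) auto
qed

lemma hahn_banach_finite:
  fixes p :: "'a::real_vector \<Rightarrow> real"
  assumes p: "\<And>x y. p (x + y) \<le> p x + p y" "\<And>c x. p (c *\<^sub>R x) = \<bar>c\<bar> * p x"
    and V: "subspace V" and f: "linear_on V f" "\<And>x. x \<in> V \<Longrightarrow> f x \<le> p x" and S: "finite S"
  obtains g where "linear_on (span (S \<union> V)) g" "\<And>x. x \<in> V \<Longrightarrow> g x = f x"
    "\<And>x. x \<in> span (S \<union> V) \<Longrightarrow> \<bar>g x\<bar> \<le> p x"
proof -
  have "\<exists>g. linear_on (span (S \<union> V)) g \<and> (\<forall>x\<in>V. g x = f x) \<and> (\<forall>x\<in>span (S \<union> V). g x \<le> p x)"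
    using S
  proof induction
    case empty
    have sV: "span V = V" using V by simp
    show ?case unfolding Un_empty_left sV using f by blast
  next
    case (insert v S)
    then obtain g where g: "linear_on (span (S \<union> V)) g" "\<forall>x\<in>V. g x = f x" "\<forall>x\<in>span (S \<union> V). g x \<le> p x"
      by blast
    have eq: "span (insert v (span (S \<union> V))) = span (insert v S \<union> V)"
      proof (rule subset_antisym)
      show "span (insert v (span (S \<union> V))) \<subseteq> span (insert v S \<union> V)"
        using span_mono[of "S \<union> V" "insert v S \<union> V"]
        by (intro span_minimal subspace_span) (auto intro: span_base)
      show "span (insert v S \<union> V) \<subseteq> span (insert v (span (S \<union> V)))"
        by (intro span_mono) (auto intro: span_base)
    qed
    obtain h where h: "linear_on (span (insert v S \<union> V)) h" "\<forall>x\<in>span (S \<union> V). h x = g x"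
      "\<forall>x\<in>span (insert v S \<union> V). h x \<le> p x"
      using hahn_banach_step[where p = p and v = v and V = "span (S \<union> V)" and f = g, OF p subspace_span g(1)] g(3)
      unfolding eq by blast
    have "\<forall>x\<in>V. h x = f x" using h g span_base by (metis UnI2)
    then show ?case using h by blast
  qed
  then obtain g where g: "linear_on (span (S \<union> V)) g" "\<forall>x\<in>V. g x = f x" "\<forall>x\<in>span (S \<union> V). g x \<le> p x"
    by blast
  have "\<bar>g x\<bar> \<le> p x" if "x \<in> span (S \<union> V)" for x
  proof -
    have "- g x = g ((- 1) *\<^sub>R x)" using g(1) that unfolding linear_on_def by (metis mult_minus1)
    also have "\<dots> \<le> p ((- 1) *\<^sub>R x)" using g(3) that span_scale by blast
    also have "\<dots> = p x" using p(2)[of "- 1" x] by simp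
    finally show ?thesis using g(3) that by fastforce
  qed
  then show thesis using that g by blast
qed

section \<open>Compactness for pointwise convergence\<close>

lemma compact_coordinatewise:
  fixes K :: "'i \<Rightarrow> 'b::topological_space set"
  assumes "\<And>i. compact (K i)"
  shows "compact {f. \<forall>i. f i \<in> K i}"
proof -
  have "{f. \<forall>i. f i \<in> K i} = PiE UNIV K" by (auto simp: PiE_def Pi_def)
  moreover have "compactin (product_topology (\<lambda>_. euclidean) UNIV) (PiE UNIV K)"
    using assms by (simp add: compactin_PiE)
  ultimately show ?thesis
    by (simp add: euclidean_product_topology)
qed

lemma continuous_on_eval [continuous_intros]:
  "continuous_on S (\<lambda>f::'i \<Rightarrow> 'b::topological_space. f i)"
  by (rule continuous_on_subset[OF continuous_on_product_coordinates subset_UNIV])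

lemma continuous_on_eval2 [continuous_intros]:
  "continuous_on S (\<lambda>f::'i \<Rightarrow> 'j \<Rightarrow> 'b::topological_space. f i j)"
  by (rule continuous_on_product_then_coordinatewise[where f = "\<lambda>f. f i", OF continuous_on_eval])


section \<open>Finite-dimensional subspaces of the space of bounded sequences\<close>

text \<open>The space \<open>\<real>\<^sup>d\<close> is modelled by the sequences that vanish from position \<open>d\<close> on. This keeps all
dimensions in one type, which is also a normed space with the right norm.\<close>

definition fseq :: "nat \<Rightarrow> (nat \<Rightarrow> real) \<Rightarrow> l_infty" where
  "fseq d f = Bcontfun (\<lambda>i. if i < d then f i else 0)"

lemma bcontfun_natI: "(\<And>i::nat. \<bar>f i\<bar> \<le> c) \<Longrightarrow> f \<in> bcontfun" for f :: "nat \<Rightarrow> real"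
  by (rule bcontfun_normI[of f c]) simp_all

lemma fseq_apply [simp]: "apply_bcontfun (fseq d f) i = (if i < d then f i else 0)"
proof -
  have "(\<lambda>i. if i < d then f i else 0) \<in> bcontfun"
  proof (rule bcontfun_natI)
    fix i
    show "\<bar>if i < d then f i else 0\<bar> \<le> (\<Sum>i<d. \<bar>f i\<bar>)"
      using member_le_sum[of i "{..<d}" "\<lambda>i. \<bar>f i\<bar>"] by (simp add: sum_nonneg)
  qed
  then show ?thesis unfolding fseq_def by (simp add: Bcontfun_inverse)
qed

lemma coord_le_norm: "\<bar>apply_bcontfun x i\<bar> \<le> norm x" for x :: l_infty
  using norm_bounded[of x i] by simp

lemma norm_leI: "(\<And>i. \<bar>apply_bcontfun x i\<bar> \<le> c) \<Longrightarrow> norm x \<le> c" for x :: l_infty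
  by (rule norm_bound) simp

lemma norm_fseq_le: "0 \<le> c \<Longrightarrow> (\<And>i. i < d \<Longrightarrow> \<bar>f i\<bar> \<le> c) \<Longrightarrow> norm (fseq d f) \<le> c"
  by (rule norm_leI) auto

lemma sum_apply_bcontfun [simp]:
  "apply_bcontfun (\<Sum>k\<in>A. f k) i = (\<Sum>k\<in>A. apply_bcontfun (f k) i)" for f :: "'k \<Rightarrow> l_infty"
  by (induction A rule: infinite_finite_induct) auto

lemma linear_coord: "linear (\<lambda>x::l_infty. c * apply_bcontfun x i)"
  by (rule linearI) (simp_all add: algebra_simps)

lemma linear_fseq: "linear (\<lambda>x::l_infty. fseq d (apply_bcontfun x))"
  by (rule linearI; rule bcontfun_eqI; simp)

lemma continuous_on_coord: "continuous_on S (\<lambda>x::l_infty. apply_bcontfun x i)"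
proof -
  have "bounded_linear (\<lambda>x::l_infty. apply_bcontfun x i)"
    by (rule bounded_linear_intro[of _ 1]) (auto simp: coord_le_norm)
  then show ?thesis by (rule linear_continuous_on)
qed

text \<open>A weak Auerbach basis. Each basis vector has norm 1 and is paired with a multiple of a coordinate
functional at a position where it exceeds half its norm, which bounds the functional by 2; solving the
triangular system for the coefficients then costs a factor 3 at each step. What matters is that the
bound depends on the dimension only.\<close>

lemma bounded_coefficient_basis:
  fixes E :: "l_infty set"
  assumes "fin_dim n E"
  obtains b where "\<And>k. k < n \<Longrightarrow> b k \<in> E" "\<And>k. k < n \<Longrightarrow> norm (b k) \<le> 1"
    "\<And>x. x \<in> E \<Longrightarrow> \<exists>a. x = (\<Sum>k<n. a k *\<^sub>R b k)"
    "\<And>a k. k < n \<Longrightarrow> \<bar>a k\<bar> \<le> 2 * 3 ^ n * norm (\<Sum>k<n. a k *\<^sub>R b k)"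
proof -
  let ?R = "\<lambda>f b. norm b \<le> 1 \<and> (\<forall>x. \<bar>f x\<bar> \<le> 2 * norm x)"
  have "\<exists>r f. r *\<^sub>R x \<in> E \<and> linear f \<and> f (r *\<^sub>R x) = (1::real) \<and> ?R f (r *\<^sub>R x)"
    if x: "x \<in> E" "x \<noteq> 0" for x
  proof -
    \<comment> \<open>the supremum need not be attained, so half of it is asked for\<close>
    obtain i where i: "\<bar>apply_bcontfun x i\<bar> > norm x / 2"
    proof (rule ccontr)
      assume "\<not> thesis"
      then have "norm x \<le> norm x / 2" using that by (intro norm_leI) (metis not_le)
      then show False using x by simp
    qed
    let ?r = "1 / norm x" and ?c = "norm x / apply_bcontfun x i"
    have xi: "apply_bcontfun x i \<noteq> 0" using i x by auto
    have c: "\<bar>?c\<bar> \<le> 2" using i xi by (simp add: abs_divide field_simps)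
    have "\<bar>?c * apply_bcontfun y i\<bar> \<le> 2 * norm y" for y
      unfolding abs_mult using c coord_le_norm by (intro mult_mono) auto
    moreover have "?r *\<^sub>R x \<in> E" using x assms fin_dim_subspace subspace_scale by blast
    moreover have "?c * apply_bcontfun (?r *\<^sub>R x) i = 1" using x xi by simp
    ultimately show ?thesis
      using linear_coord[of ?c i] x by (intro exI[of _ ?r] exI[of _ "\<lambda>y. ?c * apply_bcontfun y i"]) auto
  qed
  from triangular_basis[of n E ?R, OF assms this] obtain b f where b:
    "\<forall>k<n. b k \<in> E \<and> linear (f k) \<and> f k (b k) = 1 \<and> ?R (f k) (b k)"
    "\<forall>k l. k < l \<and> l < n \<longrightarrow> f k (b l) = 0" "\<forall>x\<in>E. \<exists>a. x = (\<Sum>k<n. a k *\<^sub>R b k)"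
    by blast
  have "\<bar>a k\<bar> \<le> 2 * 3 ^ k * norm (\<Sum>k<n. a k *\<^sub>R b k)" (is "_ \<le> _ * norm ?x") if "k < n" for a k
    using that
  proof (induction k rule: less_induct)
    case (less k)
    interpret f: linear "f k" using b less by blast
    have "f k ?x = (\<Sum>l<n. a l * f k (b l))" by (simp add: f.sum f.scaleR)
    also have "\<dots> = (\<Sum>l<Suc k. a l * f k (b l))"
      using less b by (intro sum.mono_neutral_right) auto
    also have "\<dots> = a k + (\<Sum>l<k. a l * f k (b l))" using less b by simp
    finally have "\<bar>a k\<bar> \<le> \<bar>f k ?x\<bar> + \<bar>\<Sum>l<k. a l * f k (b l)\<bar>" by linarith
    also have "\<bar>f k ?x\<bar> \<le> 2 * norm ?x" using less b by blast
    also have "\<bar>\<Sum>l<k. a l * f k (b l)\<bar> \<le> (\<Sum>l<k. (2 * 3 ^ l * norm ?x) * 2)"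
    proof (intro order.trans[OF sum_abs] sum_mono)
      fix l assume l: "l \<in> {..<k}"
      have "\<bar>f k (b l)\<bar> \<le> 2 * norm (b l)" using b less by blast
      also have "\<dots> \<le> 2" using b less l by auto
      finally show "\<bar>a l * f k (b l)\<bar> \<le> (2 * 3 ^ l * norm ?x) * 2"
        unfolding abs_mult using less l by (intro mult_mono) auto
    qed
    also have "(\<Sum>l<k. (2 * 3 ^ l * norm ?x) * 2) = (\<Sum>l<k. 3 ^ l * (4 * norm ?x))"
      by (intro sum.cong) auto
    also have "\<dots> = (3 ^ k - 1) / 2 * (4 * norm ?x)"
      unfolding sum_distrib_right[symmetric] using geometric_sum[of "3::real" k] by simp
    also have "2 * norm ?x + \<dots> = 2 * 3 ^ k * norm ?x" by (simp add: field_simps)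
    finally show ?case by simp
  qed
  moreover have "2 * 3 ^ k * norm y \<le> 2 * 3 ^ n * norm y" if "k < n" for k and y :: l_infty
    using that by (intro mult_right_mono mult_left_mono power_increasing) auto
  ultimately have bound: "\<bar>a k\<bar> \<le> 2 * 3 ^ n * norm (\<Sum>k<n. a k *\<^sub>R b k)" if "k < n" for a k
    using that order.trans by blast
  show thesis by (rule that[OF _ _ _ bound]) (use b in auto)
qed

definition orthonormal :: "'i set \<Rightarrow> nat \<Rightarrow> ('i \<Rightarrow> nat \<Rightarrow> real) \<Rightarrow> bool" where
  "orthonormal I n U \<longleftrightarrow> (\<forall>k<n. \<forall>l<n. (\<Sum>i\<in>I. U i k * U i l) = (if k = l then 1 else 0))"

text \<open>The entry of \<open>U U\<^sup>T\<close> at \<open>(i, j)\<close>.\<close>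

definition gram :: "nat \<Rightarrow> ('i \<Rightarrow> nat \<Rightarrow> real) \<Rightarrow> 'i \<Rightarrow> 'i \<Rightarrow> real" where
  "gram n U i j = (\<Sum>k<n. U i k * U j k)"

lemma orthonormal_independent:
  assumes U: "orthonormal I n U" and z: "\<And>i. i \<in> I \<Longrightarrow> (\<Sum>k<n. a k * U i k) = 0" and l: "l < n"
  shows "a l = 0"
proof -
  have "a l = (\<Sum>k<n. if k = l then a k else 0)" using l by simp
  also have "\<dots> = (\<Sum>k<n. a k * (\<Sum>i\<in>I. U i l * U i k))"
    using U l by (intro sum.cong refl) (auto simp: orthonormal_def)
  also have "\<dots> = (\<Sum>i\<in>I. U i l * (\<Sum>k<n. a k * U i k))"
    unfolding sum_distrib_left by (subst sum.swap) (simp add: mult_ac)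
  also have "\<dots> = 0" using z by simp
  finally show ?thesis .
qed

lemma column_in_span:
  fixes l n :: nat
  assumes "l < n"
  shows "fseq d (\<lambda>i. U i l) \<in> {fseq d (\<lambda>i. \<Sum>k<n. a k * U i k) | a. True}"
proof -
  have "fseq d (\<lambda>i. U i l) = fseq d (\<lambda>i. \<Sum>k<n. (if k = l then 1 else 0) * U i k)"
    using assms by (simp add: if_distrib[of "\<lambda>x. x * _"] cong: if_cong)
  then show ?thesis by (intro CollectI exI[of _ "\<lambda>k. if k = l then 1 else 0"]) simp
qed

lemma orthonormal_span_fin_dim:
  assumes U: "orthonormal {..<d} n U"
  shows "fin_dim n {fseq d (\<lambda>i. \<Sum>k<n. a k * U i k) | a. True}"
proof -
  let ?u = "\<lambda>k. fseq d (\<lambda>i. U i k)"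
  have comb: "(\<Sum>k<n. a k *\<^sub>R ?u k) = fseq d (\<lambda>i. \<Sum>k<n. a k * U i k)" for a
    by (rule bcontfun_eqI) simp
  have "fin_dim n {\<Sum>k<n. a k *\<^sub>R ?u k | a. True}"
  proof (rule fin_dim_combinations)
    fix a assume a: "(\<Sum>k<n. a k *\<^sub>R ?u k) = 0"
    have "(\<Sum>k<n. a k * U i k) = 0" if "i \<in> {..<d}" for i
      using arg_cong[OF a, of "\<lambda>x. apply_bcontfun x i"] that unfolding comb by simp
    then show "\<forall>k<n. a k = 0" using orthonormal_independent[OF U] by blast
  qed
  then show ?thesis unfolding comb .
qed

lemma gram_schmidt_fin_dim:
  fixes E :: "l_infty set"
  assumes E: "fin_dim n E" and supp: "\<And>x i. x \<in> E \<Longrightarrow> d \<le> i \<Longrightarrow> apply_bcontfun x i = 0"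
  obtains U where "orthonormal {..<d} n U" "E = {fseq d (\<lambda>i. \<Sum>k<n. a k * U i k) | a. True}"
proof -
  have sE: "subspace E" using E by (rule fin_dim_subspace)
  let ?ip = "\<lambda>b x. \<Sum>i<d. apply_bcontfun b i * apply_bcontfun x i :: real"
  let ?R = "\<lambda>f b. f = ?ip b"
  have lin: "linear (?ip b)" for b
    by (auto intro!: linearI simp: algebra_simps sum.distrib sum_distrib_left)
  have "\<exists>r f. r *\<^sub>R x \<in> E \<and> linear f \<and> f (r *\<^sub>R x) = 1 \<and> ?R f (r *\<^sub>R x)"
    if x: "x \<in> E" "x \<noteq> 0" for x
  proof -
    obtain i where i: "apply_bcontfun x i \<noteq> 0" using x by (metis bcontfun_eqI zero_bcontfun.rep_eq)
    then have "i < d" using supp[of x i] x(1) not_le by blast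
    have pos: "?ip x x > 0"
      using i \<open>i < d\<close> by (intro sum_pos2[of _ i]) (auto simp: zero_less_mult_iff)
    let ?r = "1 / sqrt (?ip x x)"
    have "?ip (r *\<^sub>R x) (r *\<^sub>R x) = r * r * ?ip x x" for r
      by (simp add: sum_distrib_left mult_ac)
    then have "?ip (?r *\<^sub>R x) (?r *\<^sub>R x) = ?r * ?r * ?ip x x" .
    also have "\<dots> = 1" using pos by simp
    finally show ?thesis
      using x sE lin[of "?r *\<^sub>R x"] subspace_scale by (intro exI[of _ ?r] exI[of _ "?ip (?r *\<^sub>R x)"]) blast
  qed
  from triangular_basis[of n E ?R, OF assms(1) this] obtain b f where
    "\<forall>k<n. b k \<in> E \<and> linear (f k) \<and> f k (b k) = 1 \<and> ?R (f k) (b k)"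
    "\<forall>k l. k < l \<and> l < n \<longrightarrow> f k (b l) = 0" and gen: "\<forall>x\<in>E. \<exists>a. x = (\<Sum>k<n. a k *\<^sub>R b k)"
    by blast
  then have b: "\<forall>k<n. b k \<in> E" "\<forall>k<n. ?ip (b k) (b k) = 1" "\<forall>k l. k < l \<and> l < n \<longrightarrow> ?ip (b k) (b l) = 0"
    by auto
  let ?U = "\<lambda>i k. apply_bcontfun (b k) i"
  have "?ip (b k) (b l) = (if k = l then 1 else 0)" if "k < n" "l < n" for k l
  proof (cases "k < l")
    case False
    have "?ip (b k) (b l) = ?ip (b l) (b k)" by (simp add: mult.commute)
    then show ?thesis using b(2,3) that False by (cases "k = l") auto
  qed (use b(3) that in auto)
  then have "orthonormal {..<d} n ?U" by (auto simp: orthonormal_def)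
  moreover have eq: "fseq d (\<lambda>i. \<Sum>k<n. a k * ?U i k) = (\<Sum>k<n. a k *\<^sub>R b k)" for a
    using b supp by (intro bcontfun_eqI) (auto intro!: sum.neutral)
  have "(\<Sum>k<n. a k *\<^sub>R b k) \<in> E" for a
    using b sE by (intro subspace_sum subspace_scale) auto
  then have "E = {fseq d (\<lambda>i. \<Sum>k<n. a k * ?U i k) | a. True}"
    unfolding eq using gen by blast
  ultimately show thesis using that by blast
qed

lemma compact_fin_dim_ball:
  fixes E :: "l_infty set"
  assumes E: "fin_dim n E"
  shows "compact (E \<inter> {x. norm x \<le> r})"
proof -
  have sE: "subspace E" using E by (rule fin_dim_subspace)
  obtain b where bE: "\<And>k. k < n \<Longrightarrow> b k \<in> E" and gen: "\<And>x. x \<in> E \<Longrightarrow> \<exists>a. x = (\<Sum>k<n. a k *\<^sub>R b k)"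
    and bound: "\<And>a k. k < n \<Longrightarrow> \<bar>a k\<bar> \<le> 2 * 3 ^ n * norm (\<Sum>k<n. a k *\<^sub>R b k)"
    by (rule bounded_coefficient_basis[OF E]) blast
  let ?C = "2 * 3 ^ n * \<bar>r\<bar>"
  let ?K = "{a::nat\<Rightarrow>real. \<forall>k. a k \<in> {-?C..?C}}"
  let ?\<Phi> = "\<lambda>a. \<Sum>k<n. a k *\<^sub>R b k"
  have "compact ?K" by (rule compact_coordinatewise) simp
  then have "compact (?\<Phi> ` ?K)" by (intro compact_continuous_image continuous_intros)
  then have "compact (?\<Phi> ` ?K \<inter> {x. norm x \<le> r})"
    by (rule compact_Int_closed) (intro closed_Collect_le continuous_intros)
  moreover have "?\<Phi> ` ?K \<inter> {x. norm x \<le> r} = E \<inter> {x. norm x \<le> r}"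
  proof (intro subset_antisym subsetI IntI)
    fix x assume "x \<in> ?\<Phi> ` ?K \<inter> {x. norm x \<le> r}"
    then show "x \<in> E" using bE sE by (auto intro!: subspace_sum subspace_scale)
  next
    fix x assume x: "x \<in> E \<inter> {x. norm x \<le> r}"
    then obtain a where a: "x = ?\<Phi> a" using gen by blast
    let ?a = "\<lambda>k. if k < n then a k else 0"
    have "\<bar>a k\<bar> \<le> ?C" if "k < n" for k
    proof -
      have "\<bar>a k\<bar> \<le> 2 * 3 ^ n * norm x" unfolding a by (rule bound[OF that])
      also have "\<dots> \<le> ?C" using x by (intro mult_left_mono) auto
      finally show ?thesis .
    qed
    then have "?a \<in> ?K" by (auto simp: abs_le_iff minus_le_iff)
    moreover have "x = ?\<Phi> ?a" unfolding a by (intro sum.cong) auto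
    ultimately show "x \<in> ?\<Phi> ` ?K" by (intro image_eqI[of _ _ ?a])
  qed auto
  ultimately show ?thesis by simp
qed

text \<open>The sets where the modulus of some coordinate exceeds \<open>1 / (1 + \<epsilon>)\<close> form an open cover of the compact
unit sphere of \<open>E\<close>.\<close>

lemma norm_finitely_many_coords:
  fixes E :: "l_infty set"
  assumes E: "fin_dim n E" and \<epsilon>: "\<epsilon> > 0"
  obtains d where "\<And>x. x \<in> E \<Longrightarrow> norm x \<le> (1 + \<epsilon>) * norm (fseq d (apply_bcontfun x))"
proof -
  have sE: "subspace E" using E by (rule fin_dim_subspace)
  let ?S = "(E \<inter> {x. norm x \<le> 1}) \<inter> {x. norm x = 1}"
  have "compact ?S"
    by (rule compact_Int_closed[OF compact_fin_dim_ball[OF E]]) (intro closed_Collect_eq continuous_intros)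
  let ?V = "\<lambda>i. {x::l_infty. 1 / (1 + \<epsilon>) < \<bar>apply_bcontfun x i\<bar>}"
  have op: "open (?V i)" for i
    by (intro open_Collect_less continuous_intros continuous_on_coord)
  have cov: "?S \<subseteq> (\<Union>i\<in>UNIV. ?V i)"
  proof (rule subsetI, rule ccontr)
    fix x assume x: "x \<in> ?S" and "x \<notin> (\<Union>i\<in>UNIV. ?V i)"
    then have "norm x \<le> 1 / (1 + \<epsilon>)" by (intro norm_leI) (auto simp: not_less)
    then show False using x \<epsilon> by (simp add: field_simps)
  qed
  obtain D where D: "finite D" "?S \<subseteq> (\<Union>i\<in>D. ?V i)"
    by (rule compactE_image[OF \<open>compact ?S\<close> op cov])
  obtain d where d: "\<forall>i\<in>D. i < d" using D(1) finite_nat_set_iff_bounded by blast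
  have "norm x \<le> (1 + \<epsilon>) * norm (fseq d (apply_bcontfun x))" if x: "x \<in> E" for x
  proof (cases "x = 0")
    case False
    let ?y = "(1 / norm x) *\<^sub>R x"
    have "?y \<in> E" using x sE subspace_scale by blast
    then have "?y \<in> ?S" using False by simp
    then obtain i where i: "i \<in> D" "1 / (1 + \<epsilon>) < \<bar>apply_bcontfun ?y i\<bar>" using D(2) by blast
    have "norm x < (1 + \<epsilon>) * \<bar>apply_bcontfun x i\<bar>"
      using i(2) False \<epsilon> by (simp add: field_simps abs_mult abs_divide)
    also have "\<bar>apply_bcontfun x i\<bar> \<le> norm (fseq d (apply_bcontfun x))"
      using coord_le_norm[of "fseq d (apply_bcontfun x)" i] d i by simp
    finally show ?thesis using \<epsilon> by simp
  qed (use \<epsilon> in simp)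
  then show thesis using that by blast
qed

section \<open>Projections onto a space of maximal absolute Gram sum\<close>

lemma sum_rotate: "(\<Sum>i\<in>A. \<Sum>j\<in>B. \<Sum>k\<in>C. f i j k) = (\<Sum>k\<in>C. \<Sum>i\<in>A. \<Sum>j\<in>B. f i j k)"
proof -
  have "(\<Sum>i\<in>A. \<Sum>j\<in>B. \<Sum>k\<in>C. f i j k) = (\<Sum>i\<in>A. \<Sum>k\<in>C. \<Sum>j\<in>B. f i j k)"
    by (intro sum.cong[OF refl] sum.swap)
  also have "\<dots> = (\<Sum>k\<in>C. \<Sum>i\<in>A. \<Sum>j\<in>B. f i j k)" by (rule sum.swap)
  finally show ?thesis .
qed

text \<open>All variational arguments below end here: a quantity that stays nonnegative along a one-sided
perturbation has a nonnegative first-order term.\<close>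

lemma first_order_nonneg:
  fixes A B :: real
  assumes "\<And>s. 0 < s \<Longrightarrow> s \<le> 1 \<Longrightarrow> 0 \<le> 2 * s * A + s\<^sup>2 * B"
  shows "0 \<le> A"
proof (rule ccontr)
  assume A: "\<not> 0 \<le> A"
  define s where "s = min 1 (- A / (\<bar>B\<bar> + 1))"
  have s: "0 < s" "s \<le> 1" using A by (auto simp: s_def field_simps)
  have "s * B \<le> s * (\<bar>B\<bar> + 1)" using s by (intro mult_left_mono) auto
  also have "\<dots> \<le> (- A / (\<bar>B\<bar> + 1)) * (\<bar>B\<bar> + 1)"
    by (intro mult_right_mono) (auto simp: s_def)
  also have "\<dots> = - A" by simp
  finally have "s * (2 * A + s * B) < 0" using A s by (intro mult_pos_neg) auto
  then show False using assms[OF s] by (simp add: power2_eq_square algebra_simps)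
qed

lemma orthonormal_entry_le_1:
  assumes "orthonormal I n U" "finite I" "i \<in> I" "k < n"
  shows "\<bar>U i k\<bar> \<le> 1"
proof -
  have "U i k * U i k \<le> (\<Sum>i\<in>I. U i k * U i k)"
    using assms by (intro member_le_sum) auto
  also have "\<dots> = 1" using assms by (auto simp: orthonormal_def)
  finally show ?thesis by (metis abs_square_le_1 power2_eq_square)
qed

text \<open>For a symmetric idempotent matrix the sum of the squares of the entries is its trace, which is its
rank.\<close>

lemma sum_gram_squares:
  assumes "orthonormal I n U" "finite I"
  shows "(\<Sum>i\<in>I. \<Sum>j\<in>I. (gram n U i j)\<^sup>2) = n"
proof -
  have "(\<Sum>i\<in>I. \<Sum>j\<in>I. (gram n U i j)\<^sup>2)
      = (\<Sum>i\<in>I. \<Sum>j\<in>I. \<Sum>k<n. \<Sum>l<n. (U i k * U i l) * (U j k * U j l))"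
    unfolding gram_def power2_eq_square sum_product by (simp add: mult_ac)
  also have "\<dots> = (\<Sum>i\<in>I. \<Sum>k<n. \<Sum>l<n. \<Sum>j\<in>I. (U i k * U i l) * (U j k * U j l))"
    by (intro sum.cong refl, subst sum.swap, intro sum.cong refl, subst sum.swap, rule refl)
  also have "\<dots> = (\<Sum>k<n. \<Sum>l<n. \<Sum>i\<in>I. \<Sum>j\<in>I. (U i k * U i l) * (U j k * U j l))"
    by (subst sum.swap, intro sum.cong refl, subst sum.swap, rule refl)
  also have "\<dots> = (\<Sum>k<n. \<Sum>l<n. (\<Sum>i\<in>I. U i k * U i l) * (\<Sum>j\<in>I. U j k * U j l))"
    by (simp add: sum_product)
  also have "\<dots> = (\<Sum>k<n. \<Sum>l<n. if k = l then 1 else 0)"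
    using assms by (intro sum.cong refl) (auto simp: orthonormal_def)
  also have "\<dots> = n" by simp
  finally show ?thesis .
qed

lemma gram_maximizer:
  fixes d :: nat
  assumes "orthonormal {..<d} n U0"
  obtains U where "orthonormal {..<d} n U"
    "\<And>V. orthonormal {..<d} n V \<Longrightarrow>
      (\<Sum>i<d. \<Sum>j<d. \<bar>gram n V i j\<bar>) \<le> (\<Sum>i<d. \<Sum>j<d. \<bar>gram n U i j\<bar>)"
proof -
  let ?f = "\<lambda>U. \<Sum>i<d. \<Sum>j<d. \<bar>gram n U i j\<bar>"
  let ?K = "{U::nat\<Rightarrow>nat\<Rightarrow>real. \<forall>i. U i \<in> {g. \<forall>k. g k \<in> {-1..1}}} \<inter> {U. orthonormal {..<d} n U}"
  \<comment> \<open>only the entries with \<open>i < d\<close> and \<open>k < n\<close> matter; the others are set to 0 to land in a compact set\<close>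
  let ?tr = "\<lambda>(U::nat\<Rightarrow>nat\<Rightarrow>real) i k. if i < d \<and> k < n then U i k else 0"
  have "closed {U. orthonormal {..<d} n U}"
    unfolding orthonormal_def
    by (intro closed_Collect_all closed_Collect_imp open_Collect_const closed_Collect_eq continuous_intros)
  then have K: "compact ?K"
    by (intro compact_Int_closed compact_coordinatewise) auto
  have tr: "?tr U \<in> ?K" if "orthonormal {..<d} n U" for U
  proof -
    have "orthonormal {..<d} n (?tr U)" using that by (simp add: orthonormal_def)
    moreover have "?tr U i k \<in> {-1..1}" for i k
      using orthonormal_entry_le_1[OF that, of i k] by (auto simp: abs_le_iff)
    ultimately show ?thesis by blast
  qed
  have f: "continuous_on ?K ?f" unfolding gram_def by (intro continuous_intros)
  have ne: "?K \<noteq> {}" using tr[OF assms] by (rule ex_in_conv[THEN iffD1, OF exI])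
  from continuous_attains_sup[OF K ne f] obtain U
    where U: "U \<in> ?K" "\<forall>V\<in>?K. ?f V \<le> ?f U" by (rule bexE)
  have "?f V \<le> ?f U" if "orthonormal {..<d} n V" for V
  proof -
    have "?f V = ?f (?tr V)" unfolding gram_def by (intro sum.cong refl arg_cong[of _ _ abs]) auto
    then show ?thesis using U tr[OF that] by auto
  qed
  then show thesis using U(1) by (intro that) auto
qed

text \<open>The conclusion says that \<open>S\<close> maps the range of \<open>U\<close> into itself. Let \<open>v\<close> be the component of
\<open>S u\<^sub>k\<close> orthogonal to the range. Replacing \<open>u\<^sub>k\<close> by the normalised vector \<open>u\<^sub>k + s v\<close> keeps the columns
orthonormal and changes the trace by \<open>2 s |v|\<^sup>2\<close> to first order, which is impossible at a maximum
unless \<open>v = 0\<close>.\<close>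

lemma trace_maximizer_invariant:
  fixes S :: "nat \<Rightarrow> nat \<Rightarrow> real"
  assumes U: "orthonormal {..<d} n U"
    and sym: "\<And>i j. S i j = S j i"
    and max: "\<And>V. orthonormal {..<d} n V \<Longrightarrow>
      (\<Sum>i<d. \<Sum>j<d. S i j * gram n V i j) \<le> (\<Sum>i<d. \<Sum>j<d. S i j * gram n U i j)"
    and k: "k < n" and i: "i < d"
  shows "(\<Sum>j<d. S i j * U j k) = (\<Sum>l<n. (\<Sum>i<d. U i l * (\<Sum>j<d. S i j * U j k)) * U i l)"
proof -
  define y where "y i = (\<Sum>j<d. S i j * U j k)" for i
  define M where "M l = (\<Sum>i<d. U i l * y i)" for l
  define v where "v i = y i - (\<Sum>l<n. M l * U i l)" for i
  define q where "q = (\<Sum>i<d. v i * v i)"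
  have orth: "(\<Sum>i<d. U i k * U i l) = (if k = l then 1 else 0)" if "k < n" "l < n" for k l
    using U that by (auto simp: orthonormal_def)
  have vU: "(\<Sum>i<d. v i * U i l) = 0" if l: "l < n" for l
  proof -
    have "(\<Sum>i<d. v i * U i l) = M l - (\<Sum>i<d. \<Sum>m<n. M m * (U i m * U i l))"
      by (simp add: v_def M_def[of l] right_diff_distrib left_diff_distrib sum_subtractf sum_distrib_right sum_distrib_left mult_ac)
    also have "(\<Sum>i<d. \<Sum>m<n. M m * (U i m * U i l)) = (\<Sum>m<n. M m * (\<Sum>i<d. U i m * U i l))"
      by (subst sum.swap) (simp add: sum_distrib_left)
    also have "\<dots> = (\<Sum>m<n. if m = l then M m else 0)"
      using orth l by (intro sum.cong refl) auto
    also have "\<dots> = M l" using l by simp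
    finally show ?thesis by simp
  qed
  have vy: "(\<Sum>i<d. v i * y i) = q"
  proof -
    have "(\<Sum>i<d. v i * y i) = q + (\<Sum>i<d. \<Sum>l<n. M l * (v i * U i l))"
      by (simp add: q_def v_def algebra_simps sum.distrib sum_distrib_left sum_subtractf)
    also have "(\<Sum>i<d. \<Sum>l<n. M l * (v i * U i l)) = (\<Sum>l<n. M l * (\<Sum>i<d. v i * U i l))"
      by (subst sum.swap) (simp add: sum_distrib_left)
    also have "\<dots> = 0" using vU by simp
    finally show ?thesis by simp
  qed
  have q0: "q \<ge> 0" unfolding q_def by (intro sum_nonneg) auto
  define Q where "Q x = (\<Sum>i<d. \<Sum>j<d. S i j * (x i * x j))" for x
  have trace: "(\<Sum>i<d. \<Sum>j<d. S i j * gram n V i j) = (\<Sum>m<n. Q (\<lambda>i. V i m))" for V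
    unfolding gram_def Q_def sum_distrib_left by (rule sum_rotate)
  have "0 \<le> - q"
  proof (rule first_order_nonneg)
    fix s :: real assume s: "0 < s" "s \<le> 1"
    let ?x = "\<lambda>i. U i k + s * v i"
    define r where "r = 1 + s\<^sup>2 * q"
    have r: "r > 0" using q0 unfolding r_def by (simp add: add_pos_nonneg)
    \<comment> \<open>rotate the k-th column towards v\<close>
    define V where "V i m = (if m = k then ?x i / sqrt r else U i m)" for i m
    have xx: "(\<Sum>i<d. ?x i * ?x i) = r"
    proof -
      have "(\<Sum>i<d. ?x i * ?x i) = (\<Sum>i<d. U i k * U i k) + 2 * s * (\<Sum>i<d. v i * U i k) + s\<^sup>2 * q"
        by (simp add: q_def algebra_simps sum.distrib sum_distrib_left power2_eq_square)
      then show ?thesis using orth[OF k k] vU[OF k] by (simp add: r_def)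
    qed
    have xU: "(\<Sum>i<d. ?x i * U i l) = 0" if "l < n" "l \<noteq> k" for l
    proof -
      have "(\<Sum>i<d. ?x i * U i l) = (\<Sum>i<d. U i k * U i l) + s * (\<Sum>i<d. v i * U i l)"
        by (simp add: algebra_simps sum.distrib sum_distrib_left)
      then show ?thesis using orth[OF k \<open>l < n\<close>] vU that by simp
    qed
    have "orthonormal {..<d} n V"
      unfolding orthonormal_def
    proof (intro allI impI)
      fix a b assume ab: "a < n" "b < n"
      consider "a = k" "b = k" | "a = k" "b \<noteq> k" | "a \<noteq> k" "b = k" | "a \<noteq> k" "b \<noteq> k" by blast
      then show "(\<Sum>i<d. V i a * V i b) = (if a = b then 1 else 0)"
      proof cases
        case 1
        have "(\<Sum>i<d. V i a * V i b) = (\<Sum>i<d. ?x i * ?x i) / r"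
          unfolding sum_divide_distrib using 1 r by (intro sum.cong refl) (simp add: V_def)
        then show ?thesis using xx r 1 by simp
      next
        case 2
        have "(\<Sum>i<d. V i a * V i b) = (\<Sum>i<d. ?x i * U i b) / sqrt r"
          unfolding sum_divide_distrib using 2 by (intro sum.cong refl) (simp add: V_def)
        then show ?thesis using xU ab 2 by simp
      next
        case 3
        have "(\<Sum>i<d. V i a * V i b) = (\<Sum>i<d. ?x i * U i a) / sqrt r"
          unfolding sum_divide_distrib using 3 by (intro sum.cong refl) (simp add: V_def)
        then show ?thesis using xU ab 3 by simp
      next
        case 4
        then show ?thesis using orth ab by (simp add: V_def)
      qed
    qed
    then have "(\<Sum>m<n. Q (\<lambda>i. V i m)) \<le> (\<Sum>m<n. Q (\<lambda>i. U i m))"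
      using max trace by metis
    moreover have "(\<Sum>m<n. Q (\<lambda>i. W i m)) = Q (\<lambda>i. W i k) + (\<Sum>m\<in>{..<n}-{k}. Q (\<lambda>i. W i m))" for W
      using k by (intro sum.remove) auto
    moreover have "(\<Sum>m\<in>{..<n}-{k}. Q (\<lambda>i. V i m)) = (\<Sum>m\<in>{..<n}-{k}. Q (\<lambda>i. U i m))"
      by (intro sum.cong refl) (simp add: V_def)
    ultimately have le: "Q (\<lambda>i. V i k) \<le> Q (\<lambda>i. U i k)" by simp
    have "Q (\<lambda>i. V i k) = Q ?x / r"
      unfolding Q_def sum_divide_distrib using r by (intro sum.cong refl) (simp add: V_def)
    with le r have le': "Q ?x \<le> Q (\<lambda>i. U i k) * r" by (simp add: field_simps)
    have "Q ?x = (\<Sum>i<d. \<Sum>j<d. S i j * (U i k * U j k) + s * (v i * (S i j * U j k))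
        + s * (v j * (S j i * U i k)) + s\<^sup>2 * (S i j * (v i * v j)))"
      unfolding Q_def
    proof (intro sum.cong refl)
      fix i j
      show "S i j * ((U i k + s * v i) * (U j k + s * v j)) = S i j * (U i k * U j k)
          + s * (v i * (S i j * U j k)) + s * (v j * (S j i * U i k)) + s\<^sup>2 * (S i j * (v i * v j))"
        using sym[of j i] by (simp add: algebra_simps power2_eq_square)
    qed
    also have "\<dots> = Q (\<lambda>i. U i k) + s * (\<Sum>i<d. \<Sum>j<d. v i * (S i j * U j k))
        + s * (\<Sum>i<d. \<Sum>j<d. v j * (S j i * U i k)) + s\<^sup>2 * Q v"
      by (simp add: Q_def sum.distrib sum_distrib_left)
    also have "(\<Sum>i<d. \<Sum>j<d. v j * (S j i * U i k)) = (\<Sum>i<d. \<Sum>j<d. v i * (S i j * U j k))"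
      by (rule sum.swap)
    also have "(\<Sum>i<d. \<Sum>j<d. v i * (S i j * U j k)) = q"
      unfolding vy[symmetric] y_def by (simp add: sum_distrib_left)
    finally show "0 \<le> 2 * s * - q + s\<^sup>2 * (Q (\<lambda>i. U i k) * q - Q v)"
      using le' by (simp add: r_def algebra_simps)
  qed
  then have "q = 0" using q0 by simp
  then have "v i * v i = 0" using i unfolding q_def by (subst (asm) sum_nonneg_eq_0_iff) auto
  then show ?thesis by (simp add: v_def M_def y_def)
qed

text \<open>For \<open>U\<close> with independent columns, the matrices \<open>U R\<close> with \<open>R U = 1\<close> are exactly
the linear projections onto the range of \<open>U\<close>.\<close>

definition left_inverse :: "nat \<Rightarrow> nat \<Rightarrow> (nat \<Rightarrow> nat \<Rightarrow> real) \<Rightarrow> (nat \<Rightarrow> nat \<Rightarrow> real) \<Rightarrow> bool" where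
  "left_inverse n d R U \<longleftrightarrow> (\<forall>k<n. \<forall>l<n. (\<Sum>j<d. R k j * U j l) = (if k = l then 1 else 0))"

text \<open>The operator norm of \<open>U R\<close> on \<open>\<ell>\<^sub>\<infinity>\<^sup>d\<close> is the maximum of these numbers over the rows.\<close>

definition row_norm :: "nat \<Rightarrow> nat \<Rightarrow> (nat \<Rightarrow> nat \<Rightarrow> real) \<Rightarrow> (nat \<Rightarrow> nat \<Rightarrow> real) \<Rightarrow> nat \<Rightarrow> real" where
  "row_norm n d U R i = (\<Sum>j<d. \<bar>\<Sum>k<n. U i k * R k j\<bar>)"

text \<open>Trace duality: since the sign matrix \<open>S\<close> of \<open>U U\<^sup>T\<close> preserves the range of \<open>U\<close>, the number
\<open>tr (S U R)\<close> equals the trace of \<open>S\<close> on that range whatever the left inverse \<open>R\<close> is. The choice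
\<open>R = U\<^sup>T\<close> shows that this is the left-hand side, and \<open>tr (S U R)\<close> is at most the absolute sum of the
entries of \<open>U R\<close>.\<close>

lemma projection_norm_lower_bound:
  assumes U: "orthonormal {..<d} n U"
    and max: "\<And>V. orthonormal {..<d} n V \<Longrightarrow>
      (\<Sum>i<d. \<Sum>j<d. \<bar>gram n V i j\<bar>) \<le> (\<Sum>i<d. \<Sum>j<d. \<bar>gram n U i j\<bar>)"
    and R: "left_inverse n d R U"
  shows "(\<Sum>i<d. \<Sum>j<d. \<bar>gram n U i j\<bar>) \<le> (\<Sum>i<d. row_norm n d U R i)"
proof -
  define S where "S i j = sgn (gram n U i j)" for i j
  have gsym: "gram n V i j = gram n V j i" for V :: "nat \<Rightarrow> nat \<Rightarrow> real" and i j by (simp add: gram_def mult.commute)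
  have S: "S i j = S j i" for i j by (simp add: S_def gsym)
  have S1: "S i j * x \<le> \<bar>x\<bar>" for i j x
    by (auto simp: S_def sgn_if)
  have SU: "(\<Sum>i<d. \<Sum>j<d. S i j * gram n U i j) = (\<Sum>i<d. \<Sum>j<d. \<bar>gram n U i j\<bar>)"
    by (simp add: S_def abs_sgn mult.commute)
  define M where "M l k = (\<Sum>i<d. U i l * (\<Sum>j<d. S i j * U j k))" for l k
  have inv: "(\<Sum>j<d. S i j * U j k) = (\<Sum>l<n. M l k * U i l)" if "k < n" "i < d" for i k
    unfolding M_def
  proof (rule trace_maximizer_invariant[OF U S _ that])
    fix V :: "nat \<Rightarrow> nat \<Rightarrow> real" assume V: "orthonormal {..<d} n V"
    have "(\<Sum>i<d. \<Sum>j<d. S i j * gram n V i j) \<le> (\<Sum>i<d. \<Sum>j<d. \<bar>gram n V i j\<bar>)"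
      by (intro sum_mono S1)
    then show "(\<Sum>i<d. \<Sum>j<d. S i j * gram n V i j) \<le> (\<Sum>i<d. \<Sum>j<d. S i j * gram n U i j)"
      using max[OF V] SU by simp
  qed
  have "(\<Sum>i<d. \<Sum>j<d. S i j * (\<Sum>k<n. U i k * R k j)) = (\<Sum>i<d. \<Sum>j<d. \<Sum>k<n. R k j * (S j i * U i k))"
    by (simp add: sum_distrib_left mult_ac S)
  also have "\<dots> = (\<Sum>k<n. \<Sum>j<d. \<Sum>i<d. R k j * (S j i * U i k))"
    by (subst sum.swap, subst (2) sum.swap, subst sum.swap, rule refl)
  also have "\<dots> = (\<Sum>k<n. \<Sum>j<d. R k j * (\<Sum>l<n. M l k * U j l))"
    by (intro sum.cong refl) (simp add: sum_distrib_left[symmetric] inv)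
  also have "\<dots> = (\<Sum>k<n. \<Sum>l<n. M l k * (\<Sum>j<d. R k j * U j l))"
    unfolding sum_distrib_left
    by (rule sum.cong[OF refl], subst sum.swap, intro sum.cong refl) (simp add: mult_ac)
  also have "\<dots> = (\<Sum>k<n. \<Sum>l<n. if k = l then M l k else 0)"
    using R by (intro sum.cong refl) (auto simp: left_inverse_def)
  also have "\<dots> = (\<Sum>k<n. M k k)" by simp
  also have "\<dots> = (\<Sum>i<d. \<Sum>j<d. S i j * gram n U i j)"
    unfolding M_def gram_def sum_distrib_left sum_rotate[of _ "{..<n}"]
    by (intro sum.cong refl) (simp add: mult_ac)
  finally have "(\<Sum>i<d. \<Sum>j<d. \<bar>gram n U i j\<bar>) = (\<Sum>i<d. \<Sum>j<d. S i j * (\<Sum>k<n. U i k * R k j))"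
    using SU by simp
  also have "\<dots> \<le> (\<Sum>i<d. row_norm n d U R i)"
    unfolding row_norm_def by (intro sum_mono S1)
  finally show ?thesis .
qed

section \<open>A minimax principle for row norms\<close>

lemma row_norm_nonneg: "0 \<le> row_norm n d U R i"
  unfolding row_norm_def by (intro sum_nonneg) simp

lemma left_inverse_orthonormal: "orthonormal {..<d} n U \<Longrightarrow> left_inverse n d (\<lambda>k j. U j k) U"
  by (simp add: left_inverse_def orthonormal_def)

lemma row_norm_entry_bound:
  assumes U: "orthonormal {..<d} n U"
    and c: "\<And>i. i < d \<Longrightarrow> row_norm n d U R i \<le> c" and k: "k < n" and j: "j < d"
  shows "\<bar>R k j\<bar> \<le> d * c"
proof -
  let ?q = "\<lambda>i. \<Sum>l<n. U i l * R l j"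
  have "(\<Sum>i<d. U i k * ?q i) = (\<Sum>l<n. R l j * (\<Sum>i<d. U i k * U i l))"
    unfolding sum_distrib_left by (subst sum.swap) (simp add: mult_ac)
  also have "\<dots> = (\<Sum>l<n. if k = l then R l j else 0)"
    using U k by (intro sum.cong refl) (auto simp: orthonormal_def)
  also have "\<dots> = R k j" using k by simp
  finally have "\<bar>R k j\<bar> \<le> (\<Sum>i<d. \<bar>U i k\<bar> * \<bar>?q i\<bar>)"
    using sum_abs[of "\<lambda>i. U i k * ?q i" "{..<d}"] by (simp add: abs_mult)
  also have "\<dots> \<le> (\<Sum>i<d. 1 * c)"
  proof (intro sum_mono mult_mono)
    fix i assume i: "i \<in> {..<d}"
    show "\<bar>U i k\<bar> \<le> 1" using orthonormal_entry_le_1[OF U _ i k] by simp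
    have "\<bar>?q i\<bar> \<le> row_norm n d U R i"
      unfolding row_norm_def using j by (intro member_le_sum[of j _ "\<lambda>j. \<bar>\<Sum>l<n. U i l * R l j\<bar>"]) auto
    then show "\<bar>?q i\<bar> \<le> c" using c i by force
  qed auto
  finally show ?thesis by simp
qed

text \<open>If no projection has all its row norms at most \<open>\<mu>\<close>, a fixed weighting of the rows detects this
for all projections. Minimise the sum of the squared excesses \<open>(\<rho>\<^sub>i - \<mu>)\<^sub>+\<^sup>2\<close>, that is, the
distance of the vector of row norms to the orthant below \<open>\<mu>\<close>; the excesses at a minimiser,
normalised to total 1, are the weights. Convexity of the row norms along segments of projections gives
the inequality.\<close>

lemma minimax_weights:
  fixes \<mu> :: real
  assumes U: "orthonormal {..<d} n U"
    and big: "\<And>R. left_inverse n d R U \<Longrightarrow> \<exists>i<d. \<mu> < row_norm n d U R i"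
  obtains w where "\<forall>i<d. 0 \<le> w i" "(\<Sum>i<d. w i) = 1"
    "\<forall>R. left_inverse n d R U \<longrightarrow> \<mu> \<le> (\<Sum>i<d. w i * row_norm n d U R i)"
proof -
  let ?\<rho> = "row_norm n d U"
  define \<phi> where "\<phi> R = (\<Sum>i<d. (max 0 (?\<rho> R i - \<mu>))\<^sup>2)" for R
  let ?tr = "\<lambda>(R::nat\<Rightarrow>nat\<Rightarrow>real) k j. if k < n \<and> j < d then R k j else 0"
  have tr_inv: "left_inverse n d (?tr R) U" if "left_inverse n d R U" for R
    using that by (simp add: left_inverse_def)
  have tr_\<rho>: "?\<rho> (?tr R) = ?\<rho> R" for R
    unfolding row_norm_def by (intro ext sum.cong refl arg_cong[of _ _ abs]) auto
  define c where "c = \<phi> (\<lambda>k j. U j k)"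
  define B where "B = real d * (\<mu> + sqrt c)"
  let ?K = "{R::nat\<Rightarrow>nat\<Rightarrow>real. \<forall>k. R k \<in> {g. \<forall>j. g j \<in> {-\<bar>B\<bar>..\<bar>B\<bar>}}} \<inter>
    ({R. left_inverse n d R U} \<inter> {R. \<phi> R \<le> c})"
  have cont_\<rho>: "continuous_on S (\<lambda>R. ?\<rho> R i)" for S i
    unfolding row_norm_def by (intro continuous_intros)
  have cont_\<phi>: "continuous_on S \<phi>" for S
    unfolding \<phi>_def by (intro continuous_intros cont_\<rho>)
  have "closed {R. left_inverse n d R U}"
    unfolding left_inverse_def
    by (intro closed_Collect_all closed_Collect_imp open_Collect_const closed_Collect_eq continuous_intros)
  moreover have "closed {R. \<phi> R \<le> c}" by (intro closed_Collect_le continuous_intros cont_\<phi>)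
  ultimately have K: "compact ?K"
    by (intro compact_Int_closed compact_coordinatewise closed_Int) auto
  have inK: "?tr R \<in> ?K" if R: "left_inverse n d R U" "\<phi> R \<le> c" for R
  proof -
    have "?\<rho> R i \<le> \<mu> + sqrt c" if i: "i < d" for i
    proof -
      have "(max 0 (?\<rho> R i - \<mu>))\<^sup>2 \<le> \<phi> R"
        unfolding \<phi>_def using i by (intro member_le_sum[of i _ "\<lambda>i. (max 0 (?\<rho> R i - \<mu>))\<^sup>2"]) auto
      then have "max 0 (?\<rho> R i - \<mu>) \<le> sqrt c" using R(2) by (intro real_le_rsqrt) auto
      then show ?thesis by simp
    qed
    then have "\<bar>R k j\<bar> \<le> B" if "k < n" "j < d" for k j
      unfolding B_def using row_norm_entry_bound[OF U _ that] by blast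
    then have "\<bar>R k j\<bar> \<le> \<bar>B\<bar>" if "k < n" "j < d" for k j
      using that by (meson abs_ge_self order.trans)
    then have "?tr R k j \<in> {-\<bar>B\<bar>..\<bar>B\<bar>}" for k j
      by (auto simp: abs_le_iff minus_le_iff)
    moreover have "\<phi> (?tr R) \<le> c" using R unfolding \<phi>_def tr_\<rho> by simp
    ultimately show ?thesis using tr_inv[OF R(1)] by blast
  qed
  have "?tr (\<lambda>k j. U j k) \<in> ?K"
    using left_inverse_orthonormal[OF U] by (intro inK) (simp_all add: c_def)
  then have ne: "?K \<noteq> {}" by (rule ex_in_conv[THEN iffD1, OF exI])
  from continuous_attains_inf[OF K ne cont_\<phi>] obtain R1
    where R1: "R1 \<in> ?K" "\<forall>R\<in>?K. \<phi> R1 \<le> \<phi> R" by (rule bexE)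
  have R1_inv: "left_inverse n d R1 U" using R1 by blast
  have min: "\<phi> R1 \<le> \<phi> R" if R: "left_inverse n d R U" for R
  proof (cases "\<phi> R \<le> c")
    case True
    then have "\<phi> R1 \<le> \<phi> (?tr R)" using R1 inK[OF R True] by blast
    then show ?thesis unfolding \<phi>_def tr_\<rho> .
  next
    case False
    then show ?thesis using R1 by auto
  qed
  define a where "a i = ?\<rho> R1 i - \<mu>" for i
  define p where "p i = max 0 (a i)" for i
  have first_order: "0 \<le> (\<Sum>i<d. p i * (?\<rho> R i - ?\<rho> R1 i))" if R: "left_inverse n d R U" for R
  proof (rule first_order_nonneg)
    fix s :: real assume s: "0 < s" "s \<le> 1"
    let ?h = "\<lambda>i. ?\<rho> R i - ?\<rho> R1 i"
    \<comment> \<open>move from the minimiser towards R\<close>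
    let ?Rs = "\<lambda>k j. (1 - s) * R1 k j + s * R k j"
    have "left_inverse n d ?Rs U"
      unfolding left_inverse_def
    proof (intro allI impI)
      fix k l assume kl: "k < n" "l < n"
      have "(\<Sum>j<d. ?Rs k j * U j l) = (1 - s) * (\<Sum>j<d. R1 k j * U j l) + s * (\<Sum>j<d. R k j * U j l)"
        by (simp add: algebra_simps sum.distrib sum_distrib_left sum_subtractf)
      then show "(\<Sum>j<d. ?Rs k j * U j l) = (if k = l then 1 else 0)"
        using R R1_inv kl by (simp add: left_inverse_def)
    qed
    then have "\<phi> R1 \<le> \<phi> ?Rs" by (rule min)
    also have "\<dots> \<le> (\<Sum>i<d. (p i)\<^sup>2 + (2 * s * (p i * ?h i) + s\<^sup>2 * (?h i)\<^sup>2))"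
      unfolding \<phi>_def
    proof (rule sum_mono)
      fix i
      have "?\<rho> ?Rs i \<le> (\<Sum>j<d. (1 - s) * \<bar>\<Sum>k<n. U i k * R1 k j\<bar> + s * \<bar>\<Sum>k<n. U i k * R k j\<bar>)"
        unfolding row_norm_def
      proof (rule sum_mono)
        fix j
        have "(\<Sum>k<n. U i k * ?Rs k j) = (1 - s) * (\<Sum>k<n. U i k * R1 k j) + s * (\<Sum>k<n. U i k * R k j)"
          by (simp add: algebra_simps sum.distrib sum_distrib_left sum_subtractf)
        then show "\<bar>\<Sum>k<n. U i k * ?Rs k j\<bar> \<le> (1 - s) * \<bar>\<Sum>k<n. U i k * R1 k j\<bar> + s * \<bar>\<Sum>k<n. U i k * R k j\<bar>"
          using s abs_triangle_ineq[of "(1 - s) * (\<Sum>k<n. U i k * R1 k j)" "s * (\<Sum>k<n. U i k * R k j)"]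
          by (simp add: abs_mult)
      qed
      also have "\<dots> = ?\<rho> R1 i + s * ?h i"
        by (simp add: row_norm_def algebra_simps sum.distrib sum_distrib_left sum_subtractf)
      finally have le: "?\<rho> ?Rs i - \<mu> \<le> a i + s * ?h i" by (simp add: a_def)
      have "\<bar>max 0 (?\<rho> ?Rs i - \<mu>)\<bar> \<le> \<bar>p i + s * ?h i\<bar>"
        using le by (auto simp: p_def)
      then have "(max 0 (?\<rho> ?Rs i - \<mu>))\<^sup>2 \<le> (p i + s * ?h i)\<^sup>2"
        by (rule abs_le_square_iff[THEN iffD1])
      also have "\<dots> = (p i)\<^sup>2 + (2 * s * (p i * ?h i) + s\<^sup>2 * (?h i)\<^sup>2)"
        by (simp add: power2_eq_square algebra_simps)
      finally show "(max 0 (?\<rho> ?Rs i - \<mu>))\<^sup>2 \<le> (p i)\<^sup>2 + (2 * s * (p i * ?h i) + s\<^sup>2 * (?h i)\<^sup>2)" .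
    qed
    also have "\<dots> = \<phi> R1 + (2 * s * (\<Sum>i<d. p i * ?h i) + s\<^sup>2 * (\<Sum>i<d. (?h i)\<^sup>2))"
      by (simp add: \<phi>_def p_def a_def sum.distrib sum_distrib_left)
    finally show "0 \<le> 2 * s * (\<Sum>i<d. p i * ?h i) + s\<^sup>2 * (\<Sum>i<d. (?h i)\<^sup>2)" by simp
  qed
  have p0: "0 \<le> p i" for i by (simp add: p_def)
  define W where "W = (\<Sum>i<d. p i)"
  obtain i0 where "i0 < d" "\<mu> < ?\<rho> R1 i0" using big[OF R1_inv] by blast
  then have W: "W > 0"
    unfolding W_def using p0 by (intro sum_pos2[of _ i0]) (auto simp: p_def a_def)
  define w where "w i = p i / W" for i
  show thesis
  proof (rule that[of w])
    show "\<forall>i<d. 0 \<le> w i" using W p0 by (simp add: w_def)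
    show "(\<Sum>i<d. w i) = 1" unfolding w_def sum_divide_distrib[symmetric] using W by (simp add: W_def)
    show "\<forall>R. left_inverse n d R U \<longrightarrow> \<mu> \<le> (\<Sum>i<d. w i * row_norm n d U R i)"
    proof (intro allI impI)
      fix R assume R: "left_inverse n d R U"
      have "\<mu> * W \<le> (\<Sum>i<d. p i * ?\<rho> R1 i)"
        unfolding W_def sum_distrib_left
      proof (rule sum_mono)
        fix i
        have "0 \<le> p i * a i" by (auto simp: p_def max_def)
        then show "\<mu> * p i \<le> p i * ?\<rho> R1 i" by (simp add: a_def algebra_simps)
      qed
      also have "\<dots> \<le> (\<Sum>i<d. p i * ?\<rho> R i)"
        using first_order[OF R] by (simp add: right_diff_distrib sum_subtractf)
      also have "\<dots> = (\<Sum>i<d. w i * ?\<rho> R i) * W"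
        using W by (simp add: w_def sum_distrib_right)
      finally show "\<mu> \<le> (\<Sum>i<d. w i * ?\<rho> R i)" using W by simp
    qed
  qed
qed

section \<open>The Perron vector of a symmetric positive matrix\<close>

text \<open>A unit vector maximising the quadratic form may be replaced by the vector of its absolute values,
since \<open>A\<close> is positive. Being a maximiser it is an eigenvector, and then positivity of \<open>A\<close>
makes all its entries positive.\<close>

lemma perron_vector:
  fixes A :: "'i \<Rightarrow> 'i \<Rightarrow> real"
  assumes I: "finite I" and pos: "\<And>i j. i \<in> I \<Longrightarrow> j \<in> I \<Longrightarrow> 0 < A i j"
    and sym: "\<And>i j. A i j = A j i" and x: "(\<Sum>i\<in>I. (x i)\<^sup>2) = 1"
  obtains t \<rho> where "\<forall>i\<in>I. 0 < t i" "(\<Sum>i\<in>I. \<Sum>j\<in>I. A i j * (x i * x j)) \<le> \<rho>"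
    "\<forall>i\<in>I. (\<Sum>j\<in>I. A i j * t j) = \<rho> * t i" "(\<Sum>i\<in>I. (t i)\<^sup>2) = 1"
proof -
  define Q where "Q y = (\<Sum>i\<in>I. \<Sum>j\<in>I. A i j * (y i * y j))" for y
  define N :: "('i \<Rightarrow> real) \<Rightarrow> real" where "N y = (\<Sum>i\<in>I. (y i)\<^sup>2)" for y
  let ?K = "{t::'i\<Rightarrow>real. \<forall>i. t i \<in> {-1..1}} \<inter> {t. N t = 1}"
  have "closed {t. N t = 1}" unfolding N_def by (intro closed_Collect_eq continuous_intros)
  then have K: "compact ?K" by (intro compact_Int_closed compact_coordinatewise) auto
  let ?tr = "\<lambda>y i. if i \<in> I then y i else 0"
  have tr: "?tr y \<in> ?K" if "N y = 1" for y
  proof -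
    have "y i \<in> {-1..1}" if "i \<in> I" for i
    proof -
      have "(y i)\<^sup>2 \<le> 1"
        using member_le_sum[OF \<open>i \<in> I\<close>, of "\<lambda>i. (y i)\<^sup>2"] I \<open>N y = 1\<close> by (simp add: N_def)
      then show ?thesis by (auto simp: abs_square_le_1 abs_le_iff)
    qed
    moreover have "N (?tr y) = 1" using that by (simp add: N_def)
    ultimately show ?thesis by auto
  qed
  have Qtr: "Q (?tr y) = Q y" for y by (simp add: Q_def)
  have ne: "?K \<noteq> {}" using tr[of x] x unfolding N_def[symmetric] by (intro ex_in_conv[THEN iffD1, OF exI])
  have "continuous_on ?K Q" unfolding Q_def by (intro continuous_intros)
  from continuous_attains_sup[OF K ne this] obtain t0
    where t0: "t0 \<in> ?K" "\<forall>y\<in>?K. Q y \<le> Q t0" by (rule bexE)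
  define t where "t i = \<bar>t0 i\<bar>" for i
  define \<rho> where "\<rho> = Q t"
  have Nt: "N t = 1" using t0 by (simp add: t_def N_def)
  have "Q t0 \<le> Q t"
    unfolding Q_def t_def
  proof (intro sum_mono mult_left_mono)
    fix i j assume "i \<in> I" "j \<in> I"
    then show "0 \<le> A i j" using pos less_imp_le by blast
    show "t0 i * t0 j \<le> \<bar>t0 i\<bar> * \<bar>t0 j\<bar>" by (metis abs_ge_self abs_mult)
  qed
  then have max1: "Q y \<le> \<rho>" if "N y = 1" for y
    using t0 tr[OF that] Qtr[of y] unfolding \<rho>_def by (metis (no_types, lifting) order.trans)
  have max: "Q y \<le> \<rho> * N y" for y
  proof (cases "N y = 0")
    case True
    then have "y i = 0" if "i \<in> I" for i
      using that I unfolding N_def by (simp add: sum_nonneg_eq_0_iff)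
    then show ?thesis using True by (simp add: Q_def)
  next
    case False
    then have Ny: "N y > 0" using sum_nonneg[of I "\<lambda>i. (y i)\<^sup>2"] by (simp add: N_def less_le)
    let ?z = "\<lambda>i. y i / sqrt (N y)"
    have "N ?z = N y / N y" using Ny by (simp add: N_def power_divide sum_divide_distrib[symmetric])
    then have "Q ?z \<le> \<rho>" using Ny by (intro max1) simp
    moreover have "Q ?z = Q y / N y"
      unfolding Q_def sum_divide_distrib using Ny by (intro sum.cong refl) simp
    ultimately show ?thesis using Ny by (simp add: field_simps)
  qed
  have eig: "(\<Sum>j\<in>I. A i j * t j) = \<rho> * t i" if i: "i \<in> I" for i
  proof -
    let ?At = "\<Sum>j\<in>I. A i j * t j"
    have "0 \<le> c * (\<rho> * t i - ?At)" if c: "\<bar>c\<bar> = 1" for c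
    proof (rule first_order_nonneg)
      fix s :: real assume s: "0 < s" "s \<le> 1"
      let ?e = "\<lambda>j. if j = i then c else 0"
      let ?y = "\<lambda>j. t j + s * ?e j"
      have cc: "c * c = 1" using c by (metis abs_mult_self_eq mult_1)
      have "N ?y = (\<Sum>j\<in>I. (t j)\<^sup>2 + (2 * s * (t j * ?e j) + s\<^sup>2 * (?e j * ?e j)))"
        unfolding N_def by (intro sum.cong refl) (auto simp: power2_eq_square algebra_simps)
      also have "\<dots> = N t + (2 * s * (\<Sum>j\<in>I. t j * ?e j) + s\<^sup>2 * (\<Sum>j\<in>I. ?e j * ?e j))"
        unfolding N_def by (simp only: sum.distrib sum_distrib_left)
      also have "(\<Sum>j\<in>I. t j * ?e j) = (\<Sum>j\<in>I. if j = i then t j * c else 0)"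
        by (intro sum.cong) auto
      also have "\<dots> = c * t i" using i I by simp
      also have "(\<Sum>j\<in>I. ?e j * ?e j) = (\<Sum>j\<in>I. if j = i then 1 else 0)"
        using cc by (intro sum.cong) auto
      also have "\<dots> = 1" using i I by simp
      finally have Ny: "N ?y = 1 + (2 * s * (c * t i) + s\<^sup>2)" using Nt by simp
      have "Q ?y = (\<Sum>k\<in>I. \<Sum>j\<in>I. A k j * (t k * t j) + (s * (?e k * (A k j * t j))
          + s * (?e j * (A j k * t k)) + s\<^sup>2 * (A k j * (?e k * ?e j))))"
        unfolding Q_def
      proof (intro sum.cong refl)
        fix k j
        show "A k j * (?y k * ?y j) = A k j * (t k * t j) + (s * (?e k * (A k j * t j))
          + s * (?e j * (A j k * t k)) + s\<^sup>2 * (A k j * (?e k * ?e j)))"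
          using sym[of j k] by (simp add: algebra_simps power2_eq_square)
      qed
      also have "\<dots> = Q t + (s * (\<Sum>k\<in>I. \<Sum>j\<in>I. ?e k * (A k j * t j))
          + s * (\<Sum>k\<in>I. \<Sum>j\<in>I. ?e j * (A j k * t k)) + s\<^sup>2 * Q ?e)"
        unfolding Q_def by (simp only: sum.distrib sum_distrib_left)
      also have "(\<Sum>k\<in>I. \<Sum>j\<in>I. ?e j * (A j k * t k)) = (\<Sum>k\<in>I. \<Sum>j\<in>I. ?e k * (A k j * t j))"
        by (rule sum.swap)
      also have "(\<Sum>k\<in>I. \<Sum>j\<in>I. ?e k * (A k j * t j)) = (\<Sum>k\<in>I. if k = i then c * (\<Sum>j\<in>I. A k j * t j) else 0)"
        by (intro sum.cong refl) (simp add: sum_distrib_left)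
      also have "\<dots> = c * ?At" using i I by simp
      finally have "Q ?y = \<rho> + (2 * s * (c * ?At) + s\<^sup>2 * Q ?e)" by (simp add: \<rho>_def)
      with max[of ?y] Ny
      show "0 \<le> 2 * s * (c * (\<rho> * t i - ?At)) + s\<^sup>2 * (\<rho> - Q ?e)" by (simp add: algebra_simps)
    qed
    from this[of 1] this[of "-1"] show ?thesis by simp
  qed
  have t0': "0 \<le> t i" for i by (simp add: t_def)
  obtain k where k: "k \<in> I" "t k \<noteq> 0"
    using Nt unfolding N_def by (metis (mono_tags, lifting) sum.neutral zero_neq_one zero_power2)
  have "0 < t i" if "i \<in> I" for i
  proof -
    have "0 < (\<Sum>j\<in>I. A i j * t j)"
      using k t0' pos that I by (intro sum_pos2[of _ k]) (auto simp: less_le intro!: mult_nonneg_nonneg)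
    then have "t i \<noteq> 0" using eig[OF that] by auto
    then show ?thesis using t0'[of i] by simp
  qed
  moreover have "Q x \<le> \<rho>" using max1 x by (simp add: N_def)
  ultimately show thesis
    using that eig Nt unfolding Q_def N_def by blast
qed

section \<open>Orthogonal projection matrices and orthonormal systems\<close>

definition proj_mat :: "nat \<Rightarrow> nat \<Rightarrow> (nat \<Rightarrow> nat \<Rightarrow> real) \<Rightarrow> real mat" where
  "proj_mat d n U = mat d d (\<lambda>(i, j). gram n U i j)"

lemma gram_sym: "gram n U i j = gram n U j i"
  by (simp add: gram_def mult.commute)

text \<open>The rank is read off from the column space: \<open>U U\<^sup>T\<close> and \<open>U\<close> have the same one, and the columns
of \<open>U\<close> are independent because \<open>U\<^sup>T U = 1\<close>.\<close>

lemma proj_mat_in_orth_proj_mats: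
  assumes U: "orthonormal {..<d} n U"
  shows "proj_mat d n U \<in> orth_proj_mats n"
proof -
  interpret vec_space "TYPE(real)" d .
  let ?P = "proj_mat d n U"
  define B where "B = mat d n (\<lambda>(i, k). U i k)"
  have B: "B \<in> carrier_mat d n" by (simp add: B_def)
  then have BT: "transpose_mat B \<in> carrier_mat n d" by simp
  have P: "?P \<in> carrier_mat d d" by (simp add: proj_mat_def)
  have BB: "transpose_mat B * B = 1\<^sub>m n"
    using U by (intro eq_matI) (auto simp: B_def scalar_prod_def orthonormal_def atLeast0LessThan)
  have PB: "?P = B * transpose_mat B"
    by (intro eq_matI) (auto simp: B_def proj_mat_def gram_def scalar_prod_def atLeast0LessThan)
  have "?P * ?P = B * (transpose_mat B * (B * transpose_mat B))"
    unfolding PB by (rule assoc_mult_mat[OF B BT]) (use B BT in auto)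
  also have "transpose_mat B * (B * transpose_mat B) = (transpose_mat B * B) * transpose_mat B"
    by (rule assoc_mult_mat[OF BT B BT, symmetric])
  also have "\<dots> = transpose_mat B" unfolding BB using BT by simp
  finally have idem: "?P * ?P = ?P" unfolding PB .
  have sym: "transpose_mat ?P = ?P"
    by (intro eq_matI) (auto simp: proj_mat_def gram_sym)
  have nz: "v = 0\<^sub>v n" if v: "v \<in> carrier_vec n" and Bv: "B *\<^sub>v v = 0\<^sub>v d" for v
  proof -
    have "v = (transpose_mat B * B) *\<^sub>v v" using v by (simp add: BB)
    also have "\<dots> = transpose_mat B *\<^sub>v (B *\<^sub>v v)" using B BT v by simp
    also have "\<dots> = 0\<^sub>v n" unfolding Bv using BT by auto
    finally show ?thesis .
  qed
  have dist: "distinct (cols B)"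
    unfolding distinct_conv_nth
  proof (intro allI impI notI)
    fix k l assume kl: "k < length (cols B)" "l < length (cols B)" "k \<noteq> l" "cols B ! k = cols B ! l"
    then have k: "k < n" "l < n" and eq: "col B k = col B l" using B by auto
    have "U i k = U i l" if "i < d" for i
      using arg_cong[OF eq, of "\<lambda>v. v $ i"] k that by (simp add: B_def)
    then have "(\<Sum>i<d. U i k * U i k) = (\<Sum>i<d. U i k * U i l)" by simp
    then show False using U k kl(3) by (simp add: orthonormal_def)
  qed
  have "lin_indpt (set (cols B))"
    using lin_depE[OF B _ dist] nz by metis
  then have rankB: "rank B = n" by (rule lin_indpt_full_rank[OF B dist])
  have "col_space ?P = col_space B"
  proof -
    have 1: "\<exists>x\<in>carrier_vec n. B *\<^sub>v x = ?P *\<^sub>v y" if y: "y \<in> carrier_vec d" for y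
      using B BT y unfolding PB by (intro bexI[of _ "transpose_mat B *\<^sub>v y"]) auto
    have 2: "\<exists>y\<in>carrier_vec d. ?P *\<^sub>v y = B *\<^sub>v x" if x: "x \<in> carrier_vec n" for x
    proof (intro bexI[of _ "B *\<^sub>v x"])
      have "?P *\<^sub>v (B *\<^sub>v x) = B *\<^sub>v (transpose_mat B *\<^sub>v (B *\<^sub>v x))" unfolding PB using B BT x by auto
      also have "transpose_mat B *\<^sub>v (B *\<^sub>v x) = (transpose_mat B * B) *\<^sub>v x" using B BT x by simp
      also have "\<dots> = x" using x by (simp add: BB)
      finally show "?P *\<^sub>v (B *\<^sub>v x) = B *\<^sub>v x" .
      show "B *\<^sub>v x \<in> carrier_vec d" using B x by simp
    qed
    show ?thesis
    proof -
      have cP: "col_space ?P = (\<lambda>y. ?P *\<^sub>v y) ` carrier_vec d"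
        unfolding col_space_eq[OF P] using P by auto
      have cB: "col_space B = (\<lambda>x. B *\<^sub>v x) ` carrier_vec n"
        unfolding col_space_eq[OF B] using B by auto
      show ?thesis
        unfolding cP cB
      proof (intro subset_antisym image_subsetI)
        fix y :: "real vec" assume "y \<in> carrier_vec d"
        from 1[OF this] show "?P *\<^sub>v y \<in> (\<lambda>x. B *\<^sub>v x) ` carrier_vec n" by (metis image_eqI)
      next
        fix x :: "real vec" assume "x \<in> carrier_vec n"
        from 2[OF this] show "B *\<^sub>v x \<in> (\<lambda>y. ?P *\<^sub>v y) ` carrier_vec d" by (metis image_eqI)
      qed
    qed
  qed
  then have rankP: "rank ?P = n"
    using rankB unfolding rank_def col_space_def by simp
  have "n \<le> d" using rankB B
    by (metis P rankP rank_le_nc)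
  then show ?thesis
    unfolding orth_proj_mats_def using P idem sym rankP by blast
qed

lemma fin_dim_fseq: "fin_dim d {fseq d f | f. True}"
proof -
  let ?e = "\<lambda>k. fseq d (\<lambda>i. if i = k then 1 else 0)"
  have sum: "(\<Sum>k<d. a k *\<^sub>R ?e k) = fseq d a" for a
    by (rule bcontfun_eqI) (simp add: if_distrib[of "\<lambda>x. _ * x"] cong: if_cong)
  have "fin_dim d {\<Sum>k<d. a k *\<^sub>R ?e k | a. True}"
  proof (rule fin_dim_combinations)
    fix a assume a0: "(\<Sum>k<d. a k *\<^sub>R ?e k) = 0"
    have "a k = 0" if "k < d" for k
      using arg_cong[OF a0, of "\<lambda>x. apply_bcontfun x k"] that unfolding sum by simp
    then show "\<forall>k<d. a k = 0" by blast
  qed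
  then show ?thesis unfolding sum .
qed

text \<open>The columns of \<open>U\<close> are an orthonormal basis of the range of \<open>P\<close>. By symmetry, the
coefficients of the \<open>j\<close>-th column of \<open>P\<close> in this basis are \<open>(P u\<^sub>l)\<^sub>j = u\<^sub>j\<^sub>l\<close>.\<close>

lemma symmetric_idempotent_is_gram:
  fixes P :: "nat \<Rightarrow> nat \<Rightarrow> real"
  assumes sym: "\<And>i j. i < d \<Longrightarrow> j < d \<Longrightarrow> P i j = P j i"
    and idem: "\<And>i j. i < d \<Longrightarrow> j < d \<Longrightarrow> (\<Sum>k<d. P i k * P k j) = P i j"
  obtains m U where "orthonormal {..<d} m U" "\<And>i j. i < d \<Longrightarrow> j < d \<Longrightarrow> gram m U i j = P i j"
proof -
  let ?P = "\<lambda>f. fseq d (\<lambda>i. \<Sum>j<d. P i j * f j)"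
  let ?E = "{?P f | f. True}"
  let ?L = "\<lambda>x::l_infty. ?P (apply_bcontfun x)"
  have "linear ?L"
    by (rule linearI; rule bcontfun_eqI) (simp_all add: algebra_simps sum.distrib sum_distrib_left)
  then have "subspace (range ?L)" by (rule linear_subspace_image) (rule real_vector.subspace_UNIV)
  moreover have "range ?L = ?E"
  proof (intro subset_antisym subsetI)
    fix x assume "x \<in> ?E"
    then obtain f where f: "x = ?P f" by blast
    have "?L (fseq d f) = x" unfolding f by (rule bcontfun_eqI) simp
    then show "x \<in> range ?L" by (intro image_eqI[of _ _ "fseq d f"]) simp_all
  next
    fix x assume "x \<in> range ?L"
    then obtain y where "x = ?L y" by (rule rangeE)
    then show "x \<in> ?E" by (intro CollectI exI[of _ "apply_bcontfun y"]) simp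
  qed
  ultimately have "subspace ?E" by simp
  moreover have "?E \<subseteq> {fseq d f | f. True}" by blast
  ultimately obtain m where m: "fin_dim m ?E"
    using fin_dim_subset[OF fin_dim_fseq[of d]] by blast
  have "apply_bcontfun x i = 0" if "x \<in> ?E" "d \<le> i" for x i
    using that by auto
  with m obtain U where U: "orthonormal {..<d} m U"
    and E: "?E = {fseq d (\<lambda>i. \<Sum>k<m. a k * U i k) | a. True}"
    by (rule gram_schmidt_fin_dim)
  have PU: "(\<Sum>j<d. P i j * U j l) = U i l" if l: "l < m" and i: "i < d" for i l
  proof -
    have "fseq d (\<lambda>i. U i l) \<in> ?E" unfolding E by (rule column_in_span[OF l])
    then obtain f where f: "fseq d (\<lambda>i. U i l) = ?P f" by blast
    have Ul: "U i l = (\<Sum>j<d. P i j * f j)" if "i < d" for i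
      using arg_cong[OF f, of "\<lambda>x. apply_bcontfun x i"] that by simp
    have "(\<Sum>j<d. P i j * U j l) = (\<Sum>j<d. \<Sum>k<d. P i j * P j k * f k)"
      by (simp add: Ul sum_distrib_left mult_ac)
    also have "\<dots> = (\<Sum>k<d. (\<Sum>j<d. P i j * P j k) * f k)"
      by (subst sum.swap) (simp add: sum_distrib_right)
    also have "\<dots> = U i l" using idem i Ul[OF i] by simp
    finally show ?thesis .
  qed
  have "gram m U i j = P i j" if ij: "i < d" "j < d" for i j
  proof -
    have "?P (\<lambda>k. if k = j then 1 else 0) \<in> ?E" by (intro CollectI exI[of _ "\<lambda>k. if k = j then 1 else 0"]) simp
    then obtain a where a: "?P (\<lambda>k. if k = j then 1 else 0) = fseq d (\<lambda>i. \<Sum>k<m. a k * U i k)"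
      unfolding E by blast
    have Pa: "P i j = (\<Sum>k<m. a k * U i k)" if "i < d" for i
      using arg_cong[OF a, of "\<lambda>x. apply_bcontfun x i"] that ij
      by (simp add: if_distrib[of "\<lambda>x. _ * x"] cong: if_cong)
    have "a l = U j l" if l: "l < m" for l
    proof -
      have "U j l = (\<Sum>i<d. P j i * U i l)" using PU l ij by simp
      also have "\<dots> = (\<Sum>i<d. P i j * U i l)" using sym ij by (intro sum.cong) auto
      also have "\<dots> = (\<Sum>i<d. \<Sum>k<m. a k * (U i k * U i l))"
        by (intro sum.cong refl) (simp add: Pa sum_distrib_right mult.assoc)
      also have "\<dots> = (\<Sum>k<m. a k * (\<Sum>i<d. U i k * U i l))"
        by (subst sum.swap) (simp add: sum_distrib_left)
      also have "\<dots> = (\<Sum>k<m. if k = l then a k else 0)"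
        using U l by (intro sum.cong refl) (auto simp: orthonormal_def)
      finally show ?thesis using l by simp
    qed
    then show ?thesis using Pa[OF ij(1)] by (simp add: gram_def mult.commute)
  qed
  then show thesis using U that by blast
qed

lemma orth_proj_mats_is_gram:
  assumes "P \<in> orth_proj_mats n"
  obtains d U where "n \<le> d" "orthonormal {..<d} n U" "P = proj_mat d n U"
proof -
  obtain d where d: "n \<le> d" "P \<in> carrier_mat d d" "transpose_mat P = P" "P * P = P"
    and rank: "vec_space.rank d P = n"
    using assms unfolding orth_proj_mats_def by blast
  have 1: "P $$ (i, j) = P $$ (j, i)" if "i < d" "j < d" for i j
    using arg_cong[OF d(3), of "\<lambda>M. M $$ (i, j)"] that d(2) by simp
  have 2: "(\<Sum>k<d. P $$ (i, k) * P $$ (k, j)) = P $$ (i, j)" if "i < d" "j < d" for i j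
    using arg_cong[OF d(4), of "\<lambda>M. M $$ (i, j)"] that d(2)
    by (simp add: scalar_prod_def atLeast0LessThan)
  obtain m U where U: "orthonormal {..<d} m U" "\<And>i j. i < d \<Longrightarrow> j < d \<Longrightarrow> gram m U i j = P $$ (i, j)"
    using symmetric_idempotent_is_gram[where d = d and P = "\<lambda>i j. P $$ (i, j)"] 1 2 by blast
  have P: "P = proj_mat d m U"
    using U(2) d(2) by (intro eq_matI) (auto simp: proj_mat_def)
  have "proj_mat d m U \<in> orth_proj_mats m" using U(1) by (rule proj_mat_in_orth_proj_mats)
  then obtain d' where "proj_mat d m U \<in> carrier_mat d' d'" "vec_space.rank d' (proj_mat d m U) = m"
    unfolding orth_proj_mats_def by blast
  moreover from this have "d' = d" by (auto simp: proj_mat_def)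
  ultimately have "m = n" using rank P by simp
  then show thesis using that d(1) U(1) P by blast
qed

definition positive_row_sums :: "nat \<Rightarrow> real set" where
  "positive_row_sums n = {min_row_sum (abs_mat P) | P. P \<in> orth_proj_mats n \<and> positive_mat (abs_mat P)}"

lemma min_row_sum_proj_mat:
  "min_row_sum (abs_mat (proj_mat d n U)) = Min ((\<lambda>i. \<Sum>j<d. \<bar>gram n U i j\<bar>) ` {..<d})"
proof -
  have "(\<Sum>j<d. abs_mat (proj_mat d n U) $$ (i, j)) = (\<Sum>j<d. \<bar>gram n U i j\<bar>)" if "i < d" for i
    using that by (intro sum.cong) (auto simp: abs_mat_def proj_mat_def)
  then have "(\<lambda>i. \<Sum>j<d. abs_mat (proj_mat d n U) $$ (i, j)) ` {..<d} = (\<lambda>i. \<Sum>j<d. \<bar>gram n U i j\<bar>) ` {..<d}"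
    by (intro image_cong) auto
  moreover have "dim_row (abs_mat (proj_mat d n U)) = d" "dim_col (abs_mat (proj_mat d n U)) = d"
    by (auto simp: abs_mat_def proj_mat_def)
  ultimately show ?thesis unfolding min_row_sum_def by simp
qed

lemma positive_row_sumsE:
  assumes "r \<in> positive_row_sums n" "1 \<le> n"
  obtains d :: nat and U where "0 < d" "orthonormal {..<d} n U" "\<forall>i<d. r \<le> (\<Sum>j<d. \<bar>gram n U i j\<bar>)"
proof -
  obtain P where P: "P \<in> orth_proj_mats n" "r = min_row_sum (abs_mat P)"
    using assms unfolding positive_row_sums_def by blast
  from P(1) obtain d U where "n \<le> d" "orthonormal {..<d} n U" "P = proj_mat d n U"
    by (rule orth_proj_mats_is_gram)
  then have *: "n \<le> d" "orthonormal {..<d} n U"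
    "r = Min ((\<lambda>i. \<Sum>j<d. \<bar>gram n U i j\<bar>) ` {..<d})"
    using P(2) min_row_sum_proj_mat by simp_all
  have "r \<le> (\<Sum>j<d. \<bar>gram n U i j\<bar>)" if "i < d" for i
    unfolding * using that by (intro Min_le) auto
  then show thesis using * assms(2) that[of d U] by simp
qed

text \<open>An arbitrary finite index set is allowed, since the constructions that produce such systems replicate
indices.\<close>

lemma positive_row_sumsI:
  fixes U :: "'i \<Rightarrow> nat \<Rightarrow> real"
  assumes I: "finite I" and n: "1 \<le> n" and U: "orthonormal I n U"
    and nz: "\<And>i j. i \<in> I \<Longrightarrow> j \<in> I \<Longrightarrow> gram n U i j \<noteq> 0"
    and rows: "\<And>i. i \<in> I \<Longrightarrow> c \<le> (\<Sum>j\<in>I. \<bar>gram n U i j\<bar>)"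
  shows "\<exists>r\<in>positive_row_sums n. c \<le> r"
proof -
  obtain h where h: "bij_betw h {..<card I} I"
    using ex_bij_betw_nat_finite[OF I] unfolding atLeast0LessThan by blast
  let ?d = "card I" and ?V = "\<lambda>a. U (h a)"
  have hI: "h a \<in> I" if "a < ?d" for a using h that bij_betwE by blast
  have V: "orthonormal {..<?d} n ?V"
    unfolding orthonormal_def
  proof (intro allI impI)
    fix k l assume "k < n" "l < n"
    have "(\<Sum>a<?d. ?V a k * ?V a l) = (\<Sum>i\<in>I. U i k * U i l)"
      by (rule sum.reindex_bij_betw[OF h])
    then show "(\<Sum>a<?d. ?V a k * ?V a l) = (if k = l then 1 else 0)"
      using U \<open>k < n\<close> \<open>l < n\<close> by (simp add: orthonormal_def)
  qed
  have gr: "gram n ?V a b = gram n U (h a) (h b)" for a b by (simp add: gram_def)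
  let ?P = "proj_mat ?d n ?V"
  have "positive_mat (abs_mat ?P)"
    using nz hI by (simp add: positive_mat_def abs_mat_def proj_mat_def gr)
  then have "min_row_sum (abs_mat ?P) \<in> positive_row_sums n"
    unfolding positive_row_sums_def using proj_mat_in_orth_proj_mats[OF V] by blast
  moreover have "c \<le> min_row_sum (abs_mat ?P)"
  proof -
    have "I \<noteq> {}"
    proof
      assume "I = {}"
      have "(\<Sum>i\<in>I. U i 0 * U i 0) = (if (0::nat) = 0 then 1 else 0)"
        using U n unfolding orthonormal_def by simp
      then show False using \<open>I = {}\<close> by simp
    qed
    moreover have "c \<le> (\<Sum>b<?d. \<bar>gram n ?V a b\<bar>)" if "a < ?d" for a
      unfolding gr using rows[OF hI[OF that]] sum.reindex_bij_betw[OF h, of "\<lambda>j. \<bar>gram n U (h a) j\<bar>"] by simp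
    moreover have "{..<?d} \<noteq> {}" using I \<open>I \<noteq> {}\<close> card_gt_0_iff by blast
    ultimately show ?thesis
      unfolding min_row_sum_proj_mat by (subst Min_ge_iff) auto
  qed
  ultimately show ?thesis by blast
qed

section \<open>Weighted Gram sums are dominated by row sums\<close>

lemma eventually_quadratic_nonzero:
  fixes a b c :: real
  assumes "a \<noteq> 0 \<or> b \<noteq> 0 \<or> c \<noteq> 0"
  shows "eventually (\<lambda>s. a + s * b + s\<^sup>2 * c \<noteq> 0) (at_right 0)"
proof -
  have pos: "eventually (\<lambda>s::real. s \<noteq> 0) (at_right 0)"
    by (simp add: eventually_at_filter)
  have lin: "eventually (\<lambda>s. b + s * c \<noteq> 0) (at_right 0)" if "b \<noteq> 0 \<or> c \<noteq> 0"
  proof (cases "b = 0")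
    case True
    then show ?thesis using that pos by (auto elim: eventually_mono)
  next
    case False
    have "((\<lambda>s. b + s * c) \<longlongrightarrow> b + 0 * c) (at_right 0)" by (intro tendsto_intros)
    then show ?thesis using False by (intro tendsto_imp_eventually_ne) auto
  qed
  show ?thesis
  proof (cases "a = 0")
    case True
    have "eventually (\<lambda>s. s \<noteq> 0 \<and> b + s * c \<noteq> 0) (at_right 0)"
      using pos lin True assms by (simp add: eventually_conj_iff)
    then show ?thesis
    proof (rule eventually_mono)
      fix s assume s: "s \<noteq> 0 \<and> b + s * c \<noteq> 0"
      have "a + s * b + s\<^sup>2 * c = s * (b + s * c)" using True by (simp add: power2_eq_square algebra_simps)
      then show "a + s * b + s\<^sup>2 * c \<noteq> 0" using s by simp
    qed
  next
    case False
    have "((\<lambda>s. a + s * b + s\<^sup>2 * c) \<longlongrightarrow> a + 0 * b + 0\<^sup>2 * c) (at_right 0)" by (intro tendsto_intros)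
    then show ?thesis using False by (intro tendsto_imp_eventually_ne) auto
  qed
qed

text \<open>The projection of \<open>\<real>\<^sup>n\<^sup>+\<^sup>1\<close> along the vector of ones has rank \<open>n\<close> and entries
\<open>\<delta>\<^sub>a\<^sub>b - 1 / (n + 1)\<close>, none of which is 0.\<close>

lemma simplex_frame:
  assumes n: "1 \<le> n"
  obtains Y where "orthonormal {..<Suc n} n Y" "\<And>a b. a < Suc n \<Longrightarrow> b < Suc n \<Longrightarrow> gram n Y a b \<noteq> 0"
proof -
  define c where "c = 1 / real (Suc n)"
  define P where "P i j = (if i = j then 1 else 0) - c" for i j :: nat
  have idem: "(\<Sum>k<Suc n. P i k * P k j) = P i j" if "i < Suc n" "j < Suc n" for i j
  proof -
    have "(\<Sum>k<Suc n. P i k * P k j) = (\<Sum>k<Suc n. (if k = i then (if i = j then 1 else 0) - c else 0)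
        - (if k = j then c else 0) + c * c)"
      by (intro sum.cong refl) (auto simp: P_def algebra_simps)
    also have "\<dots> = (if i = j then 1 else 0) - c - c + real (Suc n) * (c * c)"
      using that by (simp add: sum.distrib sum_subtractf del: sum.lessThan_Suc)
    also have "real (Suc n) * (c * c) = c" by (simp add: c_def)
    finally show ?thesis by (simp add: P_def)
  qed
  have sym: "P i j = P j i" for i j by (simp add: P_def)
  obtain m Y where Y: "orthonormal {..<Suc n} m Y"
    and g: "\<And>i j. i < Suc n \<Longrightarrow> j < Suc n \<Longrightarrow> gram m Y i j = P i j"
    using symmetric_idempotent_is_gram[of "Suc n" P] sym idem by blast
  have "real m = (\<Sum>k<m. \<Sum>i<Suc n. Y i k * Y i k)"
    using Y by (simp add: orthonormal_def del: sum.lessThan_Suc)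
  also have "\<dots> = (\<Sum>i<Suc n. gram m Y i i)"
    unfolding gram_def by (rule sum.swap)
  also have "\<dots> = (\<Sum>i<Suc n. 1 - c)" by (intro sum.cong refl) (simp add: g P_def)
  also have "\<dots> = n" by (simp add: c_def field_simps del: sum.lessThan_Suc)
  finally have m: "m = n" by simp
  have "P a b \<noteq> 0" for a b using n by (auto simp: P_def c_def)
  then show thesis using Y g m by (intro that[of Y]) auto
qed

text \<open>A row of \<open>U\<close> with weight \<open>t\<^sub>i\<close> is replaced by the rows \<open>u\<^sub>i \<plusminus> s t\<^sub>i y\<^sub>a\<close>, up to a
common factor, where the \<open>y\<^sub>a\<close> are the vectors of the simplex frame. The two signs cancel the
mixed terms and the frame is isotropic, so the columns stay orthonormal up to the factor. A Gram number
of the new rows is a quadratic polynomial in \<open>s\<close> whose leading coefficient is a nonzero multiple of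
\<open>y\<^sub>a \<cdot> y\<^sub>b\<close>; it does not vanish for small \<open>s > 0\<close>. At \<open>s = 0\<close> the weighted sum has
not changed.\<close>

lemma perturb_to_positive:
  fixes U :: "'i \<Rightarrow> nat \<Rightarrow> real"
  assumes I: "finite I" and n: "1 \<le> n" and U: "orthonormal I n U"
    and t: "\<And>i. i \<in> I \<Longrightarrow> t i \<noteq> 0" "(\<Sum>i\<in>I. (t i)\<^sup>2) = 1" and \<delta>: "0 < \<delta>"
  obtains J :: "('i \<times> nat \<times> real) set" and V x
  where "finite J" "orthonormal J n V" "\<forall>e\<in>J. \<forall>e'\<in>J. gram n V e e' \<noteq> 0"
    "(\<Sum>e\<in>J. (x e)\<^sup>2) = 1"
    "(\<Sum>i\<in>I. \<Sum>j\<in>I. \<bar>gram n U i j\<bar> * (t i * t j)) - \<delta> \<le> (\<Sum>e\<in>J. \<Sum>e'\<in>J. \<bar>gram n V e e'\<bar> * (x e * x e'))"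
proof -
  obtain Y where Y: "orthonormal {..<Suc n} n Y"
    and Ynz: "\<And>a b. a < Suc n \<Longrightarrow> b < Suc n \<Longrightarrow> gram n Y a b \<noteq> 0"
    using simplex_frame[OF n] by blast
  define q where "q = sqrt (real (Suc n))"
  have qq: "q * q = real (Suc n)" and q0: "q > 0" by (auto simp: q_def)
  define J where "J = I \<times> {..<Suc n} \<times> {1, - 1 :: real}"
  define A where "A = 2 * real (Suc n)"
  have A: "A > 0" by (simp add: A_def)
  have A2: "A = 2 * (q * q)" by (simp add: A_def qq)
  define Z :: "real \<Rightarrow> 'i \<times> nat \<times> real \<Rightarrow> nat \<Rightarrow> real"
    where "Z s e k = (case e of (i, a, \<sigma>) \<Rightarrow> U i k + s * (t i * \<sigma> * (q * Y a k)))" for s e k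
  have J: "finite J" using I by (simp add: J_def)
  have sumJ: "(\<Sum>e\<in>J. f e) = (\<Sum>i\<in>I. \<Sum>a<Suc n. f (i, a, 1) + f (i, a, - 1))" for f :: "_ \<Rightarrow> real"
    unfolding J_def by (simp add: sum.cartesian_product' del: sum.lessThan_Suc)
  have frame: "(\<Sum>e\<in>J. Z s e k * Z s e l) = (if k = l then A * (1 + s\<^sup>2) else 0)" if kl: "k < n" "l < n" for s k l
  proof -
    have "(\<Sum>e\<in>J. Z s e k * Z s e l)
        = (\<Sum>i\<in>I. \<Sum>a<Suc n. 2 * (U i k * U i l) + A * s\<^sup>2 * ((t i)\<^sup>2 * (Y a k * Y a l)))"
      unfolding sumJ A2 by (intro sum.cong refl) (simp add: Z_def power2_eq_square algebra_simps)
    also have "\<dots> = (\<Sum>i\<in>I. \<Sum>a<Suc n. 2 * (U i k * U i l))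
        + (\<Sum>i\<in>I. \<Sum>a<Suc n. A * s\<^sup>2 * ((t i)\<^sup>2 * (Y a k * Y a l)))"
      by (simp only: sum.distrib)
    also have "(\<Sum>i\<in>I. \<Sum>a<Suc n. 2 * (U i k * U i l)) = A * (\<Sum>i\<in>I. U i k * U i l)"
      unfolding sum_distrib_left by (simp add: A_def algebra_simps del: sum.lessThan_Suc)
    also have "(\<Sum>i\<in>I. \<Sum>a<Suc n. A * s\<^sup>2 * ((t i)\<^sup>2 * (Y a k * Y a l)))
        = A * s\<^sup>2 * ((\<Sum>i\<in>I. (t i)\<^sup>2) * (\<Sum>a<Suc n. Y a k * Y a l))"
      unfolding sum_product by (simp only: sum_distrib_left)
    also have "A * (\<Sum>i\<in>I. U i k * U i l) + A * s\<^sup>2 * ((\<Sum>i\<in>I. (t i)\<^sup>2) * (\<Sum>a<Suc n. Y a k * Y a l))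
        = (if k = l then A * (1 + s\<^sup>2) else 0)"
      using U Y kl t(2) by (simp add: orthonormal_def algebra_simps del: sum.lessThan_Suc)
    finally show ?thesis .
  qed
  define V where "V s e k = Z s e k / sqrt (A * (1 + s\<^sup>2))" for s e k
  have As: "A * (1 + s\<^sup>2) > 0" for s using A by (simp add: add_pos_nonneg)
  have V: "orthonormal J n (V s)" for s
    unfolding orthonormal_def
  proof (intro allI impI)
    fix k l assume kl: "k < n" "l < n"
    have "(\<Sum>e\<in>J. V s e k * V s e l) = (\<Sum>e\<in>J. Z s e k * Z s e l) / (A * (1 + s\<^sup>2))"
      unfolding V_def sum_divide_distrib using As[of s] by (intro sum.cong refl) simp
    then show "(\<Sum>e\<in>J. V s e k * V s e l) = (if k = l then 1 else 0)"
      using As[of s] unfolding frame[OF kl] by (cases "k = l") auto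
  qed
  have gV: "gram n (V s) e e' = gram n (Z s) e e' / (A * (1 + s\<^sup>2))" for s e e'
    unfolding gram_def V_def sum_divide_distrib using As[of s] by (intro sum.cong refl) simp
  define x :: "'i \<times> nat \<times> real \<Rightarrow> real" where "x e = t (fst e) / sqrt A" for e
  have xx: "(\<Sum>e\<in>J. (x e)\<^sup>2) = 1"
  proof -
    have "(\<Sum>e\<in>J. (x e)\<^sup>2) = (\<Sum>i\<in>I. \<Sum>a<Suc n. 2 / A * (t i)\<^sup>2)"
      unfolding sumJ using A by (intro sum.cong refl) (simp add: x_def power_divide)
    also have "\<dots> = (\<Sum>i\<in>I. (t i)\<^sup>2)"
      by (intro sum.cong refl) (simp add: A_def field_simps del: sum.lessThan_Suc)
    finally show ?thesis using t by simp
  qed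
  have nz: "eventually (\<lambda>s. gram n (V s) e e' \<noteq> 0) (at_right 0)" if e: "e \<in> J" "e' \<in> J" for e e'
  proof -
    obtain i a \<sigma> j b \<tau> where ee: "e = (i, a, \<sigma>)" "e' = (j, b, \<tau>)" by (metis surj_pair)
    have quad: "gram n (Z s) e e' = gram n U i j + s * (\<Sum>k<n. U i k * (t j * \<tau> * (q * Y b k)) + U j k * (t i * \<sigma> * (q * Y a k)))
       + s\<^sup>2 * (t i * t j * \<sigma> * \<tau> * (q * q) * gram n Y a b)" for s
      unfolding gram_def Z_def ee prod.case sum_distrib_left sum.distrib[symmetric]
      by (intro sum.cong refl) (simp add: power2_eq_square algebra_simps)
    have lead: "t i * t j * \<sigma> * \<tau> * (q * q) * gram n Y a b \<noteq> 0"
      using e t(1) q0 Ynz unfolding ee J_def by auto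
    have "eventually (\<lambda>s. gram n (Z s) e e' \<noteq> 0) (at_right 0)"
      unfolding quad by (rule eventually_quadratic_nonzero) (use lead in blast)
    then show ?thesis
    proof (rule eventually_mono)
      fix s assume "gram n (Z s) e e' \<noteq> 0"
      then show "gram n (V s) e e' \<noteq> 0" unfolding gV using As[of s] by auto
    qed
  qed
  have twice: "(\<Sum>a<Suc n. c + c) = A * c" for c :: real
    by (simp add: A_def algebra_simps del: sum.lessThan_Suc)
  define F where "F s = (\<Sum>e\<in>J. \<Sum>e'\<in>J. \<bar>gram n (V s) e e'\<bar> * (x e * x e'))" for s
  have "continuous_on UNIV F"
  proof -
    have "continuous_on UNIV (\<lambda>s. V s e k)" for e k
      unfolding V_def Z_def split_beta
      by (intro continuous_intros ballI) (metis As less_irrefl real_sqrt_eq_zero_cancel_iff)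
    then show ?thesis unfolding F_def gram_def by (intro continuous_intros)
  qed
  then have "(F \<longlongrightarrow> F 0) (at_right 0)"
    by (metis UNIV_I continuous_on_def tendsto_within_subset subset_UNIV)
  moreover have F0: "F 0 = (\<Sum>i\<in>I. \<Sum>j\<in>I. \<bar>gram n U i j\<bar> * (t i * t j))"
  proof -
    have "F 0 = (\<Sum>e\<in>J. \<Sum>e'\<in>J. \<bar>gram n U (fst e) (fst e')\<bar> * (t (fst e) * t (fst e')) / (A * A))"
      unfolding F_def gV
    proof (intro sum.cong refl)
      fix e e'
      have "gram n (Z 0) e e' = gram n U (fst e) (fst e')" by (simp add: gram_def Z_def split_beta)
      moreover have "x e * x e' = t (fst e) * t (fst e') / A" using A by (simp add: x_def)
      ultimately show "\<bar>gram n (Z 0) e e' / (A * (1 + 0\<^sup>2))\<bar> * (x e * x e')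
          = \<bar>gram n U (fst e) (fst e')\<bar> * (t (fst e) * t (fst e')) / (A * A)"
        using A by simp
    qed
    also have "\<dots> = (\<Sum>i\<in>I. A * (\<Sum>j\<in>I. A * (\<bar>gram n U i j\<bar> * (t i * t j) / (A * A))))"
      unfolding sumJ fst_conv twice by (rule refl)
    also have "\<dots> = (\<Sum>i\<in>I. \<Sum>j\<in>I. \<bar>gram n U i j\<bar> * (t i * t j))"
      using A by (simp add: sum_distrib_left)
    finally show ?thesis .
  qed
  ultimately have "eventually (\<lambda>s. F 0 - \<delta> < F s) (at_right 0)"
    using \<delta> by (intro order_tendstoD(1)) auto
  moreover have "eventually (\<lambda>s. \<forall>e\<in>J. \<forall>e'\<in>J. gram n (V s) e e' \<noteq> 0) (at_right 0)"
    using J nz by (intro eventually_ball_finite ballI) auto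
  ultimately have "eventually (\<lambda>s. F 0 - \<delta> < F s \<and> (\<forall>e\<in>J. \<forall>e'\<in>J. gram n (V s) e e' \<noteq> 0)) (at_right 0)"
    by (rule eventually_conj)
  then obtain s where s: "F 0 - \<delta> < F s" "\<forall>e\<in>J. \<forall>e'\<in>J. gram n (V s) e e' \<noteq> 0"
    using eventually_happens'[OF trivial_limit_at_right_real] by blast
  show thesis
    by (rule that[OF J V[of s] _ xx]) (use s F0 in \<open>auto simp: F_def\<close>)
qed

text \<open>If row \<open>i\<close> is replaced by \<open>m\<^sub>i\<close> equal rows, each divided by \<open>sqrt m\<^sub>i\<close>, the columns stay
orthonormal and the row sums become \<open>\<Sum>\<^sub>j |p\<^sub>i\<^sub>j| sqrt (m\<^sub>j / m\<^sub>i)\<close>. For multiplicities approximately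
proportional to \<open>t\<^sub>i\<^sup>2\<close> these are close to \<open>\<rho>\<close>.\<close>

lemma blow_up:
  fixes U :: "'i \<Rightarrow> nat \<Rightarrow> real"
  assumes I: "finite I" and n: "1 \<le> n" and U: "orthonormal I n U"
    and nz: "\<And>i j. i \<in> I \<Longrightarrow> j \<in> I \<Longrightarrow> gram n U i j \<noteq> 0"
    and t: "\<And>i. i \<in> I \<Longrightarrow> 0 < t i"
    and eig: "\<And>i. i \<in> I \<Longrightarrow> (\<Sum>j\<in>I. \<bar>gram n U i j\<bar> * t j) = \<rho> * t i" and \<delta>: "0 < \<delta>"
  shows "\<exists>r\<in>positive_row_sums n. \<rho> - \<delta> \<le> r"
proof -
  define m where "m N i = nat \<lceil>real N * (t i)\<^sup>2\<rceil>" for N i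
  have m_lower: "real N * (t i)\<^sup>2 \<le> real (m N i)" for N i
    unfolding m_def by (simp add: real_nat_ceiling_ge)
  have m_upper: "real (m N i) \<le> real N * (t i)\<^sup>2 + 1" for N i
  proof -
    have "\<lceil>0::real\<rceil> \<le> \<lceil>real N * (t i)\<^sup>2\<rceil>" by (rule ceiling_mono) simp
    then have "0 \<le> \<lceil>real N * (t i)\<^sup>2\<rceil>" by (simp only: ceiling_zero)
    then have "real (m N i) = of_int \<lceil>real N * (t i)\<^sup>2\<rceil>" unfolding m_def by simp
    then show ?thesis by linarith
  qed
  have lim: "(\<lambda>N. real (m N i) / real N) \<longlonglongrightarrow> (t i)\<^sup>2" for i
  proof (rule tendsto_sandwich)
    show "eventually (\<lambda>N. (t i)\<^sup>2 \<le> real (m N i) / real N) sequentially"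
      using eventually_gt_at_top[of 0]
      by eventually_elim (use m_lower in \<open>simp add: field_simps\<close>)
    show "eventually (\<lambda>N. real (m N i) / real N \<le> (t i)\<^sup>2 + 1 / real N) sequentially"
      using eventually_gt_at_top[of 0]
      by eventually_elim (use m_upper in \<open>simp add: field_simps\<close>)
    have "(\<lambda>N. (t i)\<^sup>2 + 1 / real N) \<longlonglongrightarrow> (t i)\<^sup>2 + 0"
      by (intro tendsto_intros lim_1_over_n)
    then show "(\<lambda>N. (t i)\<^sup>2 + 1 / real N) \<longlonglongrightarrow> (t i)\<^sup>2" by simp
  qed simp
  let ?row = "\<lambda>N i. \<Sum>j\<in>I. \<bar>gram n U i j\<bar> * (sqrt (real (m N j) / real N) / sqrt (real (m N i) / real N))"
  have row_lim: "(\<lambda>N. ?row N i) \<longlonglongrightarrow> \<rho>" if i: "i \<in> I" for i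
  proof -
    have "(\<lambda>N. ?row N i) \<longlonglongrightarrow> (\<Sum>j\<in>I. \<bar>gram n U i j\<bar> * (sqrt ((t j)\<^sup>2) / sqrt ((t i)\<^sup>2)))"
      using t[OF i] by (intro tendsto_intros lim) auto
    also have "(\<Sum>j\<in>I. \<bar>gram n U i j\<bar> * (sqrt ((t j)\<^sup>2) / sqrt ((t i)\<^sup>2))) = (\<Sum>j\<in>I. \<bar>gram n U i j\<bar> * t j) / t i"
      unfolding sum_divide_distrib
    proof (rule sum.cong[OF refl])
      fix j assume "j \<in> I"
      from t[OF this] t[OF i]
      show "\<bar>gram n U i j\<bar> * (sqrt ((t j)\<^sup>2) / sqrt ((t i)\<^sup>2)) = \<bar>gram n U i j\<bar> * t j / t i"
        by simp
    qed
    also have "\<dots> = \<rho>" using eig[OF i] t[OF i] by simp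
    finally show ?thesis .
  qed
  have "eventually (\<lambda>N. \<forall>i\<in>I. \<rho> - \<delta> < ?row N i) sequentially"
    using I \<delta> order_tendstoD(1)[OF row_lim] by (intro eventually_ball_finite ballI) auto
  then have "eventually (\<lambda>N. 0 < N \<and> (\<forall>i\<in>I. \<rho> - \<delta> < ?row N i)) sequentially"
    using eventually_gt_at_top by (rule eventually_conj[rotated])
  then obtain N where N: "0 < N" "\<forall>i\<in>I. \<rho> - \<delta> < ?row N i"
    using eventually_happens'[OF sequentially_bot] by blast
  have mpos: "0 < m N i" if "i \<in> I" for i
  proof -
    have "0 < real N * (t i)\<^sup>2" using N(1) t[OF that] by simp
    then show ?thesis using m_lower[of N i] by linarith
  qed
  let ?J = "Sigma I (\<lambda>i. {..<m N i})"
  define V where "V e k = U (fst e) k / sqrt (real (m N (fst e)))" for e :: "'i \<times> nat" and k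
  have sumJ: "(\<Sum>e\<in>?J. f (fst e)) = (\<Sum>i\<in>I. real (m N i) * f i)" for f :: "'i \<Rightarrow> real"
    using sum.Sigma[OF I, of "\<lambda>i. {..<m N i}" "\<lambda>i _. f i"] by (simp add: split_beta)
  have V: "orthonormal ?J n V"
    unfolding orthonormal_def
  proof (intro allI impI)
    fix k l assume kl: "k < n" "l < n"
    have "(\<Sum>e\<in>?J. V e k * V e l) = (\<Sum>i\<in>I. real (m N i) * (U i k / sqrt (real (m N i)) * (U i l / sqrt (real (m N i)))))"
      unfolding V_def by (rule sumJ)
    also have "\<dots> = (\<Sum>i\<in>I. U i k * U i l)"
      using mpos by (intro sum.cong refl) (simp add: less_imp_neq[symmetric])
    finally show "(\<Sum>e\<in>?J. V e k * V e l) = (if k = l then 1 else 0)"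
      using U kl by (simp add: orthonormal_def)
  qed
  have gV: "gram n V e e' = gram n U (fst e) (fst e') / (sqrt (real (m N (fst e))) * sqrt (real (m N (fst e'))))" for e e'
    unfolding gram_def V_def sum_divide_distrib by (intro sum.cong refl) simp
  show ?thesis
  proof (rule positive_row_sumsI[OF _ n V])
    show "finite ?J" using I by simp
    show "gram n V e e' \<noteq> 0" if "e \<in> ?J" "e' \<in> ?J" for e e'
      unfolding gV using that nz by auto
    show "\<rho> - \<delta> \<le> (\<Sum>e'\<in>?J. \<bar>gram n V e e'\<bar>)" if e: "e \<in> ?J" for e
    proof -
      let ?i = "fst e"
      have i: "?i \<in> I" using e by auto
      have "(\<Sum>e'\<in>?J. \<bar>gram n V e e'\<bar>)
          = (\<Sum>j\<in>I. real (m N j) * \<bar>gram n U ?i j / (sqrt (real (m N ?i)) * sqrt (real (m N j)))\<bar>)"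
        unfolding gV by (rule sumJ)
      also have "\<dots> = ?row N ?i"
      proof (intro sum.cong refl)
        fix j assume "j \<in> I"
        have "real (m N j) = sqrt (real (m N j)) * sqrt (real (m N j))" by simp
        then show "real (m N j) * \<bar>gram n U ?i j / (sqrt (real (m N ?i)) * sqrt (real (m N j)))\<bar>
          = \<bar>gram n U ?i j\<bar> * (sqrt (real (m N j) / real N) / sqrt (real (m N ?i) / real N))"
          using mpos[OF \<open>j \<in> I\<close>] mpos[OF i] N(1) by (simp add: real_sqrt_divide abs_mult field_simps)
      qed
      finally show ?thesis using N(2) i by force
    qed
  qed
qed

lemma weighted_gram_le_row_sum:
  fixes U :: "'i \<Rightarrow> nat \<Rightarrow> real"
  assumes I: "finite I" and n: "1 \<le> n" and U: "orthonormal I n U"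
    and t: "\<And>i. i \<in> I \<Longrightarrow> t i \<noteq> 0" "(\<Sum>i\<in>I. (t i)\<^sup>2) = 1" and \<delta>: "0 < \<delta>"
  shows "\<exists>r\<in>positive_row_sums n. (\<Sum>i\<in>I. \<Sum>j\<in>I. \<bar>gram n U i j\<bar> * (t i * t j)) - \<delta> \<le> r"
proof -
  have half: "0 < \<delta> / 2" using \<delta> by simp
  obtain J :: "('i \<times> nat \<times> real) set" and V x
    where J: "finite J" and V: "orthonormal J n V" and nz: "\<forall>e\<in>J. \<forall>e'\<in>J. gram n V e e' \<noteq> 0"
    and x: "(\<Sum>e\<in>J. (x e)\<^sup>2) = 1"
    and le: "(\<Sum>i\<in>I. \<Sum>j\<in>I. \<bar>gram n U i j\<bar> * (t i * t j)) - \<delta> / 2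
      \<le> (\<Sum>e\<in>J. \<Sum>e'\<in>J. \<bar>gram n V e e'\<bar> * (x e * x e'))"
    by (rule perturb_to_positive[where U = U and t = t and \<delta> = "\<delta> / 2", OF I n U t half])
  have pos: "0 < \<bar>gram n V e e'\<bar>" if "e \<in> J" "e' \<in> J" for e e'
    using nz that by simp
  have sym: "\<bar>gram n V e e'\<bar> = \<bar>gram n V e' e\<bar>" for e e'
    by (simp add: gram_sym)
  obtain s \<rho> where s: "\<forall>e\<in>J. 0 < s e"
    and \<rho>: "(\<Sum>e\<in>J. \<Sum>e'\<in>J. \<bar>gram n V e e'\<bar> * (x e * x e')) \<le> \<rho>"
    and eig: "\<forall>e\<in>J. (\<Sum>e'\<in>J. \<bar>gram n V e e'\<bar> * s e') = \<rho> * s e" and "(\<Sum>e\<in>J. (s e)\<^sup>2) = 1"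
    by (rule perron_vector[OF J pos sym x])
  obtain r where "r \<in> positive_row_sums n" "\<rho> - \<delta> / 2 \<le> r"
    using blow_up[where U = V and t = s, OF J n V nz[rule_format] s[rule_format] eig[rule_format] half] by blast
  then show ?thesis using le \<rho> by (intro bexI[of _ r]) auto
qed

section \<open>Projections of small norm\<close>

text \<open>The minimal row sum is at most the mean row sum. With \<open>|g| \<le> (d g\<^sup>2 + 1 / d) / 2\<close>, the fact
that the squares of the entries add up to \<open>n\<close> bounds the mean independently of the size.\<close>

lemma positive_row_sums_bdd:
  assumes r: "r \<in> positive_row_sums n" and n: "1 \<le> n"
  shows "r \<le> (real n + 1) / 2"
proof -
  obtain d :: nat and U where d: "0 < d" and U: "orthonormal {..<d} n U"
    and le: "\<forall>i<d. r \<le> (\<Sum>j<d. \<bar>gram n U i j\<bar>)"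
    by (rule positive_row_sumsE[OF r n])
  have am: "\<bar>g\<bar> \<le> (d * g\<^sup>2 + 1 / d) / 2" for g :: real
  proof -
    have "0 \<le> (sqrt d * \<bar>g\<bar> - 1 / sqrt d)\<^sup>2" by simp
    also have "\<dots> = d * g\<^sup>2 + 1 / d - 2 * \<bar>g\<bar>"
      using d by (simp add: power2_diff power_mult_distrib power_divide)
    finally show ?thesis by simp
  qed
  have "d * r \<le> (\<Sum>i<d. \<Sum>j<d. \<bar>gram n U i j\<bar>)"
    using sum_mono[of "{..<d}" "\<lambda>_. r" "\<lambda>i. \<Sum>j<d. \<bar>gram n U i j\<bar>"] le by simp
  also have "\<dots> \<le> (\<Sum>i<d. \<Sum>j<d. (d * (gram n U i j)\<^sup>2 + 1 / d) / 2)"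
    by (intro sum_mono am)
  also have "\<dots> = (d * (\<Sum>i<d. \<Sum>j<d. (gram n U i j)\<^sup>2) + d) / 2"
    using d by (simp add: sum_divide_distrib[symmetric] sum.distrib sum_distrib_left)
  also have "\<dots> = d * ((real n + 1) / 2)"
    using sum_gram_squares[OF U] by (simp add: field_simps)
  finally show ?thesis using d by simp
qed

lemma positive_row_sums_nonneg:
  assumes r: "r \<in> positive_row_sums n" and n: "1 \<le> n"
  shows "0 \<le> r"
proof -
  obtain P where P: "P \<in> orth_proj_mats n" "r = min_row_sum (abs_mat P)"
    using r unfolding positive_row_sums_def by blast
  from P(1) obtain d U where "n \<le> d" "P = proj_mat d n U" by (rule orth_proj_mats_is_gram)
  then have r: "r = Min ((\<lambda>i. \<Sum>j<d. \<bar>gram n U i j\<bar>) ` {..<d})" and d: "0 < d"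
    using P(2) min_row_sum_proj_mat n by simp_all
  then have "{..<d} \<noteq> {}" by auto
  then show ?thesis unfolding r by (subst Min_ge_iff) (auto intro: sum_nonneg)
qed

lemma positive_row_sums_nonempty: "1 \<le> n \<Longrightarrow> positive_row_sums n \<noteq> {}"
proof -
  assume n: "1 \<le> n"
  obtain Y where Y: "orthonormal {..<Suc n} n Y" "\<And>a b. a < Suc n \<Longrightarrow> b < Suc n \<Longrightarrow> gram n Y a b \<noteq> 0"
    using simplex_frame[OF n] by blast
  have "\<exists>r\<in>positive_row_sums n. 0 \<le> r"
    using Y by (intro positive_row_sumsI[OF _ n Y(1)]) (auto intro: sum_nonneg simp del: sum.lessThan_Suc)
  then show ?thesis by blast
qed

text \<open>The finite-dimensional upper bound. The weights of the minimax principle may vanish, so they are first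
mixed with a small multiple of the uniform weights. With \<open>V\<close> an orthonormal basis of the range of
\<open>D U\<close>, \<open>D = diag t\<close>, the matrix \<open>D\<^sup>-\<^sup>1 V V\<^sup>T D\<close> is a projection onto the range of \<open>U\<close>, and
its weighted mean of row norms is \<open>\<Sum> t\<^sub>i t\<^sub>j |v\<^sub>i \<cdot> v\<^sub>j|\<close>.\<close>

lemma near_optimal_left_inverse:
  assumes n: "1 \<le> n" and U: "orthonormal {..<d} n U"
    and c: "\<And>r. r \<in> positive_row_sums n \<Longrightarrow> r \<le> c" and \<epsilon>: "0 < \<epsilon>"
  shows "\<exists>R. left_inverse n d R U \<and> (\<forall>i<d. row_norm n d U R i \<le> c + \<epsilon>)"
proof (rule ccontr)
  assume contra: "\<not> ?thesis"
  define \<mu> where "\<mu> = c + \<epsilon>"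
  have big: "\<exists>i<d. \<mu> < row_norm n d U R i" if "left_inverse n d R U" for R
    using contra that unfolding \<mu>_def by (meson not_le)
  obtain w where "\<forall>i<d. 0 \<le> w i" "(\<Sum>i<d. w i) = 1"
    "\<forall>R. left_inverse n d R U \<longrightarrow> \<mu> \<le> (\<Sum>i<d. w i * row_norm n d U R i)"
    by (rule minimax_weights[OF U big])
  note w = this(1)[rule_format] this(2) this(3)[rule_format]
  have orth: "(\<Sum>i<d. U i k * U i l) = (if k = l then 1 else 0)" if "k < n" "l < n" for k l
    using U that by (auto simp: orthonormal_def)
  have d: "0 < d" using w(2) by (cases d) auto
  \<comment> \<open>small enough that mixing in the uniform weights costs at most \<open>\<epsilon> / 2\<close>\<close>
  define \<eta> where "\<eta> = \<epsilon> / (2 * (\<bar>\<mu>\<bar> + \<epsilon>))"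
  have \<eta>: "0 < \<eta>" "\<eta> \<le> 1" "\<eta> * \<mu> \<le> \<epsilon> / 2"
  proof -
    show "0 < \<eta>" using \<epsilon> by (simp add: \<eta>_def add_nonneg_pos)
    show "\<eta> \<le> 1" using \<epsilon> by (simp add: \<eta>_def divide_le_eq add_nonneg_pos)
    have pos: "0 < \<bar>\<mu>\<bar> + \<epsilon>" using \<epsilon> by simp
    have "\<eta> * \<mu> \<le> \<eta> * (\<bar>\<mu>\<bar> + \<epsilon>)" using \<open>0 < \<eta>\<close> \<epsilon> by (intro mult_left_mono) auto
    also have "\<dots> = \<epsilon> / 2" unfolding \<eta>_def using pos by (simp add: divide_simps)
    finally show "\<eta> * \<mu> \<le> \<epsilon> / 2" .
  qed
  define v where "v i = (1 - \<eta>) * w i + \<eta> / d" for i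
  have v: "0 < v i" if "i < d" for i
    using w(1)[OF that] \<eta> d unfolding v_def by (intro add_nonneg_pos mult_nonneg_nonneg) auto
  have v1: "(\<Sum>i<d. v i) = 1"
    using w(2) d by (simp add: v_def sum.distrib sum_distrib_left[symmetric])
  have v\<rho>: "c + \<epsilon> / 2 \<le> (\<Sum>i<d. v i * row_norm n d U R i)" if R: "left_inverse n d R U" for R
  proof -
    have "c + \<epsilon> / 2 \<le> (1 - \<eta>) * \<mu>" using \<eta>(3) by (simp add: \<mu>_def algebra_simps)
    also have "\<dots> \<le> (1 - \<eta>) * (\<Sum>i<d. w i * row_norm n d U R i)"
      using w(3)[OF R] \<eta> by (intro mult_left_mono) auto
    also have "\<dots> \<le> (\<Sum>i<d. v i * row_norm n d U R i)"
      unfolding sum_distrib_left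
    proof (rule sum_mono)
      fix i
      have "0 \<le> \<eta> / d * row_norm n d U R i" using \<eta>(1) by (intro mult_nonneg_nonneg row_norm_nonneg) auto
      then show "(1 - \<eta>) * (w i * row_norm n d U R i) \<le> v i * row_norm n d U R i"
        by (simp add: v_def algebra_simps)
    qed
    finally show ?thesis .
  qed
  define t where "t i = sqrt (v i)" for i
  have t: "0 < t i" if "i < d" for i using v[OF that] by (simp add: t_def)
  have tt: "t i * t i = v i" if "i < d" for i using v[OF that] by (simp add: t_def)
  \<comment> \<open>the orthogonal projection for the weighted inner product\<close>
  let ?b = "\<lambda>k. fseq d (\<lambda>i. t i * U i k)"
  have comb: "(\<Sum>k<n. a k *\<^sub>R ?b k) = fseq d (\<lambda>i. t i * (\<Sum>k<n. a k * U i k))" for a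
    by (rule bcontfun_eqI) (simp add: sum_distrib_left mult_ac)
  have indep: "a l = 0" if "\<And>i. i < d \<Longrightarrow> (\<Sum>k<n. a k * U i k) = 0" "l < n" for a l
    using orthonormal_independent[OF U, of a l] that by simp
  let ?E = "{\<Sum>k<n. a k *\<^sub>R ?b k | a. True}"
  have "fin_dim n ?E"
  proof (rule fin_dim_combinations)
    fix a assume a: "(\<Sum>k<n. a k *\<^sub>R ?b k) = 0"
    have "(\<Sum>k<n. a k * U i k) = 0" if "i < d" for i
      using arg_cong[OF a, of "\<lambda>x. apply_bcontfun x i"] that t[OF that] unfolding comb by simp
    then show "\<forall>k<n. a k = 0" using indep by blast
  qed
  moreover have "apply_bcontfun x i = 0" if "x \<in> ?E" "d \<le> i" for x i
    using that unfolding comb by auto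
  ultimately obtain V where V: "orthonormal {..<d} n V"
    and E: "?E = {fseq d (\<lambda>i. \<Sum>k<n. a k * V i k) | a. True}"
    by (rule gram_schmidt_fin_dim)
  have "\<exists>a. \<forall>i<d. V i l = t i * (\<Sum>k<n. a k * U i k)" if l: "l < n" for l
  proof -
    have "fseq d (\<lambda>i. V i l) \<in> ?E" unfolding E by (rule column_in_span[OF l])
    then obtain a where a: "fseq d (\<lambda>i. V i l) = fseq d (\<lambda>i. t i * (\<Sum>k<n. a k * U i k))"
      unfolding comb by blast
    have "V i l = t i * (\<Sum>k<n. a k * U i k)" if "i < d" for i
      using arg_cong[OF a, of "\<lambda>x. apply_bcontfun x i"] that by simp
    then show ?thesis by blast
  qed
  then have "\<forall>l. \<exists>a. l < n \<longrightarrow> (\<forall>i<d. V i l = t i * (\<Sum>k<n. a k * U i k))" by blast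
  from choice[OF this] obtain C1
    where "\<forall>l. l < n \<longrightarrow> (\<forall>i<d. V i l = t i * (\<Sum>k<n. C1 l k * U i k))" by (rule exE)
  then have c1: "V i l = t i * (\<Sum>k<n. C1 l k * U i k)" if "i < d" "l < n" for i l
    using that by blast
  have "\<exists>a. \<forall>i<d. t i * U i m = (\<Sum>l<n. a l * V i l)" if m: "m < n" for m
  proof -
    have "fseq d (\<lambda>i. t i * U i m) = (\<Sum>k<n. (if k = m then 1 else 0) *\<^sub>R ?b k)"
      using m by (simp add: if_distrib[of "\<lambda>x. x *\<^sub>R _"] cong: if_cong)
    then have "fseq d (\<lambda>i. t i * U i m) \<in> ?E"
      by (intro CollectI exI[of _ "\<lambda>k. if k = m then 1 else 0"]) simp
    then obtain a where a: "fseq d (\<lambda>i. t i * U i m) = fseq d (\<lambda>i. \<Sum>k<n. a k * V i k)"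
      unfolding E by blast
    have "t i * U i m = (\<Sum>l<n. a l * V i l)" if "i < d" for i
      using arg_cong[OF a, of "\<lambda>x. apply_bcontfun x i"] that by simp
    then show ?thesis by blast
  qed
  then have "\<forall>m. \<exists>a. m < n \<longrightarrow> (\<forall>i<d. t i * U i m = (\<Sum>l<n. a l * V i l))" by blast
  from choice[OF this] obtain C2
    where "\<forall>m. m < n \<longrightarrow> (\<forall>i<d. t i * U i m = (\<Sum>l<n. C2 m l * V i l))" by (rule exE)
  then have c2: "t i * U i m = (\<Sum>l<n. C2 m l * V i l)" if "i < d" "m < n" for i m
    using that by blast
  define R where "R k j = (\<Sum>l<n. C1 l k * V j l) * t j" for k j
  have UR: "(\<Sum>k<n. U i k * R k j) = gram n V i j * (t j / t i)" if ij: "i < d" "j < d" for i j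
  proof -
    have "t i * (\<Sum>k<n. U i k * R k j) = (\<Sum>k<n. \<Sum>l<n. t i * (C1 l k * U i k) * (V j l * t j))"
      by (simp add: R_def sum_distrib_left sum_distrib_right mult_ac)
    also have "\<dots> = (\<Sum>l<n. (t i * (\<Sum>k<n. C1 l k * U i k)) * (V j l * t j))"
      by (subst sum.swap) (simp add: sum_distrib_left sum_distrib_right)
    also have "\<dots> = (\<Sum>l<n. V i l * (V j l * t j))"
      by (intro sum.cong refl) (simp add: c1[OF ij(1)])
    also have "\<dots> = gram n V i j * t j" by (simp add: gram_def sum_distrib_right mult.assoc)
    finally show ?thesis using t[OF ij(1)] by (simp add: field_simps)
  qed
  have R: "left_inverse n d R U"
    unfolding left_inverse_def
  proof (intro allI impI)
    fix k m assume km: "k < n" "m < n"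
    let ?G = "\<lambda>k. \<Sum>j<d. R k j * U j m"
    have "(\<Sum>k<n. (?G k - (if k = m then 1 else 0)) * U i k) = 0" if i: "i < d" for i
    proof -
      have "(\<Sum>k<n. ?G k * U i k) = (\<Sum>j<d. (\<Sum>k<n. U i k * R k j) * U j m)"
        unfolding sum_distrib_right by (subst sum.swap) (simp add: mult_ac)
      also have "\<dots> = (\<Sum>j<d. gram n V i j * (t j * U j m)) / t i"
        unfolding sum_divide_distrib by (intro sum.cong refl) (simp add: UR[OF i])
      also have "(\<Sum>j<d. gram n V i j * (t j * U j m))
          = (\<Sum>j<d. \<Sum>p<n. \<Sum>q<n. V i p * (C2 m q * (V j p * V j q)))"
      proof (rule sum.cong[OF refl])
        fix j assume "j \<in> {..<d}"
        then have j: "j < d" by simp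
        show "gram n V i j * (t j * U j m) = (\<Sum>p<n. \<Sum>q<n. V i p * (C2 m q * (V j p * V j q)))"
          unfolding c2[OF j km(2)] gram_def sum_product by (intro sum.cong refl) (simp add: mult_ac)
      qed
      also have "\<dots> = (\<Sum>p<n. \<Sum>q<n. \<Sum>j<d. V i p * (C2 m q * (V j p * V j q)))"
        by (subst sum_rotate[symmetric], rule refl)
      also have "\<dots> = (\<Sum>p<n. \<Sum>q<n. V i p * (C2 m q * (\<Sum>j<d. V j p * V j q)))"
        by (simp add: sum_distrib_left)
      also have "\<dots> = (\<Sum>p<n. \<Sum>q<n. if p = q then V i p * C2 m q else 0)"
        using V by (intro sum.cong refl) (auto simp: orthonormal_def)
      also have "\<dots> = t i * U i m" by (simp add: c2[OF i km(2)] mult.commute)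
      also have "\<dots> / t i = U i m" using t[OF i] by simp
      finally show ?thesis
        using km by (simp add: left_diff_distrib sum_subtractf if_distrib[of "\<lambda>x. x * _"] cong: if_cong)
    qed
    then have "?G k - (if k = m then 1 else 0) = 0"
      by (rule indep[where a = "\<lambda>k. ?G k - (if k = m then 1 else 0)", OF _ km(1)])
    then show "?G k = (if k = m then 1 else 0)" by simp
  qed
  have "(\<Sum>i<d. v i * row_norm n d U R i) = (\<Sum>i<d. \<Sum>j<d. \<bar>gram n V i j\<bar> * (t i * t j))"
  proof (intro sum.cong refl)
    fix i assume "i \<in> {..<d}"
    then have i: "i < d" by simp
    have "row_norm n d U R i = (\<Sum>j<d. \<bar>gram n V i j\<bar> * (t j / t i))"
      unfolding row_norm_def
    proof (intro sum.cong refl)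
      fix j assume "j \<in> {..<d}"
      then show "\<bar>\<Sum>k<n. U i k * R k j\<bar> = \<bar>gram n V i j\<bar> * (t j / t i)"
        using UR[OF i] t[OF i] t[of j] by (simp add: abs_mult)
    qed
    then show "v i * row_norm n d U R i = (\<Sum>j<d. \<bar>gram n V i j\<bar> * (t i * t j))"
      using t[OF i] tt[OF i, symmetric] by (simp add: sum_distrib_left mult_ac)
  qed
  with v\<rho>[OF R] have ge: "c + \<epsilon> / 2 \<le> (\<Sum>i<d. \<Sum>j<d. \<bar>gram n V i j\<bar> * (t i * t j))" by simp
  have "(\<Sum>i<d. (t i)\<^sup>2) = 1" using v1 tt by (simp add: power2_eq_square)
  moreover have "\<And>i. i \<in> {..<d} \<Longrightarrow> t i \<noteq> 0" using t by force
  ultimately obtain r where "r \<in> positive_row_sums n"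
    "(\<Sum>i<d. \<Sum>j<d. \<bar>gram n V i j\<bar> * (t i * t j)) - \<epsilon> / 4 \<le> r"
    using weighted_gram_le_row_sum[of "{..<d}" n V t "\<epsilon> / 4"] n V \<epsilon> by auto
  then show False using c[of r] ge \<epsilon> by simp
qed

text \<open>Restriction to the first \<open>d\<close> coordinates distorts the norm of \<open>E\<close> by at most \<open>1 + \<epsilon>\<close>. So a
projection onto the restricted space lifts to one onto \<open>E\<close>, at the price of this factor.\<close>

lemma near_optimal_projection:
  fixes E :: "l_infty set"
  assumes n: "1 \<le> n" and E: "fin_dim n E"
    and c: "\<And>r. r \<in> positive_row_sums n \<Longrightarrow> r \<le> c" "0 \<le> c" and \<epsilon>: "0 < \<epsilon>"
  shows "\<exists>Q. is_projection_onto E Q \<and> onorm Q \<le> (1 + \<epsilon>) * (c + \<epsilon>)"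
proof -
  have sE: "subspace E" using E by (rule fin_dim_subspace)
  obtain d where d: "\<And>x. x \<in> E \<Longrightarrow> norm x \<le> (1 + \<epsilon>) * norm (fseq d (apply_bcontfun x))"
    using norm_finitely_many_coords[OF E \<epsilon>] by blast
  let ?\<tau> = "\<lambda>x::l_infty. fseq d (apply_bcontfun x)"
  interpret \<tau>: linear ?\<tau> by (rule linear_fseq)
  have inj: "x = y" if "x \<in> E" "y \<in> E" "?\<tau> x = ?\<tau> y" for x y
  proof -
    have "x - y \<in> E" using that sE subspace_diff by blast
    then have "norm (x - y) \<le> (1 + \<epsilon>) * norm (?\<tau> (x - y))" by (rule d)
    also have "?\<tau> (x - y) = 0" using \<tau>.diff[of x y] that(3) by simp
    finally show ?thesis by simp
  qed
  have F: "fin_dim n (?\<tau> ` E)"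
    using E linear_fseq by (rule fin_dim_linear_image) (use inj in \<open>auto simp: inj_on_def\<close>)
  have supp: "apply_bcontfun x i = 0" if "x \<in> ?\<tau> ` E" "d \<le> i" for x i using that by auto
  obtain U where U: "orthonormal {..<d} n U"
    and UE: "?\<tau> ` E = {fseq d (\<lambda>i. \<Sum>k<n. a k * U i k) | a. True}"
    by (rule gram_schmidt_fin_dim[OF F supp])
  obtain R where R: "left_inverse n d R U" and Rc: "\<And>i. i < d \<Longrightarrow> row_norm n d U R i \<le> c + \<epsilon>"
    using near_optimal_left_inverse[OF n U c(1) \<epsilon>] by blast
  have "\<forall>k. \<exists>e. k < n \<longrightarrow> e \<in> E \<and> ?\<tau> e = fseq d (\<lambda>i. U i k)"
  proof
    fix k
    show "\<exists>e. k < n \<longrightarrow> e \<in> E \<and> ?\<tau> e = fseq d (\<lambda>i. U i k)"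
    proof (cases "k < n")
      case True
      have "fseq d (\<lambda>i. U i k) \<in> ?\<tau> ` E" unfolding UE by (rule column_in_span[OF True])
      then obtain e where "e \<in> E" "fseq d (\<lambda>i. U i k) = ?\<tau> e" by (rule imageE)
      then show ?thesis by (intro exI[of _ e]) simp
    qed simp
  qed
  from choice[OF this] obtain e where "\<forall>k. k < n \<longrightarrow> e k \<in> E \<and> ?\<tau> (e k) = fseq d (\<lambda>i. U i k)" by (rule exE)
  then have eE: "e k \<in> E" and \<tau>e: "?\<tau> (e k) = fseq d (\<lambda>i. U i k)" if "k < n" for k
    using that by blast+
  \<comment> \<open>restrict to d coordinates, project there, and lift the result\<close>
  define Q where "Q y = (\<Sum>k<n. (\<Sum>j<d. R k j * apply_bcontfun y j) *\<^sub>R e k)" for y :: l_infty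
  have QE: "Q y \<in> E" for y
    unfolding Q_def using eE sE by (intro subspace_sum subspace_scale) auto
  have \<tau>Q: "?\<tau> (Q y) = fseq d (\<lambda>i. \<Sum>j<d. (\<Sum>k<n. U i k * R k j) * apply_bcontfun y j)" for y
  proof -
    have "?\<tau> (Q y) = (\<Sum>k<n. (\<Sum>j<d. R k j * apply_bcontfun y j) *\<^sub>R fseq d (\<lambda>i. U i k))"
      unfolding Q_def \<tau>.sum \<tau>.scaleR using \<tau>e by (intro sum.cong refl) simp
    also have "\<dots> = fseq d (\<lambda>i. \<Sum>k<n. (\<Sum>j<d. R k j * apply_bcontfun y j) * U i k)"
      by (rule bcontfun_eqI) simp
    also have "(\<lambda>i. \<Sum>k<n. (\<Sum>j<d. R k j * apply_bcontfun y j) * U i k)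
        = (\<lambda>i. \<Sum>j<d. (\<Sum>k<n. U i k * R k j) * apply_bcontfun y j)"
      unfolding sum_distrib_right by (subst sum.swap) (simp add: mult_ac)
    finally show ?thesis .
  qed
  have Qnorm: "norm (Q y) \<le> (1 + \<epsilon>) * (c + \<epsilon>) * norm y" for y
  proof -
    have "norm (?\<tau> (Q y)) \<le> (c + \<epsilon>) * norm y"
      unfolding \<tau>Q
    proof (rule norm_fseq_le)
      show "0 \<le> (c + \<epsilon>) * norm y" using c \<epsilon> by simp
      fix i assume i: "i < d"
      have "\<bar>\<Sum>j<d. (\<Sum>k<n. U i k * R k j) * apply_bcontfun y j\<bar> \<le> (\<Sum>j<d. \<bar>\<Sum>k<n. U i k * R k j\<bar> * norm y)"
        by (intro order.trans[OF sum_abs] sum_mono) (simp add: abs_mult mult_left_mono coord_le_norm)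
      also have "\<dots> = row_norm n d U R i * norm y" by (simp add: row_norm_def sum_distrib_right)
      also have "\<dots> \<le> (c + \<epsilon>) * norm y" using Rc[OF i] by (intro mult_right_mono) auto
      finally show "\<bar>\<Sum>j<d. (\<Sum>k<n. U i k * R k j) * apply_bcontfun y j\<bar> \<le> (c + \<epsilon>) * norm y" .
    qed
    then have "(1 + \<epsilon>) * norm (?\<tau> (Q y)) \<le> (1 + \<epsilon>) * ((c + \<epsilon>) * norm y)"
      using \<epsilon> by (intro mult_left_mono) auto
    then show ?thesis using d[OF QE[of y]] by (simp add: mult.assoc)
  qed
  have Qid: "Q x = x" if x: "x \<in> E" for x
  proof (rule inj[OF QE x])
    have "?\<tau> x \<in> ?\<tau> ` E" using x by (rule imageI)
    then obtain a where a: "?\<tau> x = fseq d (\<lambda>i. \<Sum>k<n. a k * U i k)" unfolding UE by blast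
    have xi: "apply_bcontfun x j = (\<Sum>k<n. a k * U j k)" if "j < d" for j
      using arg_cong[OF a, of "\<lambda>x. apply_bcontfun x j"] that by simp
    have Ra: "(\<Sum>j<d. R k j * apply_bcontfun x j) = a k" if k: "k < n" for k
    proof -
      have "(\<Sum>j<d. R k j * apply_bcontfun x j) = (\<Sum>l<n. a l * (\<Sum>j<d. R k j * U j l))"
        unfolding sum_distrib_left
        by (subst sum.swap, intro sum.cong refl) (simp add: xi sum_distrib_left mult_ac)
      also have "\<dots> = (\<Sum>l<n. if k = l then a l else 0)"
        using R k by (intro sum.cong refl) (auto simp: left_inverse_def)
      finally show ?thesis using k by simp
    qed
    have "?\<tau> (Q x) = (\<Sum>k<n. (\<Sum>j<d. R k j * apply_bcontfun x j) *\<^sub>R fseq d (\<lambda>i. U i k))"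
      unfolding Q_def \<tau>.sum \<tau>.scaleR using \<tau>e by (intro sum.cong refl) simp
    also have "\<dots> = fseq d (\<lambda>i. \<Sum>k<n. a k * U i k)"
      using Ra by (intro bcontfun_eqI) simp
    finally show "?\<tau> (Q x) = ?\<tau> x" using a by simp
  qed
  have lin: "bounded_linear Q"
  proof (rule bounded_linear_intro[where K = "(1 + \<epsilon>) * (c + \<epsilon>)"])
    show "Q (x + y) = Q x + Q y" for x y
      by (simp add: Q_def algebra_simps sum.distrib)
    show "Q (r *\<^sub>R x) = r *\<^sub>R Q x" for r x
      by (simp add: Q_def scaleR_sum_right sum_distrib_left mult_ac)
    show "norm (Q x) \<le> norm x * ((1 + \<epsilon>) * (c + \<epsilon>))" for x
      using Qnorm[of x] by (simp add: mult.commute)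
  qed
  have "range Q = E"
  proof (intro subset_antisym subsetI)
    fix x assume "x \<in> range Q" then show "x \<in> E" using QE by auto
  next
    fix x assume "x \<in> E" then show "x \<in> range Q" using Qid[of x] by (intro image_eqI[of _ _ x]) auto
  qed
  then have "is_projection_onto E Q"
    unfolding is_projection_onto_def using lin Qid QE by auto
  moreover have "onorm Q \<le> (1 + \<epsilon>) * (c + \<epsilon>)"
    using c \<epsilon> Qnorm by (intro onorm_bound) auto
  ultimately show ?thesis by blast
qed

text \<open>The operators into \<open>E\<close> with bounded norm form a compact set for pointwise convergence, because
balls of \<open>E\<close> are compact, and the projections of norm at most \<open>c + \<epsilon>\<close> are closed in it.\<close>

lemma projection_limit:
  fixes E :: "l_infty set"
  assumes E: "fin_dim n E" and c: "0 \<le> c"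
    and approx: "\<And>\<epsilon>. 0 < \<epsilon> \<Longrightarrow> \<exists>Q. is_projection_onto E Q \<and> onorm Q \<le> c + \<epsilon>"
  shows "\<exists>Q. is_projection_onto E Q \<and> onorm Q \<le> c"
proof -
  let ?A = "{Q :: l_infty \<Rightarrow> l_infty. \<forall>x. Q x \<in> E \<inter> {y. norm y \<le> (c + 1) * norm x}}"
  let ?L = "{Q :: l_infty \<Rightarrow> l_infty. (\<forall>x y. Q (x + y) = Q x + Q y) \<and> (\<forall>r x. Q (r *\<^sub>R x) = r *\<^sub>R Q x)
    \<and> (\<forall>x. x \<in> E \<longrightarrow> Q x = x)}"
  let ?B = "\<lambda>\<epsilon>. {Q :: l_infty \<Rightarrow> l_infty. \<forall>x. norm (Q x) \<le> (c + \<epsilon>) * norm x}"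
  have A: "compact ?A"
    by (rule compact_coordinatewise) (rule compact_fin_dim_ball[OF E])
  have L: "closed ?L"
    by (intro closed_Collect_conj closed_Collect_all closed_Collect_imp open_Collect_const
        closed_Collect_eq continuous_intros)
  have B: "closed (?B \<epsilon>)" for \<epsilon>
    by (intro closed_Collect_all closed_Collect_le continuous_intros)
  have "?A \<inter> (\<Inter>\<epsilon>\<in>{0<..}. ?L \<inter> ?B \<epsilon>) \<noteq> {}"
  proof (rule compact_imp_fip_image[OF A])
    show "closed (?L \<inter> ?B \<epsilon>)" for \<epsilon> using L B by (rule closed_Int)
    fix I' :: "real set" assume I': "finite I'" "I' \<subseteq> {0<..}"
    define \<epsilon> where "\<epsilon> = Min (insert 1 I')"
    have \<epsilon>: "0 < \<epsilon>" "\<epsilon> \<le> 1" "\<And>e. e \<in> I' \<Longrightarrow> \<epsilon> \<le> e"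
      using I' by (auto simp: \<epsilon>_def)
    obtain Q where Q: "is_projection_onto E Q" "onorm Q \<le> c + \<epsilon>" using approx[OF \<epsilon>(1)] by blast
    then have lin: "bounded_linear Q" and rg: "range Q = E" and idem: "\<And>x. Q (Q x) = Q x"
      unfolding is_projection_onto_def by auto
    interpret Q: bounded_linear Q by (rule lin)
    have nQ: "norm (Q x) \<le> (c + e) * norm x" if "\<epsilon> \<le> e" for x e
    proof -
      have "norm (Q x) \<le> onorm Q * norm x" by (rule onorm[OF lin])
      also have "\<dots> \<le> (c + e) * norm x" using Q(2) that by (intro mult_right_mono) auto
      finally show ?thesis .
    qed
    have "Q \<in> ?A" using nQ[OF \<epsilon>(2)] rg by auto
    moreover have "Q \<in> ?L" using Q.add Q.scaleR idem rg by auto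
    moreover have "Q \<in> ?B e" if "e \<in> I'" for e using nQ \<epsilon>(3)[OF that] by simp
    ultimately show "?A \<inter> (\<Inter>\<epsilon>\<in>I'. ?L \<inter> ?B \<epsilon>) \<noteq> {}" by blast
  qed
  then obtain Q where "Q \<in> ?A \<inter> (\<Inter>\<epsilon>\<in>{0<..}. ?L \<inter> ?B \<epsilon>)" by (meson ex_in_conv)
  then have QA: "Q \<in> ?A" and QLB: "\<And>\<epsilon>. 0 < \<epsilon> \<Longrightarrow> Q \<in> ?L \<and> Q \<in> ?B \<epsilon>" by auto
  have QE: "Q x \<in> E" for x using QA by simp
  have QL: "Q (x + y) = Q x + Q y" "Q (r *\<^sub>R x) = r *\<^sub>R Q x" "z \<in> E \<Longrightarrow> Q z = z" for x y r z
    using QLB[of 1] by simp_all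
  have nQ: "norm (Q x) \<le> c * norm x" for x
  proof (rule field_le_epsilon)
    fix e :: real assume e: "0 < e"
    then have "0 < e / (norm x + 1)" by (simp add: add_nonneg_pos)
    then have "Q \<in> ?B (e / (norm x + 1))" using QLB by blast
    then have "norm (Q x) \<le> (c + e / (norm x + 1)) * norm x" by simp
    also have "\<dots> = c * norm x + e * (norm x / (norm x + 1))" by (simp add: algebra_simps)
    also have "\<dots> \<le> c * norm x + e * 1"
    proof -
      have "0 < norm x + 1" by (simp add: add_nonneg_pos)
      then have "norm x / (norm x + 1) \<le> 1" by (simp add: divide_le_eq)
      then show ?thesis using e by (intro add_left_mono mult_left_mono) auto
    qed
    finally show "norm (Q x) \<le> c * norm x + e" by simp
  qed
  have lin: "bounded_linear Q"
    using QL(1,2) nQ by (intro bounded_linear_intro[where K = c]) (auto simp: mult.commute)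
  have "range Q = E"
  proof (intro subset_antisym subsetI)
    fix x assume "x \<in> range Q" then show "x \<in> E" using QE by auto
  next
    fix x assume "x \<in> E" then show "x \<in> range Q" using QL(3)[of x] by (intro image_eqI[of _ _ x]) auto
  qed
  then have "is_projection_onto E Q" unfolding is_projection_onto_def using lin QL(3) QE by auto
  moreover have "onorm Q \<le> c" using c nQ by (rule onorm_bound)
  ultimately show ?thesis by blast
qed

lemma rel_proj_const_attained:
  fixes E :: "l_infty set"
  assumes E: "fin_dim n E" and ex: "\<exists>Q. is_projection_onto E Q"
  obtains Q where "is_projection_onto E Q" "rel_proj_const E = onorm Q"
    "\<forall>Q'. is_projection_onto E Q' \<longrightarrow> onorm Q \<le> onorm Q'"
proof -
  let ?S = "{onorm Q | Q. is_projection_onto E Q}"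
  have nonneg: "0 \<le> onorm Q" if "is_projection_onto E Q" for Q
    using that onorm_pos_le unfolding is_projection_onto_def by blast
  then have bdd: "bdd_below ?S" by (intro bdd_belowI[of _ 0]) auto
  have ne: "?S \<noteq> {}" using ex by blast
  have c0: "0 \<le> Inf ?S" using ne nonneg by (intro cInf_greatest) auto
  have "\<exists>Q. is_projection_onto E Q \<and> onorm Q \<le> Inf ?S + \<epsilon>" if "0 < \<epsilon>" for \<epsilon>
  proof -
    have "Inf ?S < Inf ?S + \<epsilon>" using that by simp
    then obtain s where s: "s \<in> ?S" "s < Inf ?S + \<epsilon>" using cInf_lessD[OF ne] by blast
    then obtain Q where "s = onorm Q" "is_projection_onto E Q" by blast
    then show ?thesis using s(2) by (intro exI[of _ Q]) simp
  qed
  from projection_limit[OF E c0 this] obtain Q where Q: "is_projection_onto E Q" "onorm Q \<le> Inf ?S" by blast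
  have min: "onorm Q \<le> onorm Q'" if "is_projection_onto E Q'" for Q'
  proof -
    have "Inf ?S \<le> onorm Q'" using that by (intro cInf_lower bdd) blast
    then show ?thesis using Q(2) by simp
  qed
  have "rel_proj_const E = onorm Q"
    unfolding rel_proj_const_def using Q(1) min by (intro Least_equality) auto
  then show thesis using that Q(1) min by blast
qed

lemma rel_proj_const_le:
  fixes E :: "l_infty set"
  assumes n: "1 \<le> n" and E: "fin_dim n E"
    and c: "\<And>r. r \<in> positive_row_sums n \<Longrightarrow> r \<le> c" "0 \<le> c"
  shows "rel_proj_const E \<le> c" "\<exists>Q. is_projection_onto E Q"
proof -
  have "\<exists>Q. is_projection_onto E Q \<and> onorm Q \<le> c + \<epsilon>" if \<epsilon>: "0 < \<epsilon>" for \<epsilon>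
  proof -
    define s where "s = min 1 (\<epsilon> / (c + 2))"
    have s: "0 < s" "s \<le> 1" "s * (c + 2) \<le> \<epsilon>"
    proof -
      show "0 < s" "s \<le> 1" using \<epsilon> c by (auto simp: s_def)
      have "s \<le> \<epsilon> / (c + 2)" by (simp add: s_def)
      then show "s * (c + 2) \<le> \<epsilon>" using c by (simp add: le_divide_eq)
    qed
    obtain Q where Q: "is_projection_onto E Q" "onorm Q \<le> (1 + s) * (c + s)"
      using near_optimal_projection[OF n E c s(1)] by blast
    have "(1 + s) * (c + s) = c + s * (c + 1 + s)" by (simp add: algebra_simps)
    also have "\<dots> \<le> c + s * (c + 2)" using s by (intro add_left_mono mult_left_mono) auto
    also have "\<dots> \<le> c + \<epsilon>" using s by simp
    finally show ?thesis using Q by (intro exI[of _ Q]) simp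
  qed
  from projection_limit[OF E c(2) this] obtain Q where Q: "is_projection_onto E Q" "onorm Q \<le> c" by blast
  then show ex: "\<exists>Q. is_projection_onto E Q" by blast
  show "rel_proj_const E \<le> c"
    by (rule rel_proj_const_attained[OF E ex]) (use Q in force)
qed

section \<open>Isometric embeddings\<close>

lemma linear_on_sum:
  fixes n :: nat
  assumes W: "subspace W" and f: "linear_on W f" and x: "\<And>k. k < n \<Longrightarrow> x k \<in> W"
  shows "f (\<Sum>k<n. a k *\<^sub>R x k) = (\<Sum>k<n. a k * f (x k))"
  using x
proof (induction n)
  case 0
  have "f (0 *\<^sub>R 0) = 0 * f 0" using f subspace_0[OF W] unfolding linear_on_def by blast
  then show ?case by simp
next
  case (Suc n)
  have "(\<Sum>k<n. a k *\<^sub>R x k) \<in> W" "a n *\<^sub>R x n \<in> W"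
    using Suc.prems W by (auto intro!: subspace_sum subspace_scale)
  then have "f ((\<Sum>k<n. a k *\<^sub>R x k) + a n *\<^sub>R x n) = f (\<Sum>k<n. a k *\<^sub>R x k) + f (a n *\<^sub>R x n)"
    using f unfolding linear_on_def by blast
  moreover have "f (a n *\<^sub>R x n) = a n * f (x n)"
    using f Suc.prems[of n] unfolding linear_on_def by blast
  ultimately show ?case using Suc by simp
qed

lemma is_normD:
  assumes "is_norm n N" "x \<in> carrier_vec n"
  shows "0 \<le> N x" "N x = 0 \<longleftrightarrow> x = 0\<^sub>v n" "N (a \<cdot>\<^sub>v x) = \<bar>a\<bar> * N x"
    "y \<in> carrier_vec n \<Longrightarrow> N (x + y) \<le> N x + N y"
  using assms unfolding is_norm_def by blast+

lemma is_isometric_embeddingD: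
  assumes "is_isometric_embedding n N T" "x \<in> carrier_vec n"
  shows "T (a \<cdot>\<^sub>v x) = a *\<^sub>R T x" "norm (T x) = N x" "y \<in> carrier_vec n \<Longrightarrow> T (x + y) = T x + T y"
  using assms unfolding is_isometric_embedding_def by blast+

text \<open>An embedding is additive and homogeneous on \<open>carrier_vec n\<close> only, so the expansion in unit vectors
is obtained by adding one coordinate at a time.\<close>

lemma embedding_expansion:
  assumes T: "is_isometric_embedding n N T" and x: "x \<in> carrier_vec n"
  shows "T x = (\<Sum>k<n. (x $ k) *\<^sub>R T (unit_vec n k))"
proof -
  let ?x = "\<lambda>m. vec n (\<lambda>i. if i < m then x $ i else 0)"
  have step: "m \<le> n \<Longrightarrow> T (?x m) = (\<Sum>k<m. (x $ k) *\<^sub>R T (unit_vec n k))" for m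
  proof (induction m)
    case 0
    have "T (0 \<cdot>\<^sub>v 0\<^sub>v n) = 0 *\<^sub>R T (0\<^sub>v n)" by (rule is_isometric_embeddingD(1)[OF T zero_carrier_vec])
    moreover have "0 \<cdot>\<^sub>v 0\<^sub>v n = ?x 0" by (intro eq_vecI) auto
    ultimately show ?case by simp
  next
    case (Suc m)
    have "?x (Suc m) = ?x m + (x $ m) \<cdot>\<^sub>v unit_vec n m"
      using Suc.prems by (intro eq_vecI) (auto simp: less_Suc_eq)
    then have "T (?x (Suc m)) = T (?x m) + T ((x $ m) \<cdot>\<^sub>v unit_vec n m)"
      using is_isometric_embeddingD(3)[OF T] by simp
    also have "\<dots> = (\<Sum>k<Suc m. (x $ k) *\<^sub>R T (unit_vec n k))"
      using Suc is_isometric_embeddingD(1)[OF T] by simp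
    finally show ?case .
  qed
  have full: "?x n = x" using x by (intro eq_vecI) auto
  show ?thesis using step[of n] unfolding full by simp
qed

lemma embedding_range_fin_dim:
  assumes N: "is_norm n N" and T: "is_isometric_embedding n N T"
  shows "fin_dim n (T ` carrier_vec n)"
proof -
  let ?b = "\<lambda>k. T (unit_vec n k)"
  have comb: "(\<Sum>k<n. a k *\<^sub>R ?b k) = T (vec n a)" for a
    unfolding embedding_expansion[OF T vec_carrier] by (intro sum.cong) auto
  have "fin_dim n {\<Sum>k<n. a k *\<^sub>R ?b k | a. True}"
  proof (rule fin_dim_combinations)
    fix a assume a: "(\<Sum>k<n. a k *\<^sub>R ?b k) = 0"
    then have "N (vec n a) = 0"
      unfolding comb using is_isometric_embeddingD(2)[OF T vec_carrier[of n a]] by simp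
    then have "vec n a = 0\<^sub>v n" using is_normD(2)[OF N vec_carrier] by blast
    then show "\<forall>k<n. a k = 0" by (metis index_vec index_zero_vec(1))
  qed
  moreover have "{\<Sum>k<n. a k *\<^sub>R ?b k | a. True} = T ` carrier_vec n"
  proof (intro subset_antisym subsetI)
    fix y assume "y \<in> {\<Sum>k<n. a k *\<^sub>R ?b k | a. True}"
    then show "y \<in> T ` carrier_vec n" unfolding comb by auto
  next
    fix y assume "y \<in> T ` carrier_vec n"
    then obtain x where "x \<in> carrier_vec n" "y = T x" by blast
    then show "y \<in> {\<Sum>k<n. a k *\<^sub>R ?b k | a. True}"
      using embedding_expansion[OF T, of x] by auto
  qed
  ultimately show ?thesis by simp
qed

lemma is_norm_le_sum:
  assumes N: "is_norm n N" and x: "x \<in> carrier_vec n"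
  shows "N x \<le> (\<Sum>k<n. \<bar>x $ k\<bar> * N (unit_vec n k))"
proof -
  let ?x = "\<lambda>m. vec n (\<lambda>i. if i < m then x $ i else 0)"
  have step: "m \<le> n \<Longrightarrow> N (?x m) \<le> (\<Sum>k<m. \<bar>x $ k\<bar> * N (unit_vec n k))" for m
  proof (induction m)
    case 0
    have "?x 0 = 0\<^sub>v n" by (intro eq_vecI) auto
    then show ?case using is_normD(2)[OF N, of "0\<^sub>v n"] by simp
  next
    case (Suc m)
    have "?x (Suc m) = ?x m + (x $ m) \<cdot>\<^sub>v unit_vec n m"
      using Suc.prems by (intro eq_vecI) (auto simp: less_Suc_eq)
    then have "N (?x (Suc m)) \<le> N (?x m) + N ((x $ m) \<cdot>\<^sub>v unit_vec n m)"
      using is_normD(4)[OF N] by simp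
    also have "\<dots> \<le> (\<Sum>k<Suc m. \<bar>x $ k\<bar> * N (unit_vec n k))"
      using Suc is_normD(3)[OF N] by simp
    finally show ?case .
  qed
  have full: "?x n = x" using x by (intro eq_vecI) auto
  show ?thesis using step[of n] unfolding full by simp
qed

lemma rational_vectors_dense:
  assumes N: "is_norm n N"
  obtains q :: "nat \<Rightarrow> real vec" where "\<And>m. q m \<in> carrier_vec n"
    "\<And>x e. x \<in> carrier_vec n \<Longrightarrow> 0 < e \<Longrightarrow> \<exists>m. N (x - q m) \<le> e"
proof -
  \<comment> \<open>lists of rationals are countable; a list that is too short gives unspecified entries, which do no harm\<close>
  define q where "q m = vec n (\<lambda>i. real_of_rat ((from_nat m :: rat list) ! i))" for m
  define S where "S = (\<Sum>k<n. N (unit_vec n k))"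
  have S: "0 \<le> S" unfolding S_def using is_normD(1)[OF N] by (intro sum_nonneg) auto
  have "\<exists>m. N (x - q m) \<le> e" if x: "x \<in> carrier_vec n" and e: "0 < e" for x e
  proof -
    define h where "h = e / (S + 1)"
    have h: "0 < h" "h * S \<le> e"
    proof -
      show "0 < h" using S e by (simp add: h_def)
      have "e * S \<le> e * (S + 1)" using e by (intro mult_left_mono) auto
      then show "h * S \<le> e" using S by (simp add: h_def divide_le_eq)
    qed
    have "\<exists>r. \<bar>x $ i - real_of_rat r\<bar> < h" for i
    proof -
      obtain r where "x $ i - h < real_of_rat r" "real_of_rat r < x $ i + h"
        using of_rat_dense[of "x $ i - h" "x $ i + h"] h(1) by auto
      then show ?thesis by (intro exI[of _ r]) auto
    qed
    then obtain r where r: "\<And>i. \<bar>x $ i - real_of_rat (r i)\<bar> < h" by metis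
    let ?m = "to_nat (map r [0..<n])"
    have qm: "q ?m $ i = real_of_rat (r i)" if "i < n" for i using that by (simp add: q_def)
    have "N (x - q ?m) \<le> (\<Sum>k<n. \<bar>(x - q ?m) $ k\<bar> * N (unit_vec n k))"
      using x by (intro is_norm_le_sum[OF N]) (auto simp: q_def)
    also have "\<dots> \<le> (\<Sum>k<n. h * N (unit_vec n k))"
    proof (intro sum_mono mult_right_mono)
      fix k assume "k \<in> {..<n}"
      then show "\<bar>(x - q ?m) $ k\<bar> \<le> h"
        using x r[of k] qm[of k] less_imp_le by (simp add: q_def)
      show "0 \<le> N (unit_vec n k)" using is_normD(1)[OF N] by simp
    qed
    also have "\<dots> \<le> e" using h by (simp add: S_def sum_distrib_left)
    finally show ?thesis by blast
  qed
  moreover have "q m \<in> carrier_vec n" for m by (simp add: q_def)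
  ultimately show thesis using that by blast
qed

text \<open>Hahn-Banach for an arbitrary norm on \<open>\<real>\<^sup>n\<close>. The norm is carried to the seminorm \<open>p\<close> on
bounded sequences that looks at the first \<open>n\<close> entries only.\<close>

lemma norming_functional:
  assumes N: "is_norm n N" and z: "z \<in> carrier_vec n"
  shows "\<exists>f. (\<forall>x\<in>carrier_vec n. \<forall>y\<in>carrier_vec n. f (x + y) = f x + f y) \<and>
    (\<forall>x\<in>carrier_vec n. \<forall>a. f (a \<cdot>\<^sub>v x) = a * f x) \<and> (\<forall>x\<in>carrier_vec n. \<bar>f x\<bar> \<le> N x) \<and> f z = N z"
proof -
  \<comment> \<open>coordinate vectors are modelled by sequences supported on the first n positions\<close>
  let ?v = "\<lambda>x::l_infty. vec n (apply_bcontfun x)"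
  let ?s = "\<lambda>x::real vec. fseq n (\<lambda>i. x $ i)"
  define p where "p x = N (?v x)" for x
  have p: "p (x + y) \<le> p x + p y" "p (c *\<^sub>R x) = \<bar>c\<bar> * p x" for x y c
  proof -
    have "?v (x + y) = ?v x + ?v y" "?v (c *\<^sub>R x) = c \<cdot>\<^sub>v ?v x" by (auto intro!: eq_vecI)
    then show "p (x + y) \<le> p x + p y" "p (c *\<^sub>R x) = \<bar>c\<bar> * p x"
      unfolding p_def using is_normD[OF N, of "?v x"] by auto
  qed
  have vs: "?v (?s x) = x" if "x \<in> carrier_vec n" for x
    using that by (intro eq_vecI) auto
  have pz: "p (?s x) = N x" if "x \<in> carrier_vec n" for x
    using vs[OF that] by (simp add: p_def)
  define V where "V = {c *\<^sub>R ?s z | c. True}"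
  have "\<exists>f. linear_on V f \<and> (\<forall>x\<in>V. f x \<le> p x) \<and> f (?s z) = N z"
  proof (cases "?s z = 0")
    case True
    then have "N z = 0" using pz[OF z] p(2)[of 0 0] by simp
    moreover have "V = {0}" unfolding V_def using True by auto
    ultimately show ?thesis
      using p(2)[of 0 0] by (intro exI[of _ "\<lambda>_. 0"]) (auto simp: linear_on_def)
  next
    case False
    define f where "f x = (THE c. x = c *\<^sub>R ?s z) * N z" for x
    have f: "f (c *\<^sub>R ?s z) = c * N z" for c
      unfolding f_def using False by (subst the_equality[of _ c]) auto
    have "linear_on V f"
      unfolding linear_on_def
    proof (intro conjI ballI allI)
      fix x y assume "x \<in> V" "y \<in> V"
      then obtain c c' where *: "x = c *\<^sub>R ?s z" "y = c' *\<^sub>R ?s z" unfolding V_def by blast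
      have "f ((c + c') *\<^sub>R ?s z) = (c + c') * N z" by (rule f)
      then show "f (x + y) = f x + f y" unfolding * scaleR_add_left f by (simp add: distrib_right)
    next
      fix x r assume "x \<in> V"
      then obtain c where *: "x = c *\<^sub>R ?s z" unfolding V_def by blast
      show "f (r *\<^sub>R x) = r * f x" unfolding * scaleR_scaleR f by simp
    qed
    moreover have "f x \<le> p x" if xV: "x \<in> V" for x
    proof -
      obtain c where *: "x = c *\<^sub>R ?s z" using xV unfolding V_def by blast
      show ?thesis unfolding * f p(2) pz[OF z]
        using is_normD(1)[OF N z] by (intro mult_right_mono) auto
    qed
    moreover have "f (?s z) = N z" using f[of 1] by simp
    ultimately show ?thesis by blast
  qed
  then obtain f where f: "linear_on V f" "\<And>x. x \<in> V \<Longrightarrow> f x \<le> p x" "f (?s z) = N z" by blast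
  have "V = span {?s z}" unfolding V_def span_singleton by auto
  then have sV: "subspace V" using subspace_span[of "{?s z}"] by (rule ssubst)
  obtain S where S: "finite S" "span S = {fseq n f | f. True}"
    using fin_dim_fseq[of n] unfolding fin_dim_def by blast
  obtain g where g: "linear_on (span (S \<union> V)) g" and gf: "\<And>x. x \<in> V \<Longrightarrow> g x = f x"
    and gp: "\<And>x. x \<in> span (S \<union> V) \<Longrightarrow> \<bar>g x\<bar> \<le> p x"
    using hahn_banach_finite[OF p sV f(1,2) S(1)] by metis
  have W: "?s x \<in> span (S \<union> V)" for x
  proof -
    have "?s x \<in> span S" unfolding S(2) by blast
    then show ?thesis using span_mono[of S "S \<union> V"] by blast
  qed
  have s_add: "?s (x + y) = ?s x + ?s y" if "x \<in> carrier_vec n" "y \<in> carrier_vec n" for x y :: "real vec"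
    using that by (intro bcontfun_eqI) auto
  have s_scale: "?s (a \<cdot>\<^sub>v x) = a *\<^sub>R ?s x" if "x \<in> carrier_vec n" for a and x :: "real vec"
    using that by (intro bcontfun_eqI) auto
  have zV: "?s z \<in> V" unfolding V_def by (intro CollectI exI[of _ 1]) simp
  show ?thesis
  proof (intro exI[of _ "\<lambda>x. g (?s x)"] conjI ballI allI)
    fix x y :: "real vec" assume xy: "x \<in> carrier_vec n" "y \<in> carrier_vec n"
    have "g (?s x + ?s y) = g (?s x) + g (?s y)" using g W unfolding linear_on_def by blast
    then show "g (?s (x + y)) = g (?s x) + g (?s y)" unfolding s_add[OF xy] .
  next
    fix x :: "real vec" and a assume x: "x \<in> carrier_vec n"
    have "g (a *\<^sub>R ?s x) = a * g (?s x)" using g W unfolding linear_on_def by blast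
    then show "g (?s (a \<cdot>\<^sub>v x)) = a * g (?s x)" unfolding s_scale[OF x] .
  next
    fix x :: "real vec" assume "x \<in> carrier_vec n"
    then show "\<bar>g (?s x)\<bar> \<le> N x" using gp[OF W, of x] pz by simp
  next
    show "g (?s z) = N z" using gf[OF zV] f(3) by simp
  qed
qed

text \<open>Norming functionals at a countable dense set of vectors are the coordinates of the embedding.\<close>

lemma isometric_embedding_exists:
  assumes N: "is_norm n N"
  shows "\<exists>T. is_isometric_embedding n N T"
proof -
  obtain q :: "nat \<Rightarrow> real vec" where q: "\<And>m. q m \<in> carrier_vec n"
    and dense: "\<And>x e. x \<in> carrier_vec n \<Longrightarrow> 0 < e \<Longrightarrow> \<exists>m. N (x - q m) \<le> e"
    using rational_vectors_dense[OF N] by blast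
  have "\<forall>m. \<exists>f. (\<forall>x\<in>carrier_vec n. \<forall>y\<in>carrier_vec n. f (x + y) = f x + f y) \<and>
    (\<forall>x\<in>carrier_vec n. \<forall>a. f (a \<cdot>\<^sub>v x) = a * f x) \<and> (\<forall>x\<in>carrier_vec n. \<bar>f x\<bar> \<le> N x) \<and> f (q m) = N (q m)"
    using norming_functional[OF N q] by blast
  from choice[OF this] obtain f where f: "\<forall>m. (\<forall>x\<in>carrier_vec n. \<forall>y\<in>carrier_vec n. f m (x + y) = f m x + f m y) \<and>
    (\<forall>x\<in>carrier_vec n. \<forall>a. f m (a \<cdot>\<^sub>v x) = a * f m x) \<and> (\<forall>x\<in>carrier_vec n. \<bar>f m x\<bar> \<le> N x) \<and> f m (q m) = N (q m)"
    by (rule exE)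
  define T where "T x = Bcontfun (\<lambda>m. f m x)" for x
  have Ti: "apply_bcontfun (T x) m = f m x" if x: "x \<in> carrier_vec n" for x m
  proof -
    have "(\<lambda>m. f m x) \<in> bcontfun" using f x by (intro bcontfun_natI[of _ "N x"]) blast
    then show ?thesis unfolding T_def by (simp add: Bcontfun_inverse)
  qed
  have "norm (T x) = N x" if x: "x \<in> carrier_vec n" for x
  proof (rule antisym)
    show "norm (T x) \<le> N x" using f x Ti by (intro norm_leI) simp
    show "N x \<le> norm (T x)"
    proof (rule field_le_epsilon)
      fix e :: real assume "0 < e"
      then obtain m where m: "N (x - q m) \<le> e / 2" using dense[OF x, of "e / 2"] by auto
      have d: "x - q m \<in> carrier_vec n" using x q by simp
      have xq: "x = q m + (x - q m)" using x q[of m] by (intro eq_vecI) auto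
      have "N x \<le> N (q m) + N (x - q m)" using is_normD(4)[OF N q d, of m] xq by simp
      also have "N (q m) = f m x - f m (x - q m)"
      proof -
        have "f m (q m + (x - q m)) = f m (q m) + f m (x - q m)" using f q d by blast
        then show ?thesis using f xq by simp
      qed
      also have "\<dots> \<le> norm (T x) + N (x - q m)"
      proof -
        have "f m x \<le> norm (T x)" using coord_le_norm[of "T x" m] Ti[OF x, of m] by simp
        moreover have "\<bar>f m (x - q m)\<bar> \<le> N (x - q m)" using f d by blast
        ultimately show ?thesis by linarith
      qed
      finally show "N x \<le> norm (T x) + e" using m by simp
    qed
  qed
  moreover have "T (x + y) = T x + T y" if "x \<in> carrier_vec n" "y \<in> carrier_vec n" for x y
    using that f Ti by (intro bcontfun_eqI) simp
  moreover have "T (a \<cdot>\<^sub>v x) = a *\<^sub>R T x" if "x \<in> carrier_vec n" for a x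
    using that f Ti by (intro bcontfun_eqI) simp
  ultimately show ?thesis unfolding is_isometric_embedding_def by blast
qed

section \<open>Transfer of projections between nearby norms\<close>

text \<open>Let \<open>\<phi> x = \<Sum> x\<^sub>k b\<^sub>k\<close>, so that \<open>\<phi>\<close> identifies \<open>\<real>\<^sup>n\<close> with the range of \<open>U\<close> in
\<open>\<ell>\<^sub>\<infinity>\<^sup>d\<close> up to the factor \<open>K\<close>. Each coordinate of \<open>T \<phi>\<^sup>-\<^sup>1\<close> is a functional of norm at most
\<open>K\<close> on this range and extends to \<open>\<ell>\<^sub>\<infinity>\<^sup>d\<close> with the same bound. Together these extensions form a map
\<open>G\<close> into \<open>\<ell>\<^sub>\<infinity>\<close>, and \<open>\<phi> T\<^sup>-\<^sup>1 Q G\<close> is the projection sought.\<close>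

lemma projection_transfer:
  fixes b :: "nat \<Rightarrow> l_infty"
  assumes N: "is_norm n N" and T: "is_isometric_embedding n N T"
    and Q: "is_projection_onto (T ` carrier_vec n) Q"
    and U: "orthonormal {..<d} n U"
    and F: "{\<Sum>k<n. a k *\<^sub>R b k | a. True} = {fseq d (\<lambda>i. \<Sum>k<n. a k * U i k) | a. True}"
    and K: "0 \<le> K"
    and le1: "\<And>x. x \<in> carrier_vec n \<Longrightarrow> N x \<le> K * norm (\<Sum>k<n. (x $ k) *\<^sub>R b k)"
    and le2: "\<And>x. x \<in> carrier_vec n \<Longrightarrow> norm (\<Sum>k<n. (x $ k) *\<^sub>R b k) \<le> K * N x"
  shows "\<exists>R. left_inverse n d R U \<and> (\<forall>i<d. row_norm n d U R i \<le> K * (onorm Q * K))"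
proof -
  let ?C = "carrier_vec n :: real vec set"
  define \<phi> where "\<phi> x = (\<Sum>k<n. (x $ k) *\<^sub>R b k)" for x
  define F where "F = {fseq d (\<lambda>i. \<Sum>k<n. a k * U i k) | a. True}"
  have \<phi>_add: "\<phi> (x + y) = \<phi> x + \<phi> y" if "x \<in> ?C" "y \<in> ?C" for x y
    unfolding \<phi>_def sum.distrib[symmetric] scaleR_add_left[symmetric] using that by (intro sum.cong refl) simp
  have \<phi>_scale: "\<phi> (a \<cdot>\<^sub>v x) = a *\<^sub>R \<phi> x" if "x \<in> ?C" for a x
    unfolding \<phi>_def scaleR_sum_right using that by (intro sum.cong refl) simp
  have \<phi>F: "\<phi> x \<in> F" for x
    unfolding F_def assms(5)[symmetric] \<phi>_def by blast
  have F\<phi>: "\<exists>x\<in>?C. y = \<phi> x" if y: "y \<in> F" for y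
  proof -
    obtain a where "y = (\<Sum>k<n. a k *\<^sub>R b k)" using y unfolding F_def assms(5)[symmetric] by blast
    then have "y = \<phi> (vec n a)" unfolding \<phi>_def by simp
    then show ?thesis by (intro bexI[of _ "vec n a"]) auto
  qed
  have inj: "x = y" if xy: "x \<in> ?C" "y \<in> ?C" and eq: "\<phi> x = \<phi> y \<or> T x = T y" for x y
  proof -
    let ?z = "x + (- 1) \<cdot>\<^sub>v y"
    have z: "?z \<in> ?C" using xy by simp
    have "N ?z \<le> 0"
      using eq
    proof
      assume "\<phi> x = \<phi> y"
      then have "\<phi> ?z = 0" using \<phi>_add[of x "(- 1) \<cdot>\<^sub>v y"] \<phi>_scale xy by simp
      then show ?thesis using le1[OF z] by (simp add: \<phi>_def)
    next
      assume "T x = T y"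
      then have "T ?z = 0"
        using is_isometric_embeddingD(3)[OF T xy(1), of "(- 1) \<cdot>\<^sub>v y"] is_isometric_embeddingD(1)[OF T xy(2)] xy by simp
      then show ?thesis using is_isometric_embeddingD(2)[OF T z] by simp
    qed
    then have z0: "?z = 0\<^sub>v n" using is_normD(1,2)[OF N z] by simp
    have "x $ i = y $ i" if i: "i < n" for i
    proof -
      have "?z $ i = 0" unfolding z0 using i by simp
      moreover have "?z $ i = x $ i - y $ i" using i xy by simp
      ultimately show ?thesis by simp
    qed
    then show ?thesis using xy by (intro eq_vecI) auto
  qed
  have linQ: "bounded_linear Q" and rgQ: "range Q = T ` ?C" and idQ: "\<And>x. Q (Q x) = Q x"
    using Q unfolding is_projection_onto_def by auto
  interpret Q: bounded_linear Q by (rule linQ)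
  have nQ: "norm (Q y) \<le> onorm Q * norm y" for y by (rule onorm[OF linQ])
  \<comment> \<open>L sends T x to \<phi> x\<close>
  define L where "L y = \<phi> (SOME x. x \<in> ?C \<and> T x = y)" for y
  have LT: "L (T x) = \<phi> x" if x: "x \<in> ?C" for x
  proof -
    have "(SOME x'. x' \<in> ?C \<and> T x' = T x) = x"
      using x inj by (intro some_equality) auto
    then show ?thesis by (simp add: L_def)
  qed
  have QT: "\<exists>x\<in>?C. Q y = T x" for y using rgQ by blast
  have QTid: "Q (T x) = T x" if "x \<in> ?C" for x
  proof -
    have "T x \<in> range Q" using rgQ that by blast
    then obtain y where "T x = Q y" by (rule rangeE)
    then show ?thesis using idQ by simp
  qed
  have LQ_add: "L (Q (y + z)) = L (Q y) + L (Q z)" for y z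
  proof -
    obtain x x' where x: "x \<in> ?C" "Q y = T x" "x' \<in> ?C" "Q z = T x'" using QT by metis
    then have "Q (y + z) = T (x + x')" using Q.add is_isometric_embeddingD(3)[OF T] by simp
    moreover have "x + x' \<in> ?C" using x by simp
    ultimately show ?thesis using LT x \<phi>_add by simp
  qed
  have LQ_scale: "L (Q (r *\<^sub>R y)) = r *\<^sub>R L (Q y)" for r y
  proof -
    obtain x where x: "x \<in> ?C" "Q y = T x" using QT by metis
    then have "Q (r *\<^sub>R y) = T (r \<cdot>\<^sub>v x)" using Q.scaleR is_isometric_embeddingD(1)[OF T] by simp
    moreover have "r \<cdot>\<^sub>v x \<in> ?C" using x by simp
    ultimately show ?thesis using LT x \<phi>_scale by simp
  qed
  have LQ_norm: "norm (L (Q y)) \<le> K * (onorm Q * norm y)" for y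
  proof -
    obtain x where x: "x \<in> ?C" "Q y = T x" using QT by metis
    have "norm (L (Q y)) \<le> K * N x" using LT[OF x(1)] x le2[OF x(1)] by (simp add: \<phi>_def)
    also have "N x = norm (Q y)" using is_isometric_embeddingD(2)[OF T x(1)] x(2) by simp
    also have "K * norm (Q y) \<le> K * (onorm Q * norm y)" using K nQ by (intro mult_left_mono)
    finally show ?thesis .
  qed
  have LQF: "L (Q y) \<in> F" for y
  proof -
    obtain x where "x \<in> ?C" "Q y = T x" using QT by metis
    then show ?thesis using LT \<phi>F by simp
  qed
  \<comment> \<open>extend T, transported to F, to all of the d-dimensional sequences\<close>
  have "\<exists>\<psi>. \<forall>y\<in>F. \<psi> y \<in> ?C \<and> \<phi> (\<psi> y) = y"
    using F\<phi> by (intro exI[of _ "\<lambda>y. SOME x. x \<in> ?C \<and> \<phi> x = y"] ballI) (rule someI_ex, blast)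
  then obtain \<psi> where \<psi>C: "\<And>y. y \<in> F \<Longrightarrow> \<psi> y \<in> ?C" and \<phi>\<psi>: "\<And>y. y \<in> F \<Longrightarrow> \<phi> (\<psi> y) = y" by blast
  have sF: "subspace F" unfolding F_def by (rule fin_dim_subspace[OF orthonormal_span_fin_dim[OF U]])
  have T\<psi>_add: "T (\<psi> (x + y)) = T (\<psi> x) + T (\<psi> y)" if xy: "x \<in> F" "y \<in> F" for x y
  proof -
    have "\<psi> (x + y) = \<psi> x + \<psi> y"
      using xy \<psi>C \<phi>\<psi> \<phi>_add sF subspace_add[OF sF xy] by (intro inj disjI1) auto
    then show ?thesis using is_isometric_embeddingD(3)[OF T] \<psi>C xy by simp
  qed
  have T\<psi>_scale: "T (\<psi> (c *\<^sub>R x)) = c *\<^sub>R T (\<psi> x)" if x: "x \<in> F" for c x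
  proof -
    have "\<psi> (c *\<^sub>R x) = c \<cdot>\<^sub>v \<psi> x"
      using x \<psi>C \<phi>\<psi> \<phi>_scale subspace_scale[OF sF x, of c] by (intro inj disjI1) auto
    then show ?thesis using is_isometric_embeddingD(1)[OF T] \<psi>C x by simp
  qed
  have T\<psi>_norm: "norm (T (\<psi> y)) \<le> K * norm y" if y: "y \<in> F" for y
    using is_isometric_embeddingD(2)[OF T \<psi>C[OF y]] le1[OF \<psi>C[OF y]] \<phi>\<psi>[OF y] by (simp add: \<phi>_def)
  let ?e = "\<lambda>j. fseq d (\<lambda>i. if i = j then 1 else 0)"
  let ?W = "span (?e ` {..<d} \<union> F)"
  have p: "K * norm (x + y) \<le> K * norm x + K * norm y" "K * norm (c *\<^sub>R x) = \<bar>c\<bar> * (K * norm x)"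
    for x y :: l_infty and c
    using K norm_triangle_ineq[of x y] by (auto simp: distrib_left[symmetric] intro: mult_left_mono)
  have "\<forall>m. \<exists>g. linear_on ?W g \<and> (\<forall>y\<in>F. g y = apply_bcontfun (T (\<psi> y)) m) \<and> (\<forall>y\<in>?W. \<bar>g y\<bar> \<le> K * norm y)"
  proof
    fix m
    let ?f = "\<lambda>y. apply_bcontfun (T (\<psi> y)) m"
    have 1: "linear_on F ?f" unfolding linear_on_def using T\<psi>_add T\<psi>_scale by simp
    have 2: "?f y \<le> K * norm y" if "y \<in> F" for y
      using coord_le_norm[of "T (\<psi> y)" m] T\<psi>_norm[OF that] by linarith
    show "\<exists>g. linear_on ?W g \<and> (\<forall>y\<in>F. g y = ?f y) \<and> (\<forall>y\<in>?W. \<bar>g y\<bar> \<le> K * norm y)"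
      by (rule hahn_banach_finite[where p = "\<lambda>y. K * norm y" and S = "?e ` {..<d}", OF p sF 1 2]) blast+
  qed
  from choice[OF this] obtain g where g: "\<forall>m. linear_on ?W (g m) \<and>
    (\<forall>y\<in>F. g m y = apply_bcontfun (T (\<psi> y)) m) \<and> (\<forall>y\<in>?W. \<bar>g m y\<bar> \<le> K * norm y)" by (rule exE)
  define G where "G y = Bcontfun (\<lambda>m. g m y)" for y
  have Gi: "apply_bcontfun (G y) m = g m y" if y: "y \<in> ?W" for y m
  proof -
    have "(\<lambda>m. g m y) \<in> bcontfun" using g y by (intro bcontfun_natI[of _ "K * norm y"]) blast
    then show ?thesis unfolding G_def by (simp add: Bcontfun_inverse)
  qed
  have sW: "subspace ?W" by (rule subspace_span)
  have G_add: "G (x + y) = G x + G y" if "x \<in> ?W" "y \<in> ?W" for x y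
  proof (rule bcontfun_eqI)
    fix m
    have "g m (x + y) = g m x + g m y" using g that unfolding linear_on_def by blast
    then show "apply_bcontfun (G (x + y)) m = apply_bcontfun (G x + G y) m"
      using that subspace_add[OF sW that] by (simp add: Gi)
  qed
  have G_scale: "G (c *\<^sub>R x) = c *\<^sub>R G x" if "x \<in> ?W" for c x
  proof (rule bcontfun_eqI)
    fix m
    have "g m (c *\<^sub>R x) = c * g m x" using g that unfolding linear_on_def by blast
    then show "apply_bcontfun (G (c *\<^sub>R x)) m = apply_bcontfun (c *\<^sub>R G x) m"
      using that subspace_scale[OF sW that, of c] by (simp add: Gi)
  qed
  have G_norm: "norm (G y) \<le> K * norm y" if "y \<in> ?W" for y
    using g that by (intro norm_leI) (simp add: Gi)
  have FW: "y \<in> ?W" if "y \<in> F" for y using that by (intro span_base) blast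
  have GF: "G y = T (\<psi> y)" if "y \<in> F" for y
    using g that FW[OF that] by (intro bcontfun_eqI) (simp add: Gi)
  define M where "M y = L (Q (G y))" for y
  have MF: "M y \<in> F" for y unfolding M_def by (rule LQF)
  have Mid: "M y = y" if y: "y \<in> F" for y
    using QTid LT \<psi>C[OF y] \<phi>\<psi>[OF y] unfolding M_def GF[OF y] by simp
  have Mnorm: "norm (M y) \<le> K * (onorm Q * K) * norm y" if y: "y \<in> ?W" for y
  proof -
    have "norm (M y) \<le> K * (onorm Q * norm (G y))" unfolding M_def by (rule LQ_norm)
    also have "\<dots> \<le> K * (onorm Q * (K * norm y))"
      using K G_norm[OF y] onorm_pos_le[OF linQ] by (intro mult_left_mono) auto
    finally show ?thesis by (simp add: mult_ac)
  qed
  define h where "h i y = apply_bcontfun (M y) i" for i y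
  have h_lin: "linear_on ?W (h i)" for i
    unfolding linear_on_def h_def M_def using G_add G_scale LQ_add LQ_scale by simp
  have eW: "?e j \<in> ?W" if "j < d" for j using that by (intro span_base) blast
  have seq: "fseq d f = (\<Sum>j<d. f j *\<^sub>R ?e j)" for f
    by (rule bcontfun_eqI) (simp add: if_distrib[of "\<lambda>x. _ * x"] cong: if_cong)
  have seqW: "fseq d f \<in> ?W" for f
    unfolding seq[of f] using eW sW by (intro subspace_sum subspace_scale) auto
  have h_seq: "h i (fseq d f) = (\<Sum>j<d. f j * h i (?e j))" for i f
    unfolding seq[of f] by (rule linear_on_sum[OF sW h_lin eW])
  define R where "R k j = (\<Sum>i<d. U i k * h i (?e j))" for k j
  have orth: "(\<Sum>i<d. U i k * U i l) = (if k = l then 1 else 0)" if "k < n" "l < n" for k l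
    using U that by (auto simp: orthonormal_def)
  have "left_inverse n d R U"
    unfolding left_inverse_def
  proof (intro allI impI)
    fix k l assume kl: "k < n" "l < n"
    have "fseq d (\<lambda>i. U i l) \<in> F" unfolding F_def by (rule column_in_span[OF kl(2)])
    then have hU: "h i (fseq d (\<lambda>i. U i l)) = U i l" if "i < d" for i
      unfolding h_def Mid using that Mid by simp
    have "(\<Sum>j<d. R k j * U j l) = (\<Sum>i<d. U i k * (\<Sum>j<d. U j l * h i (?e j)))"
      unfolding R_def sum_distrib_left sum_distrib_right by (subst sum.swap) (simp add: mult_ac)
    also have "\<dots> = (\<Sum>i<d. U i k * U i l)"
      unfolding h_seq[symmetric] using hU by (intro sum.cong refl) simp
    finally show "(\<Sum>j<d. R k j * U j l) = (if k = l then 1 else 0)" using orth[OF kl] by simp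
  qed
  moreover have "row_norm n d U R i \<le> K * (onorm Q * K)" if i: "i < d" for i
  proof -
    have UR: "(\<Sum>k<n. U i k * R k j) = h i (?e j)" for j
    proof -
      obtain a where a: "M (?e j) = fseq d (\<lambda>i. \<Sum>k<n. a k * U i k)" using MF unfolding F_def by blast
      then have hi: "h i (?e j) = (\<Sum>k<n. a k * U i k)" if "i < d" for i using that by (simp add: h_def)
      have "R k j = a k" if k: "k < n" for k
      proof -
        have "R k j = (\<Sum>l<n. a l * (\<Sum>i<d. U i k * U i l))"
          unfolding R_def sum_distrib_left
          by (subst sum.swap, intro sum.cong refl) (simp add: hi sum_distrib_left mult_ac)
        also have "\<dots> = (\<Sum>l<n. if k = l then a l else 0)"
          using orth k by (intro sum.cong refl) auto
        finally show ?thesis using k by simp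
      qed
      then show ?thesis unfolding hi[OF i] by (intro sum.cong refl) (simp add: mult.commute)
    qed
    \<comment> \<open>the row norm is the value of the i-th coordinate at a vector of signs\<close>
    let ?\<sigma> = "\<lambda>j. sgn (h i (?e j))"
    have "row_norm n d U R i = h i (fseq d ?\<sigma>)"
      unfolding row_norm_def UR h_seq[of i ?\<sigma>] by (intro sum.cong refl) (simp add: abs_sgn mult.commute)
    also have "\<dots> \<le> norm (M (fseq d ?\<sigma>))"
      unfolding h_def[of i "fseq d ?\<sigma>"] using coord_le_norm[of "M (fseq d ?\<sigma>)" i] by linarith
    also have "\<dots> \<le> K * (onorm Q * K) * norm (fseq d ?\<sigma>)" by (rule Mnorm[OF seqW])
    also have "\<dots> \<le> K * (onorm Q * K) * 1"
      using K onorm_pos_le[OF linQ] by (intro mult_left_mono norm_fseq_le mult_nonneg_nonneg) (auto simp: sgn_if)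
    finally show ?thesis by simp
  qed
  ultimately show ?thesis by blast
qed

section \<open>A norm of maximal projection constant\<close>

text \<open>The topology of pointwise convergence on functions of uncountably many arguments is not first
countable, so a convergent subsequence is not available; a cluster point is.\<close>

lemma compact_sequence_cluster:
  fixes s :: "nat \<Rightarrow> 'a::topological_space"
  assumes S: "compact S" and s: "\<And>k. s k \<in> S"
  shows "\<exists>l\<in>S. \<forall>A. open A \<longrightarrow> l \<in> A \<longrightarrow> (\<forall>k0. \<exists>k\<ge>k0. s k \<in> A)"
proof (rule ccontr)
  assume contra: "\<not> ?thesis"
  have "\<forall>l. \<exists>V. l \<in> S \<longrightarrow> open (fst V) \<and> l \<in> fst V \<and> (\<forall>k\<ge>snd V. s k \<notin> fst V)"
  proof
    fix l
    show "\<exists>V. l \<in> S \<longrightarrow> open (fst V) \<and> l \<in> fst V \<and> (\<forall>k\<ge>snd V. s k \<notin> fst V)"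
    proof (cases "l \<in> S")
      case True
      have "\<not> (\<forall>A. open A \<longrightarrow> l \<in> A \<longrightarrow> (\<forall>k0. \<exists>k\<ge>k0. s k \<in> A))"
        by (rule contrapos_nn[OF contra]) (rule bexI[OF _ True])
      then obtain A k0 where "open A" "l \<in> A" "\<forall>k\<ge>k0. s k \<notin> A" by auto
      then show ?thesis by (intro exI[of _ "(A, k0)"]) simp
    qed simp
  qed
  from choice[OF this] obtain W
    where W: "\<forall>l. l \<in> S \<longrightarrow> open (fst (W l)) \<and> l \<in> fst (W l) \<and> (\<forall>k\<ge>snd (W l). s k \<notin> fst (W l))"
    by (rule exE)
  define V where "V l = fst (W l)" for l
  define k0 where "k0 l = snd (W l)" for l
  have V: "open (V l)" "l \<in> V l" "\<forall>k\<ge>k0 l. s k \<notin> V l" if "l \<in> S" for l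
    using W that unfolding V_def k0_def by blast+
  obtain D where D: "D \<subseteq> S" "finite D" "S \<subseteq> (\<Union>l\<in>D. V l)"
    by (rule compactE_image[OF S, of S V]) (use V in auto)
  let ?k = "Max (insert 0 (k0 ` D))"
  obtain l where l: "l \<in> D" "s ?k \<in> V l" using D(3) s by blast
  have "k0 l \<le> ?k" using D(2) l(1) by (intro Max_ge) auto
  then show False using V(3)[of l] l D(1) by blast
qed

text \<open>The norms on \<open>\<real>\<^sup>n\<close> for which the unit vectors are a bounded basis with coefficients controlled by
\<open>C\<close>. The value off \<open>carrier_vec n\<close> is fixed to 0 so that the set is compact, and the lower
bound by the coordinates keeps a limit of norms from degenerating to a seminorm.\<close>

definition bounded_norms :: "nat \<Rightarrow> real \<Rightarrow> (real vec \<Rightarrow> real) set" where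
  "bounded_norms n C = {N. (\<forall>x. N x \<in> (if x \<in> carrier_vec n then {0..\<Sum>i<n. \<bar>x $ i\<bar>} else {0})) \<and>
     ((\<forall>x i. x \<in> carrier_vec n \<longrightarrow> i < n \<longrightarrow> \<bar>x $ i\<bar> \<le> C * N x) \<and>
      (\<forall>x a. x \<in> carrier_vec n \<longrightarrow> N (a \<cdot>\<^sub>v x) = \<bar>a\<bar> * N x) \<and>
      (\<forall>x y. x \<in> carrier_vec n \<longrightarrow> y \<in> carrier_vec n \<longrightarrow> N (x + y) \<le> N x + N y))}"

lemma compact_bounded_norms: "compact (bounded_norms n C)"
proof -
  let ?K = "\<lambda>x::real vec. if x \<in> carrier_vec n then {0..\<Sum>i<n. \<bar>x $ i\<bar>} else {0}"
  let ?P = "{N :: real vec \<Rightarrow> real. (\<forall>x i. x \<in> carrier_vec n \<longrightarrow> i < n \<longrightarrow> \<bar>x $ i\<bar> \<le> C * N x) \<and>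
      (\<forall>x a. x \<in> carrier_vec n \<longrightarrow> N (a \<cdot>\<^sub>v x) = \<bar>a\<bar> * N x) \<and>
      (\<forall>x y. x \<in> carrier_vec n \<longrightarrow> y \<in> carrier_vec n \<longrightarrow> N (x + y) \<le> N x + N y)}"
  have "closed ?P"
    by (intro closed_Collect_conj closed_Collect_all closed_Collect_imp open_Collect_const
        closed_Collect_eq closed_Collect_le continuous_intros)
  then have "compact ({N. \<forall>x. N x \<in> ?K x} \<inter> ?P)"
    by (intro compact_Int_closed compact_coordinatewise) auto
  moreover have "{N. \<forall>x. N x \<in> ?K x} \<inter> ?P = bounded_norms n C"
    unfolding bounded_norms_def by (rule Collect_conj_eq[symmetric])
  ultimately show ?thesis by simp
qed

lemma bounded_normsD:
  assumes "N \<in> bounded_norms n C" "x \<in> carrier_vec n"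
  shows "0 \<le> N x" "N x \<le> (\<Sum>i<n. \<bar>x $ i\<bar>)" "i < n \<Longrightarrow> \<bar>x $ i\<bar> \<le> C * N x"
    "N (a \<cdot>\<^sub>v x) = \<bar>a\<bar> * N x" "y \<in> carrier_vec n \<Longrightarrow> N (x + y) \<le> N x + N y"
proof -
  have "N x \<in> {0..\<Sum>i<n. \<bar>x $ i\<bar>}" using assms unfolding bounded_norms_def by (auto split: if_splits)
  then show "0 \<le> N x" "N x \<le> (\<Sum>i<n. \<bar>x $ i\<bar>)" by auto
qed (use assms in \<open>auto simp: bounded_norms_def\<close>)

lemma bounded_norms_is_norm:
  assumes N: "N \<in> bounded_norms n C"
  shows "is_norm n N"
  unfolding is_norm_def
proof (intro conjI ballI allI)
  fix x :: "real vec" assume x: "x \<in> carrier_vec n"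
  show "0 \<le> N x" by (rule bounded_normsD(1)[OF N x])
  show "N x = 0 \<longleftrightarrow> x = 0\<^sub>v n"
  proof
    assume "N x = 0"
    then have "x $ i = 0" if "i < n" for i using bounded_normsD(3)[OF N x that] by simp
    then show "x = 0\<^sub>v n" using x by (intro eq_vecI) auto
  next
    assume "x = 0\<^sub>v n"
    then show "N x = 0" using bounded_normsD(1,2)[OF N x] by simp
  qed
  show "N (a \<cdot>\<^sub>v x) = \<bar>a\<bar> * N x" for a by (rule bounded_normsD(4)[OF N x])
  show "N (x + y) \<le> N x + N y" if "y \<in> carrier_vec n" for y by (rule bounded_normsD(5)[OF N x that])
qed

lemma bounded_norms_lipschitz:
  assumes N: "N \<in> bounded_norms n C" and z: "z \<in> carrier_vec n" and y: "y \<in> carrier_vec n"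
  shows "\<bar>N z - N y\<bar> \<le> (\<Sum>i<n. \<bar>z $ i - y $ i\<bar>)"
proof -
  have *: "N u - N v \<le> (\<Sum>i<n. \<bar>u $ i - v $ i\<bar>)" if u: "u \<in> carrier_vec n" and v: "v \<in> carrier_vec n" for u v
  proof -
    have d: "u - v \<in> carrier_vec n" using u v by simp
    have "u = v + (u - v)" using u v by (intro eq_vecI) auto
    then have "N u \<le> N v + N (u - v)" using bounded_normsD(5)[OF N v d] by simp
    also have "N (u - v) \<le> (\<Sum>i<n. \<bar>(u - v) $ i\<bar>)" by (rule bounded_normsD(2)[OF N d])
    also have "\<dots> = (\<Sum>i<n. \<bar>u $ i - v $ i\<bar>)" using u v by (intro sum.cong) auto
    finally show ?thesis by simp
  qed
  have "(\<Sum>i<n. \<bar>y $ i - z $ i\<bar>) = (\<Sum>i<n. \<bar>z $ i - y $ i\<bar>)" by (simp add: abs_minus_commute)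
  then show ?thesis using *[OF z y] *[OF y z] by linarith
qed

text \<open>All norms in the set are Lipschitz with the same constant, so closeness on a finite grid in the unit
cube implies closeness on the cube; scaling with \<open>C * N0 x\<close> puts every vector into the cube.\<close>

lemma bounded_norms_close:
  assumes C: "0 < C" and \<epsilon>: "0 < \<epsilon>"
  obtains X \<delta> where "finite X" "0 < \<delta>"
    "\<And>N N0. N \<in> bounded_norms n C \<Longrightarrow> N0 \<in> bounded_norms n C \<Longrightarrow> (\<forall>y\<in>X. \<bar>N y - N0 y\<bar> < \<delta>) \<Longrightarrow>
      \<forall>x\<in>carrier_vec n. N x \<le> (1 + \<epsilon>) * N0 x \<and> N0 x \<le> (1 + \<epsilon>) * N x"
proof -
  \<comment> \<open>a relative error of \<open>\<epsilon> / (1 + \<epsilon>)\<close> against one norm is at most \<open>\<epsilon>\<close> against either\<close>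
  define \<eta> where "\<eta> = \<epsilon> / ((1 + \<epsilon>) * C)"
  have \<eta>: "0 < \<eta>" using C \<epsilon> by (simp add: \<eta>_def)
  have \<eta>C: "\<eta> * C = \<epsilon> / (1 + \<epsilon>)" using C by (simp add: \<eta>_def)
  obtain M :: nat where M: "0 < M" "4 * real n / \<eta> < M"
    using reals_Archimedean2[of "4 * real n / \<eta>"] \<eta>
    by (metis divide_nonneg_pos gr0I linorder_not_le mult_nonneg_nonneg of_nat_0 of_nat_0_le_iff zero_le_numeral)
  have nM: "2 * (real n / M) \<le> \<eta> / 2"
    using M \<eta> by (simp add: field_simps)
  define G where "G = PiE {..<n} (\<lambda>_. {- int M - 1..int M})"
  define X where "X = (\<lambda>g. vec n (\<lambda>i. real_of_int (g i) / M)) ` G"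
  have X: "finite X" unfolding X_def G_def by (intro finite_imageI finite_PiE) auto
  have main: "\<bar>N x - N0 x\<bar> \<le> \<epsilon> / (1 + \<epsilon>) * N0 x"
    if N: "N \<in> bounded_norms n C" and N0: "N0 \<in> bounded_norms n C"
      and close: "\<forall>y\<in>X. \<bar>N y - N0 y\<bar> < \<eta> / 2" and x: "x \<in> carrier_vec n" for N N0 x
  proof (cases "N0 x = 0")
    case True
    then have "x = 0\<^sub>v n" using bounded_norms_is_norm[OF N0] is_normD(2) x by blast
    then have "N x = 0" using bounded_norms_is_norm[OF N] is_normD(2) x by blast
    then show ?thesis using True by simp
  next
    case False
    define a where "a = C * N0 x"
    have a: "0 < a" using False bounded_normsD(1)[OF N0 x] C by (simp add: a_def)
    define z where "z = (1 / a) \<cdot>\<^sub>v x"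
    have z: "z \<in> carrier_vec n" using x by (simp add: z_def)
    have z1: "\<bar>z $ i\<bar> \<le> 1" if "i < n" for i
      using bounded_normsD(3)[OF N0 x that] a x that by (simp add: z_def a_def abs_divide field_simps)
    define y where "y = vec n (\<lambda>i. real_of_int \<lfloor>M * z $ i\<rfloor> / M)"
    have yX: "y \<in> X"
    proof -
      let ?g = "restrict (\<lambda>i. \<lfloor>M * z $ i\<rfloor>) {..<n}"
      have "?g \<in> G"
        unfolding G_def
      proof (rule restrict_PiE_iff[THEN iffD2], rule ballI)
        fix i assume "i \<in> {..<n}"
        then have zi: "\<bar>z $ i\<bar> \<le> 1" using z1 by simp
        have "\<bar>real M * z $ i\<bar> \<le> real M * 1" unfolding abs_mult using zi by (intro mult_mono) auto
        then have "real_of_int (- int M - 1) \<le> real M * z $ i" "real M * z $ i < real_of_int (int M + 1)"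
          by (simp_all add: abs_le_iff)
        then have "- int M - 1 \<le> \<lfloor>M * z $ i\<rfloor>" "\<lfloor>M * z $ i\<rfloor> < int M + 1"
          by (simp_all only: le_floor_iff floor_less_iff)
        then show "\<lfloor>M * z $ i\<rfloor> \<in> {- int M - 1..int M}" by simp
      qed
      moreover have "y = vec n (\<lambda>i. real_of_int (?g i) / M)"
        unfolding y_def by (intro eq_vecI) auto
      ultimately show ?thesis unfolding X_def by blast
    qed
    have yc: "y \<in> carrier_vec n" by (simp add: y_def)
    have dist: "(\<Sum>i<n. \<bar>z $ i - y $ i\<bar>) \<le> real n / M"
    proof -
      have "\<bar>z $ i - y $ i\<bar> \<le> 1 / M" if "i < n" for i
      proof -
        have "\<bar>M * z $ i - \<lfloor>M * z $ i\<rfloor>\<bar> \<le> 1" by linarith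
        moreover have "z $ i - y $ i = (M * z $ i - \<lfloor>M * z $ i\<rfloor>) / M"
          using M(1) that by (simp add: y_def field_simps)
        ultimately show ?thesis using M(1) by (simp add: divide_right_mono)
      qed
      then have "(\<Sum>i<n. \<bar>z $ i - y $ i\<bar>) \<le> (\<Sum>i<n. 1 / M)" by (intro sum_mono) simp
      then show ?thesis by simp
    qed
    have "\<bar>N z - N0 z\<bar> \<le> \<bar>N z - N y\<bar> + \<bar>N y - N0 y\<bar> + \<bar>N0 z - N0 y\<bar>" by linarith
    also have "\<dots> \<le> real n / M + \<eta> / 2 + real n / M"
      using bounded_norms_lipschitz[OF N z yc] bounded_norms_lipschitz[OF N0 z yc] dist close yX
      by (intro add_mono) (auto intro: less_imp_le)
    also have "\<dots> \<le> \<eta>" using nM by simp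
    finally have "\<bar>N z - N0 z\<bar> \<le> \<eta>" .
    moreover have "N z = N x / a" "N0 z = N0 x / a"
      using bounded_normsD(4)[OF N x, of "1 / a"] bounded_normsD(4)[OF N0 x, of "1 / a"] a by (simp_all add: z_def)
    ultimately have "\<bar>N x / a - N0 x / a\<bar> \<le> \<eta>" by simp
    also have "N x / a - N0 x / a = (N x - N0 x) / a" by (simp add: diff_divide_distrib)
    finally have "\<bar>N x - N0 x\<bar> \<le> \<eta> * a" using a by (simp add: abs_divide divide_le_eq)
    also have "\<eta> * a = \<epsilon> / (1 + \<epsilon>) * N0 x" using \<eta>C by (simp add: a_def mult.assoc[symmetric])
    finally show ?thesis .
  qed
  have close: "N x \<le> (1 + \<epsilon>) * N0 x \<and> N0 x \<le> (1 + \<epsilon>) * N x"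
    if N: "N \<in> bounded_norms n C" and N0: "N0 \<in> bounded_norms n C"
      and close: "\<forall>y\<in>X. \<bar>N y - N0 y\<bar> < \<eta> / 2" and x: "x \<in> carrier_vec n" for N N0 x
  proof -
    have m: "\<bar>N x - N0 x\<bar> \<le> \<epsilon> / (1 + \<epsilon>) * N0 x" by (rule main[OF N N0 close x])
    have N0x: "0 \<le> N0 x" by (rule bounded_normsD(1)[OF N0 x])
    have "\<epsilon> / (1 + \<epsilon>) * N0 x \<le> \<epsilon> * N0 x"
      using \<epsilon> N0x by (intro mult_right_mono) (auto simp: divide_le_eq)
    then have "N x \<le> (1 + \<epsilon>) * N0 x" using m by (simp add: distrib_right)
    moreover have "N0 x * (1 - \<epsilon> / (1 + \<epsilon>)) \<le> N x" using m by (simp add: algebra_simps)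
    then have "N0 x / (1 + \<epsilon>) \<le> N x" using \<epsilon> by (simp add: field_simps)
    then have "N0 x \<le> (1 + \<epsilon>) * N x" using \<epsilon> by (simp add: field_simps)
    ultimately show ?thesis by blast
  qed
  show thesis by (rule that[OF X, of "\<eta> / 2"]) (use \<eta> close in auto)
qed

text \<open>The norm is that of the range of a maximiser \<open>U\<close> in \<open>\<ell>\<^sub>\<infinity>\<^sup>d\<close>, written in a basis with bounded
coefficients. The last property says that every projection onto this range has mean row norm at least
\<open>r\<close>.\<close>

lemma norm_with_large_constant:
  assumes n: "1 \<le> n" and r: "r \<in> positive_row_sums n"
  obtains N d U b where "N \<in> bounded_norms n (2 * 3 ^ n)" "0 < (d::nat)" "orthonormal {..<d} n U"
    "{\<Sum>k<n. a k *\<^sub>R b k | a. True} = {fseq d (\<lambda>i. \<Sum>k<n. a k * U i k) | a. True}"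
    "\<forall>x\<in>carrier_vec n. N x = norm (\<Sum>k<n. (x $ k) *\<^sub>R b k)"
    "\<forall>R. left_inverse n d R U \<longrightarrow> d * r \<le> (\<Sum>i<d. row_norm n d U R i)"
proof -
  obtain d :: nat and U0 where d: "0 < d" and U0: "orthonormal {..<d} n U0"
    and le: "\<forall>i<d. r \<le> (\<Sum>j<d. \<bar>gram n U0 i j\<bar>)"
    by (rule positive_row_sumsE[OF r n])
  obtain U where U: "orthonormal {..<d} n U" and max: "\<And>V. orthonormal {..<d} n V \<Longrightarrow>
      (\<Sum>i<d. \<Sum>j<d. \<bar>gram n V i j\<bar>) \<le> (\<Sum>i<d. \<Sum>j<d. \<bar>gram n U i j\<bar>)"
    using gram_maximizer[OF U0] by blast
  have lower: "d * r \<le> (\<Sum>i<d. row_norm n d U R i)" if R: "left_inverse n d R U" for R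
  proof -
    have "d * r \<le> (\<Sum>i<d. \<Sum>j<d. \<bar>gram n U0 i j\<bar>)"
      using sum_mono[of "{..<d}" "\<lambda>_. r" "\<lambda>i. \<Sum>j<d. \<bar>gram n U0 i j\<bar>"] le by simp
    also have "\<dots> \<le> (\<Sum>i<d. \<Sum>j<d. \<bar>gram n U i j\<bar>)" by (rule max[OF U0])
    also have "\<dots> \<le> (\<Sum>i<d. row_norm n d U R i)"
      by (rule projection_norm_lower_bound[OF U max R])
    finally show ?thesis .
  qed
  let ?F = "{fseq d (\<lambda>i. \<Sum>k<n. a k * U i k) | a. True}"
  have F: "fin_dim n ?F" by (rule orthonormal_span_fin_dim[OF U])
  have sF: "subspace ?F" using F by (rule fin_dim_subspace)
  obtain b where bF: "\<And>k. k < n \<Longrightarrow> b k \<in> ?F" and b1: "\<And>k. k < n \<Longrightarrow> norm (b k) \<le> 1"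
    and gen: "\<And>x. x \<in> ?F \<Longrightarrow> \<exists>a. x = (\<Sum>k<n. a k *\<^sub>R b k)"
    and coef: "\<And>a k. k < n \<Longrightarrow> \<bar>a k\<bar> \<le> 2 * 3 ^ n * norm (\<Sum>k<n. a k *\<^sub>R b k)"
    by (rule bounded_coefficient_basis[OF F]) blast
  have bspan: "{\<Sum>k<n. a k *\<^sub>R b k | a. True} = ?F"
  proof (intro subset_antisym subsetI)
    fix x assume "x \<in> {\<Sum>k<n. a k *\<^sub>R b k | a. True}"
    then obtain a where x: "x = (\<Sum>k<n. a k *\<^sub>R b k)" by blast
    show "x \<in> ?F" unfolding x using bF by (intro subspace_sum[OF sF] subspace_scale[OF sF]) simp
  next
    fix x assume "x \<in> ?F"
    from gen[OF this] show "x \<in> {\<Sum>k<n. a k *\<^sub>R b k | a. True}" by blast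
  qed
  define N where "N x = (if x \<in> carrier_vec n then norm (\<Sum>k<n. (x $ k) *\<^sub>R b k) else 0)" for x
  have "N \<in> bounded_norms n (2 * 3 ^ n)"
    unfolding bounded_norms_def
  proof (intro CollectI conjI allI impI)
    fix x :: "real vec"
    have "norm (\<Sum>k<n. (x $ k) *\<^sub>R b k) \<le> (\<Sum>k<n. \<bar>x $ k\<bar>)"
      using b1 by (intro order.trans[OF norm_sum] sum_mono) (simp add: mult_left_le)
    then show "N x \<in> (if x \<in> carrier_vec n then {0..\<Sum>i<n. \<bar>x $ i\<bar>} else {0})" by (simp add: N_def)
  next
    fix x :: "real vec" and i assume "x \<in> carrier_vec n" "i < n"
    then show "\<bar>x $ i\<bar> \<le> 2 * 3 ^ n * N x" using coef[of i "\<lambda>k. x $ k"] by (simp add: N_def)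
  next
    fix x :: "real vec" and a assume x: "x \<in> carrier_vec n"
    have "(\<Sum>k<n. ((a \<cdot>\<^sub>v x) $ k) *\<^sub>R b k) = a *\<^sub>R (\<Sum>k<n. (x $ k) *\<^sub>R b k)"
      unfolding scaleR_sum_right using x by (intro sum.cong refl) simp
    then show "N (a \<cdot>\<^sub>v x) = \<bar>a\<bar> * N x" using x by (simp add: N_def)
  next
    fix x y :: "real vec" assume xy: "x \<in> carrier_vec n" "y \<in> carrier_vec n"
    have "(\<Sum>k<n. ((x + y) $ k) *\<^sub>R b k) = (\<Sum>k<n. (x $ k) *\<^sub>R b k) + (\<Sum>k<n. (y $ k) *\<^sub>R b k)"
      unfolding sum.distrib[symmetric] scaleR_add_left[symmetric] using xy by (intro sum.cong refl) simp
    then show "N (x + y) \<le> N x + N y" using xy norm_triangle_ineq by (simp add: N_def)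
  qed
  then show thesis using d U bspan lower by (intro that[of N d U b]) (auto simp: N_def)
qed

text \<open>The norm is a cluster point of norms \<open>N\<^sub>k\<close> belonging to row sums that tend to the supremum \<open>\<Lambda>\<close>. A
projection of norm \<open>c < \<Lambda>\<close> for it would give one of norm at most \<open>(1 + \<epsilon>)\<^sup>2 c\<close> for some
\<open>N\<^sub>k\<close> with \<open>k\<close> large.\<close>

lemma maximal_norm_exists:
  assumes n: "1 \<le> n"
  obtains N0 where "is_norm n N0"
    "\<And>T Q. is_isometric_embedding n N0 T \<Longrightarrow> is_projection_onto (T ` carrier_vec n) Q \<Longrightarrow>
      Sup (positive_row_sums n) \<le> onorm Q"
proof -
  let ?\<Lambda> = "Sup (positive_row_sums n)"
  let ?C = "2 * 3 ^ n :: real"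
  have "\<forall>k::nat. \<exists>r. r \<in> positive_row_sums n \<and> ?\<Lambda> - 1 / (real k + 1) < r"
  proof
    fix k :: nat
    have "?\<Lambda> - 1 / (real k + 1) < ?\<Lambda>" by simp
    then show "\<exists>r. r \<in> positive_row_sums n \<and> ?\<Lambda> - 1 / (real k + 1) < r"
      using less_cSupD[OF positive_row_sums_nonempty[OF n]] by blast
  qed
  from choice[OF this] obtain r where r: "\<forall>k. r k \<in> positive_row_sums n \<and> ?\<Lambda> - 1 / (real k + 1) < r k" by (rule exE)
  define good where "good N s \<longleftrightarrow> N \<in> bounded_norms n ?C \<and> (\<exists>d U b. 0 < (d::nat) \<and> orthonormal {..<d} n U \<and>
    {\<Sum>k<n. a k *\<^sub>R b k | a. True} = {fseq d (\<lambda>i. \<Sum>k<n. a k * U i k) | a. True} \<and>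
    (\<forall>x\<in>carrier_vec n. N x = norm (\<Sum>k<n. (x $ k) *\<^sub>R b k)) \<and>
    (\<forall>R. left_inverse n d R U \<longrightarrow> d * s \<le> (\<Sum>i<d. row_norm n d U R i)))" for N s
  have "\<forall>k. \<exists>N. good N (r k)"
  proof
    fix k
    have rk: "r k \<in> positive_row_sums n" using r by blast
    show "\<exists>N. good N (r k)"
      by (rule norm_with_large_constant[OF n rk]) (unfold good_def, blast)
  qed
  from choice[OF this] obtain N where N: "\<forall>k. good (N k) (r k)" by (rule exE)
  then have NB: "N k \<in> bounded_norms n ?C" for k by (simp add: good_def)
  from compact_sequence_cluster[OF compact_bounded_norms NB]
  obtain N0 where N0: "N0 \<in> bounded_norms n ?C"
    and cluster: "\<forall>A. open A \<longrightarrow> N0 \<in> A \<longrightarrow> (\<forall>k0. \<exists>k\<ge>k0. N k \<in> A)" by (rule bexE)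
  have norm0: "is_norm n N0" using N0 by (rule bounded_norms_is_norm)
  have "?\<Lambda> \<le> onorm Q"
    if T: "is_isometric_embedding n N0 T" and Q: "is_projection_onto (T ` carrier_vec n) Q" for T Q
  proof (rule ccontr)
    assume neg: "\<not> ?thesis"
    define c where "c = onorm Q"
    have c: "0 \<le> c" using Q onorm_pos_le unfolding c_def is_projection_onto_def by blast
    define g where "g = ?\<Lambda> - c"
    have g: "0 < g" using neg by (simp add: g_def c_def)
    \<comment> \<open>then \<open>(1 + \<epsilon>)\<^sup>2 c \<le> c + g / 2\<close>, half way to the supremum\<close>
    define \<epsilon> where "\<epsilon> = min 1 (g / (6 * (c + 1)))"
    have \<epsilon>: "0 < \<epsilon>" "\<epsilon> \<le> 1" "\<epsilon> * (6 * (c + 1)) \<le> g"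
    proof -
      show "0 < \<epsilon>" "\<epsilon> \<le> 1" using g c by (auto simp: \<epsilon>_def)
      have "\<epsilon> \<le> g / (6 * (c + 1))" by (simp add: \<epsilon>_def)
      then show "\<epsilon> * (6 * (c + 1)) \<le> g" using c by (simp add: le_divide_eq)
    qed
    obtain k0 :: nat where "2 / g < k0" using reals_Archimedean2 by blast
    then have k0: "1 / (real k0 + 1) \<le> g / 2" using g by (simp add: field_simps)
    have C: "0 < ?C" by simp
    obtain X \<delta> where X: "finite X" "0 < \<delta>"
      and close: "\<And>N N0. N \<in> bounded_norms n ?C \<Longrightarrow> N0 \<in> bounded_norms n ?C \<Longrightarrow> (\<forall>y\<in>X. \<bar>N y - N0 y\<bar> < \<delta>) \<Longrightarrow>
      \<forall>x\<in>carrier_vec n. N x \<le> (1 + \<epsilon>) * N0 x \<and> N0 x \<le> (1 + \<epsilon>) * N x"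
      by (rule bounded_norms_close[OF C \<epsilon>(1), of n]) blast
    let ?A = "\<Inter>y\<in>X. {N :: real vec \<Rightarrow> real. \<bar>N y - N0 y\<bar> < \<delta>}"
    have "open ?A" using X(1) by (intro open_INT ballI open_Collect_less continuous_intros) auto
    moreover have "N0 \<in> ?A" using X(2) by simp
    ultimately obtain k where k: "k0 \<le> k" "N k \<in> ?A" using cluster by blast
    then have "\<forall>y\<in>X. \<bar>N k y - N0 y\<bar> < \<delta>" by simp
    then have cl: "\<forall>x\<in>carrier_vec n. N k x \<le> (1 + \<epsilon>) * N0 x \<and> N0 x \<le> (1 + \<epsilon>) * N k x"
      by (rule close[OF NB N0])
    have "good (N k) (r k)" using N by blast
    then obtain d U b where d: "0 < (d::nat)" and U: "orthonormal {..<d} n U"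
      and F: "{\<Sum>k<n. a k *\<^sub>R b k | a. True} = {fseq d (\<lambda>i. \<Sum>k<n. a k * U i k) | a. True}"
      and Nk: "\<forall>x\<in>carrier_vec n. N k x = norm (\<Sum>k<n. (x $ k) *\<^sub>R b k)"
      and lower: "\<forall>R. left_inverse n d R U \<longrightarrow> d * r k \<le> (\<Sum>i<d. row_norm n d U R i)"
      unfolding good_def by blast
    have K: "0 \<le> 1 + \<epsilon>" using \<epsilon> by simp
    have le1: "N0 x \<le> (1 + \<epsilon>) * norm (\<Sum>k<n. (x $ k) *\<^sub>R b k)"
      and le2: "norm (\<Sum>k<n. (x $ k) *\<^sub>R b k) \<le> (1 + \<epsilon>) * N0 x" if "x \<in> carrier_vec n" for x
      using cl Nk that by auto
    obtain R where R: "left_inverse n d R U" and Rc: "\<forall>i<d. row_norm n d U R i \<le> (1 + \<epsilon>) * (c * (1 + \<epsilon>))"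
      using projection_transfer[OF norm0 T Q U F K le1 le2] unfolding c_def by blast
    have "d * r k \<le> (\<Sum>i<d. row_norm n d U R i)" using lower R by blast
    also have "\<dots> \<le> (\<Sum>i<d. (1 + \<epsilon>) * (c * (1 + \<epsilon>)))" using Rc by (intro sum_mono) simp
    also have "\<dots> = d * ((1 + \<epsilon>) * (c * (1 + \<epsilon>)))" by simp
    finally have "r k \<le> (1 + \<epsilon>) * (c * (1 + \<epsilon>))" using d by simp
    also have "\<dots> = c + \<epsilon> * ((2 + \<epsilon>) * c)" by (simp add: algebra_simps)
    also have "\<dots> \<le> c + \<epsilon> * (3 * (c + 1))"
      using \<epsilon> c by (intro add_left_mono mult_left_mono mult_mono) auto
    also have "\<dots> \<le> c + g / 2" using \<epsilon>(3) by (simp add: algebra_simps)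
    also have "c + g / 2 = ?\<Lambda> - g / 2" by (simp add: g_def field_simps)
    also have "\<dots> \<le> ?\<Lambda> - 1 / (real k0 + 1)" using k0 by simp
    also have "\<dots> \<le> ?\<Lambda> - 1 / (real k + 1)" using k(1) by (simp add: frac_le)
    also have "\<dots> < r k" using r by blast
    finally show False by simp
  qed
  then show thesis using norm0 that by blast
qed

theorem corollary1p5:
  fixes n :: nat
  assumes "n \<ge> 1"
  shows "max_proj_const n =
    Sup {min_row_sum (abs_mat P) | P. P \<in> orth_proj_mats n \<and> positive_mat (abs_mat P)}"
proof -
  let ?\<Lambda> = "Sup (positive_row_sums n)"
  have bdd: "bdd_above (positive_row_sums n)"
    by (rule bdd_aboveI) (rule positive_row_sums_bdd[OF _ assms])
  have upper: "r \<le> ?\<Lambda>" if "r \<in> positive_row_sums n" for r using that bdd by (rule cSup_upper)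
  have nonneg: "0 \<le> ?\<Lambda>"
  proof -
    obtain r where r: "r \<in> positive_row_sums n" using positive_row_sums_nonempty[OF assms] by blast
    show ?thesis using positive_row_sums_nonneg[OF r assms] upper[OF r] by simp
  qed
  have emb: "is_isometric_embedding n N (SOME T. is_isometric_embedding n N T)" if "is_norm n N" for N
    using isometric_embedding_exists[OF that] by (rule someI_ex)
  have le: "abs_proj_const n N \<le> ?\<Lambda>" if N: "is_norm n N" for N
    unfolding abs_proj_const_def
    by (rule rel_proj_const_le(1)[OF assms embedding_range_fin_dim[OF N emb[OF N]] upper nonneg])
  obtain N0 where N0: "is_norm n N0"
    and lower: "\<And>T Q. is_isometric_embedding n N0 T \<Longrightarrow> is_projection_onto (T ` carrier_vec n) Q \<Longrightarrow> ?\<Lambda> \<le> onorm Q"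
    by (rule maximal_norm_exists[OF assms]) blast
  let ?E = "(SOME T. is_isometric_embedding n N0 T) ` carrier_vec n"
  have E: "fin_dim n ?E" by (rule embedding_range_fin_dim[OF N0 emb[OF N0]])
  obtain Q where "is_projection_onto ?E Q" "rel_proj_const ?E = onorm Q"
    by (rule rel_proj_const_attained[OF E rel_proj_const_le(2)[OF assms E upper nonneg]])
  then have "?\<Lambda> \<le> abs_proj_const n N0"
    unfolding abs_proj_const_def using lower[OF emb[OF N0]] by simp
  then have eq: "?\<Lambda> = abs_proj_const n N0" using le[OF N0] by simp
  have "max_proj_const n = ?\<Lambda>"
    unfolding max_proj_const_def
  proof (rule Greatest_equality)
    show "?\<Lambda> \<in> {abs_proj_const n N | N. is_norm n N}" using eq N0 by blast
  next
    fix y assume "y \<in> {abs_proj_const n N | N. is_norm n N}"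
    then show "y \<le> ?\<Lambda>" using le by blast
  qed
  then show ?thesis unfolding positive_row_sums_def .
qed

end
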